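(* Let $k$ be an infinite perfect field that admits at least one Galois extension of degree $8$. Then the set $\mathcal B$ of representatives of Bertini involutions with a base point of degree $8$, up to conjugacy by $\mathrm{PGL}_3(k)$, has at least the same cardinality as the field $k$.
   Context: Let $k^a$ be an algebraic closure of $k$. A point of degree $8$ in $\mathbb P^2$ is an orbit $p=\{p_1,\dots,p_8\}\subset\mathbb P^2(k^a)$ of cardinality 8 under $\mathrm{Gal}(k^a/k)$. It is general if the blow-up of $p$ is a del Pezzo surface of degree 1, that is, no line (over $k^a$) contains 3 of the $p_i$, no conic contains 6 of them, and no cubic is singular at one of them and contains all the others. For such $p$, the pencil of cubics through $p$ has smooth general member and base locus $p\cup\{q\}$ with $q\in\mathbb P^2(k)$; the Bertini involution $b\in\mathrm{Bir}_k(\mathbb P^2)$ with base point $p$ sends a general point $x$ to $-x$ for the group law with neutral element $q$ on the smooth cubic of the pencil through $x$. $\mathrm{PGL}_3(k)=\mathrm{Aut}_k(\mathbb P^2)$ acts on Bertini involutions by conjugation. *)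

theory Defs
  imports
    "HOL-Analysis.Cartesian_Space"
    "HOL-Library.Equipollence"
    "HOL-Library.Poly_Mapping"
    "HOL-Algebra.Algebraic_Closure_Type"
begin

unbundle no fps_syntax

section \<open>Field-theoretic hypotheses\<close>

text \<open>The algebraic closure of \<open>'k\<close> is \<^typ>\<open>'k alg_closure\<close>, and \<open>'k\<close> is embedded in it by
  \<^const>\<open>to_ac\<close>.\<close>

definition separable_poly :: "'k::field poly \<Rightarrow> bool" where
  "separable_poly f \<longleftrightarrow> rsquarefree (map_poly to_ac f)"

definition perfect_field :: "'k::field itself \<Rightarrow> bool" where
  "perfect_field _ \<longleftrightarrow> (\<forall>f::'k poly. irreducible f \<longrightarrow> separable_poly f)"

definition intermediate_field :: "'k::field alg_closure set \<Rightarrow> bool" where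
  "intermediate_field L \<longleftrightarrow>
     range to_ac \<subseteq> L \<and>
     (\<forall>x\<in>L. \<forall>y\<in>L. x - y \<in> L \<and> x * y \<in> L) \<and> (\<forall>x\<in>L. inverse x \<in> L)"

definition ext_degree :: "'k::field alg_closure set \<Rightarrow> nat" where
  "ext_degree L = vector_space.dim (\<lambda>(c::'k) x. to_ac c * x) L"

definition normal_ext :: "'k::field alg_closure set \<Rightarrow> bool" where
  "normal_ext L \<longleftrightarrow>
     (\<forall>f::'k poly. irreducible f \<and> (\<exists>x\<in>L. poly (map_poly to_ac f) x = 0) \<longrightarrow>
        {x. poly (map_poly to_ac f) x = 0} \<subseteq> L)"

definition separable_ext :: "'k::field alg_closure set \<Rightarrow> bool" where
  "separable_ext L \<longleftrightarrow>
     (\<forall>f::'k poly. irreducible f \<and> (\<exists>x\<in>L. poly (map_poly to_ac f) x = 0) \<longrightarrow> separable_poly f)"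

text \<open>Every algebraic extension of \<open>'k\<close> embeds over \<open>'k\<close> in \<^typ>\<open>'k alg_closure\<close>, so it suffices
  to consider subfields of the latter. As \<open>vector_space.dim\<close> is \<open>0\<close> in the absence of a finite
  basis, a positive degree entails that the extension is finite.\<close>

definition galois_ext :: "'k::field alg_closure set \<Rightarrow> bool" where
  "galois_ext L \<longleftrightarrow> intermediate_field L \<and> normal_ext L \<and> separable_ext L"

definition abs_galois_group :: "('k::field alg_closure \<Rightarrow> 'k alg_closure) set" where
  "abs_galois_group =
     {\<sigma>. bij \<sigma> \<and> (\<forall>x y. \<sigma> (x + y) = \<sigma> x + \<sigma> y) \<and> (\<forall>x y. \<sigma> (x * y) = \<sigma> x * \<sigma> y) \<and>
         (\<forall>c. \<sigma> (to_ac c) = to_ac c)}"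


section \<open>Polynomials in three variables\<close>

text \<open>The variables are indexed by the three-element type \<open>3\<close>, which is also the index type of
  coordinate vectors; an exponent is a finitely supported function \<open>3 \<Rightarrow>\<^sub>0 nat\<close>.\<close>

type_synonym 'a poly3 = "(3 \<Rightarrow>\<^sub>0 nat) \<Rightarrow>\<^sub>0 'a"

definition homog :: "nat \<Rightarrow> 'a::zero poly3 \<Rightarrow> bool" where
  "homog d F \<longleftrightarrow> (\<forall>m \<in> Poly_Mapping.keys F. (\<Sum>i\<in>UNIV. Poly_Mapping.lookup m i) = d)"

definition eval3 :: "'a::comm_semiring_1 poly3 \<Rightarrow> 'a ^ 3 \<Rightarrow> 'a" where
  "eval3 F v = (\<Sum>m \<in> Poly_Mapping.keys F.
     Poly_Mapping.lookup F m * (\<Prod>i\<in>UNIV. (v $ i) ^ Poly_Mapping.lookup m i))"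

definition const3 :: "'a::zero \<Rightarrow> 'a poly3" where
  "const3 c = Poly_Mapping.single 0 c"

definition var3 :: "3 \<Rightarrow> 'a::zero_neq_one poly3" where
  "var3 i = Poly_Mapping.single (Poly_Mapping.single i 1) 1"

definition subst3 :: "'a::comm_semiring_1 poly3 \<Rightarrow> 'a poly3 ^ 3 \<Rightarrow> 'a poly3" where
  "subst3 F g = (\<Sum>m \<in> Poly_Mapping.keys F.
     const3 (Poly_Mapping.lookup F m) * (\<Prod>i\<in>UNIV. (g $ i) ^ Poly_Mapping.lookup m i))"

definition pderiv3 :: "3 \<Rightarrow> 'a::comm_semiring_1 poly3 \<Rightarrow> 'a poly3" where
  "pderiv3 i F = (\<Sum>m \<in> Poly_Mapping.keys F.
     Poly_Mapping.single (m - Poly_Mapping.single i 1)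
       (of_nat (Poly_Mapping.lookup m i) * Poly_Mapping.lookup F m))"


section \<open>The projective plane and its curves\<close>

text \<open>A point of the projective plane is the set of all its vectors of homogeneous coordinates.\<close>

definition proj_pt :: "'a::field ^ 3 \<Rightarrow> ('a ^ 3) set" where
  "proj_pt v = {c *s v | c. c \<noteq> 0}"

definition P2 :: "('a::field ^ 3) set set" where
  "P2 = {proj_pt v | v. v \<noteq> 0}"

definition plane_curve :: "nat \<Rightarrow> 'a::field poly3 \<Rightarrow> bool" where
  "plane_curve d F \<longleftrightarrow> F \<noteq> 0 \<and> homog d F"

definition on_curve :: "'a::field poly3 \<Rightarrow> ('a ^ 3) set \<Rightarrow> bool" where
  "on_curve F x \<longleftrightarrow> (\<forall>v\<in>x. eval3 F v = 0)"

definition singular_at :: "'a::field poly3 \<Rightarrow> ('a ^ 3) set \<Rightarrow> bool" where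
  "singular_at F x \<longleftrightarrow> on_curve F x \<and> (\<forall>i. on_curve (pderiv3 i F) x)"

text \<open>Only to be used over an algebraically closed field.\<close>

definition smooth_curve :: "'a::field poly3 \<Rightarrow> bool" where
  "smooth_curve F \<longleftrightarrow> \<not> (\<exists>x\<in>P2. singular_at F x)"


section \<open>The group law on a smooth cubic\<close>

text \<open>The cubic \<open>F\<close> cuts out on some line the divisor \<open>x + y + z\<close>: the line is spanned by \<open>u\<close> and
  \<open>v\<close>, the three points have coordinates \<open>a\<close>, \<open>b\<close>, \<open>c\<close> with respect to \<open>u\<close>, \<open>v\<close>, and the
  restriction of \<open>F\<close> to the line is a nonzero multiple of the product of the linear forms that
  vanish at these points. Multiplicities are thereby taken into account, e.g. the line is the
  tangent at \<open>x\<close> if \<open>x = y\<close>. Over an infinite field equality of the values is equality of the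
  binary forms.\<close>

definition line_section ::
  "'a::field poly3 \<Rightarrow> ('a ^ 3) set \<Rightarrow> ('a ^ 3) set \<Rightarrow> ('a ^ 3) set \<Rightarrow> bool" where
  "line_section F x y z \<longleftrightarrow>
     x \<in> P2 \<and> y \<in> P2 \<and> z \<in> P2 \<and>
     (\<exists>u v a1 a2 b1 b2 c1 c2 e.
        (\<forall>s t. s *s u + t *s v = 0 \<longrightarrow> s = 0 \<and> t = 0) \<and>
        x = proj_pt (a1 *s u + a2 *s v) \<and>
        y = proj_pt (b1 *s u + b2 *s v) \<and>
        z = proj_pt (c1 *s u + c2 *s v) \<and>
        e \<noteq> 0 \<and>
        (\<forall>s t. eval3 F (s *s u + t *s v) =
           e * (s * a2 - t * a1) * (s * b2 - t * b1) * (s * c2 - t * c1)))"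

text \<open>Chord-tangent construction of the group law with neutral element \<open>q\<close>, which need not be an
  inflection point: \<open>x + y = z\<close> iff the third point \<open>w\<close> of the cubic on the line through \<open>x\<close> and
  \<open>y\<close> is also the third point on the line through \<open>q\<close> and \<open>z\<close>.\<close>

definition cubic_add ::
  "'a::field poly3 \<Rightarrow> ('a ^ 3) set \<Rightarrow> ('a ^ 3) set \<Rightarrow> ('a ^ 3) set \<Rightarrow> ('a ^ 3) set \<Rightarrow> bool" where
  "cubic_add F q x y z \<longleftrightarrow> (\<exists>w. line_section F x y w \<and> line_section F w q z)"

definition cubic_neg ::
  "'a::field poly3 \<Rightarrow> ('a ^ 3) set \<Rightarrow> ('a ^ 3) set \<Rightarrow> ('a ^ 3) set \<Rightarrow> bool" where
  "cubic_neg F q x y \<longleftrightarrow> cubic_add F q x y q"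


section \<open>Birational maps of the plane\<close>

text \<open>A rational map of the plane over \<open>'k\<close> is the class of a nonzero triple of forms of the same
  degree with coefficients in \<open>'k\<close>, two triples being identified if they are proportional.\<close>

definition rat_triple :: "'k::field poly3 ^ 3 \<Rightarrow> bool" where
  "rat_triple f \<longleftrightarrow> f \<noteq> 0 \<and> (\<exists>d. \<forall>i. homog d (f $ i))"

definition rat_eq :: "'k::field poly3 ^ 3 \<Rightarrow> 'k poly3 ^ 3 \<Rightarrow> bool" where
  "rat_eq f g \<longleftrightarrow> rat_triple f \<and> rat_triple g \<and> (\<forall>i j. f $ i * g $ j = f $ j * g $ i)"

definition rat_class :: "'k::field poly3 ^ 3 \<Rightarrow> ('k poly3 ^ 3) set" where
  "rat_class f = {g. rat_eq f g}"

definition Rat2 :: "('k::field poly3 ^ 3) set set" where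
  "Rat2 = {rat_class f | f. rat_triple f}"

text \<open>The composite is the empty set when it is undefined, that is, when the substituted triple
  vanishes identically.\<close>

definition rat_comp ::
  "('k::field poly3 ^ 3) set \<Rightarrow> ('k poly3 ^ 3) set \<Rightarrow> ('k poly3 ^ 3) set"
  (infixl \<open>\<circ>\<^sub>R\<close> 70) where
  "\<phi> \<circ>\<^sub>R \<psi> = {h. \<exists>f\<in>\<phi>. \<exists>g\<in>\<psi>. rat_eq (\<chi> i. subst3 (f $ i) g) h}"

definition rat_id :: "('k::field poly3 ^ 3) set" where
  "rat_id = rat_class (\<chi> i. var3 i)"

definition Bir2 :: "('k::field poly3 ^ 3) set set" where
  "Bir2 = {\<phi> \<in> Rat2. \<exists>\<psi>\<in>Rat2. \<phi> \<circ>\<^sub>R \<psi> = rat_id \<and> \<psi> \<circ>\<^sub>R \<phi> = rat_id}"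

text \<open>\<open>PGL_map A\<close>, for invertible \<open>A\<close>, is the automorphism of the plane given by the class of \<open>A\<close>
  in \<open>PGL\<^sub>3\<close>.\<close>

definition PGL_map :: "'k::field ^ 3 ^ 3 \<Rightarrow> ('k poly3 ^ 3) set" where
  "PGL_map A = rat_class (\<chi> i. \<Sum>j\<in>UNIV. const3 (A $ i $ j) * var3 j)"

definition PGL3_conj :: "(('k::field poly3 ^ 3) set \<times> ('k poly3 ^ 3) set) set" where
  "PGL3_conj = {(\<phi>, \<psi>). \<exists>A. invertible A \<and> \<psi> = PGL_map A \<circ>\<^sub>R \<phi> \<circ>\<^sub>R PGL_map (matrix_inv A)}"

text \<open>\<open>rat_maps_to \<phi> x y\<close>: the rational map \<open>\<phi>\<close> is defined at the geometric point \<open>x\<close>, with value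
  \<open>y\<close>.\<close>

definition rat_maps_to ::
  "('k::field poly3 ^ 3) set \<Rightarrow> ('k alg_closure ^ 3) set \<Rightarrow> ('k alg_closure ^ 3) set \<Rightarrow> bool" where
  "rat_maps_to \<phi> x y \<longleftrightarrow>
     (\<exists>f\<in>\<phi>. \<exists>v\<in>x.
        let w = (\<chi> i. eval3 (Poly_Mapping.map to_ac (f $ i)) v)
        in w \<noteq> 0 \<and> y = proj_pt w)"


section \<open>Bertini involutions\<close>

definition galois_act ::
  "('k::field alg_closure \<Rightarrow> 'k alg_closure) \<Rightarrow> ('k alg_closure ^ 3) set \<Rightarrow> ('k alg_closure ^ 3) set"
  where "galois_act \<sigma> x = (\<lambda>v. \<chi> i. \<sigma> (v $ i)) ` x"

definition closed_point_of_degree ::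
  "nat \<Rightarrow> ('k::field alg_closure ^ 3) set set \<Rightarrow> bool" where
  "closed_point_of_degree n p \<longleftrightarrow>
     (\<exists>x\<in>P2. p = {galois_act \<sigma> x | \<sigma>. \<sigma> \<in> abs_galois_group}) \<and> finite p \<and> card p = n"

definition general_points :: "('a::field ^ 3) set set \<Rightarrow> bool" where
  "general_points p \<longleftrightarrow>
     (\<forall>F. plane_curve 1 F \<longrightarrow> card {x\<in>p. on_curve F x} < 3) \<and>
     (\<forall>F. plane_curve 2 F \<longrightarrow> card {x\<in>p. on_curve F x} < 6) \<and>
     (\<forall>F. plane_curve 3 F \<longrightarrow> \<not> ((\<forall>x\<in>p. on_curve F x) \<and> (\<exists>x\<in>p. singular_at F x)))"

definition cubics_through :: "('a::field ^ 3) set set \<Rightarrow> 'a poly3 set" where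
  "cubics_through p = {F. plane_curve 3 F \<and> (\<forall>x\<in>p. on_curve F x)}"

text \<open>For a general point \<open>x\<close>, i.e. off some curve \<open>H = 0\<close>, the map sends \<open>x\<close> to \<open>-x\<close> on the smooth
  cubic through \<open>x\<close> in the pencil. The ninth base point \<open>q\<close> is determined by \<open>p\<close>, and it is a
  \<open>'k\<close>-point because it is fixed by the Galois group.\<close>

definition is_bertini ::
  "('k::field alg_closure ^ 3) set set \<Rightarrow> ('k poly3 ^ 3) set \<Rightarrow> bool" where
  "is_bertini p \<phi> \<longleftrightarrow>
     \<phi> \<in> Bir2 \<and>
     (\<exists>q. q \<notin> p \<and> {x\<in>P2. \<forall>F\<in>cubics_through p. on_curve F x} = insert q p \<and>
        (\<exists>d H. plane_curve d H \<and>
           (\<forall>x\<in>P2. \<not> on_curve H x \<longrightarrow>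
              (\<exists>F\<in>cubics_through p. smooth_curve F \<and> on_curve F x \<and>
                 (\<exists>y. rat_maps_to \<phi> x y \<and> cubic_neg F q x y)))))"

definition bertini_involutions :: "nat \<Rightarrow> ('k::field poly3 ^ 3) set set" where
  "bertini_involutions n =
     {\<phi>. \<exists>p. closed_point_of_degree n p \<and> general_points p \<and> is_bertini p \<phi>}"

end

theory Submission
  imports Defs
begin

text \<open>
  The eight points are placed on the cuspidal cubic \<open>x\<^sup>2 z = y\<^sup>3\<close>, parametrised by
  \<open>s \<mapsto> (1, s, s\<^sup>3)\<close>, with the conjugates \<open>s\<^sub>i\<close> of an element of degree 8 and trace 0 as parameters.
  On this curve a form of degree \<open>d\<close> becomes a polynomial of degree at most \<open>3d\<close> without term of degree
  \<open>3d - 1\<close>, so that general position only means that no sum of at most three of the \<open>s\<^sub>i\<close> vanishes,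
  and the ninth base point of the pencil is the point \<open>(1 : 0 : 0)\<close> with parameter 0. Its tangential
  point \<open>w\<close> on the members of the pencil is given by forms in the parameter of the pencil, and
  \<open>- x\<close> is the third point of the line through \<open>x\<close> and \<open>w\<close>; this makes the Bertini involution explicit
  in every characteristic.

  The involution contracts, for each \<open>i\<close>, the curve of the inverses of the \<open>i\<close>-th point in the members of
  the pencil, while its fibres over other points than the nine base points are finite. A
  projectivity that conjugates two Bertini involutions thus maps the base points of the one to base points
  of the other. For a generic line of elements of degree 8 a cross-ratio of five of the points is not
  constant along the line, hence every conjugacy class is met only finitely often.
\<close>

text \<open>Conjugacy concerns classes of triples of forms and does not mention base points, so the
  base points must be recovered from the map itself, whose explicit triple may have common factors.
  What is recovered is weak: the ninth base point is not told apart from the eight, so an image is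
  only known to be one of nine points. This is enough: five points have at most 9^5 systems of
  images, and each system prescribes a cross-ratio, that is, one polynomial equation in the
  parameter of the line. The line passes, at a parameter in the algebraic closure, through a
  configuration in which two of the five points collide; there the cross-ratio degenerates, so none
  of the equations that occur is an identity.

  The trace is 0 because the nine zeros of a cubic on the cuspidal curve have sum 0: the ninth
  parameter is then 0 and rational over k. The characteristic matters mainly for the smoothness of
  the general member, where the discriminant argument divides by 2 and characteristic 2 needs an
  elimination of its own.\<close>

no_notation fps_nth (infixl \<open>$\<close> 75)

section \<open>Evaluation of polynomials in three variables\<close>

definition mon3 :: "'a::comm_semiring_1 ^ 3 \<Rightarrow> (3 \<Rightarrow>\<^sub>0 nat) \<Rightarrow> 'a" where
  "mon3 v m = (\<Prod>i\<in>UNIV. v $ i ^ Poly_Mapping.lookup m i)"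

lemma mon3_0 [simp]: "mon3 v 0 = 1"
  by (simp add: mon3_def)

lemma mon3_add: "mon3 v (m + n) = mon3 v m * mon3 v n"
  by (simp add: mon3_def lookup_add power_add prod.distrib)

lemma mon3_single [simp]: "mon3 v (Poly_Mapping.single i e) = v $ i ^ e"
proof -
  have "mon3 v (Poly_Mapping.single i e) = (\<Prod>j\<in>UNIV. if j = i then v $ i ^ e else 1)"
    unfolding mon3_def by (rule prod.cong) (auto simp: lookup_single)
  then show ?thesis by simp
qed

lemma mon3_scale: "mon3 (c *s v) m = c ^ (\<Sum>i\<in>UNIV. Poly_Mapping.lookup m i) * mon3 v m"
  by (simp add: mon3_def power_mult_distrib prod.distrib power_sum)

lemma poly_mapping_sum_monomials:
  "(\<Sum>m\<in>Poly_Mapping.keys F. Poly_Mapping.single m (Poly_Mapping.lookup F m)) = F"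
  by (intro poly_mapping_eqI) (auto simp: lookup_sum lookup_single when_def in_keys_iff)

text \<open>The coefficients are mapped by \<open>h\<close> before evaluation: the identity gives
  values over the field of coefficients, \<open>to_ac\<close> gives the values of forms over k at
  geometric points. Both cases share the lemmas of \<open>ring_hom3\<close>.\<close>

definition evh :: "('a::zero \<Rightarrow> 'b::comm_semiring_1) \<Rightarrow> 'a poly3 \<Rightarrow> 'b ^ 3 \<Rightarrow> 'b" where
  "evh h F v = (\<Sum>m\<in>Poly_Mapping.keys F. h (Poly_Mapping.lookup F m) * mon3 v m)"

locale ring_hom3 =
  fixes h :: "'a::comm_ring_1 \<Rightarrow> 'b::comm_ring_1"
  assumes h_0: "h 0 = 0" and h_1: "h 1 = 1"
    and h_add: "\<And>x y. h (x + y) = h x + h y"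
    and h_mult: "\<And>x y. h (x * y) = h x * h y"
begin

lemmas hom = h_0 h_1 h_add h_mult

lemma h_uminus: "h (- x) = - h x"
  using h_add[of x "-x"] by (simp add: eq_neg_iff_add_eq_0 add.commute hom)

lemma evh_superset:
  assumes "finite A" "Poly_Mapping.keys F \<subseteq> A"
  shows "evh h F v = (\<Sum>m\<in>A. h (Poly_Mapping.lookup F m) * mon3 v m)"
  unfolding evh_def using assms by (intro sum.mono_neutral_left) (auto simp: in_keys_iff hom)

lemma evh_0 [simp]: "evh h 0 v = 0"
  by (simp add: evh_def hom)

lemma evh_single [simp]: "evh h (Poly_Mapping.single m c) v = h c * mon3 v m"
  by (simp add: evh_def hom)

lemma evh_add [simp]: "evh h (F + G) v = evh h F v + evh h G v"
proof -
  let ?A = "Poly_Mapping.keys F \<union> Poly_Mapping.keys G"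
  have "evh h (F + G) v = (\<Sum>m\<in>?A. h (Poly_Mapping.lookup (F + G) m) * mon3 v m)"
    using keys_add[of F G] by (intro evh_superset) auto
  also have "\<dots> = (\<Sum>m\<in>?A. h (Poly_Mapping.lookup F m) * mon3 v m)
      + (\<Sum>m\<in>?A. h (Poly_Mapping.lookup G m) * mon3 v m)"
    by (simp add: lookup_add hom distrib_right sum.distrib)
  also have "\<dots> = evh h F v + evh h G v"
    by (simp add: evh_superset[of ?A])
  finally show ?thesis .
qed

lemma evh_uminus [simp]: "evh h (- F) v = - evh h F v"
  using evh_add[of F "-F" v] by (simp add: eq_neg_iff_add_eq_0 add.commute hom)

lemma evh_diff [simp]: "evh h (F - G) v = evh h F v - evh h G v"
  using evh_add[of F "-G" v] by simp

lemma evh_sum [simp]: "evh h (sum f A) v = (\<Sum>x\<in>A. evh h (f x) v)"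
  by (induction A rule: infinite_finite_induct) auto

lemma evh_mult [simp]: "evh h (F * G) v = evh h F v * evh h G v"
proof -
  have "F * G = (\<Sum>m\<in>Poly_Mapping.keys F. Poly_Mapping.single m (Poly_Mapping.lookup F m)) *
      (\<Sum>n\<in>Poly_Mapping.keys G. Poly_Mapping.single n (Poly_Mapping.lookup G n))"
    by (simp add: poly_mapping_sum_monomials)
  also have "\<dots> = (\<Sum>m\<in>Poly_Mapping.keys F. \<Sum>n\<in>Poly_Mapping.keys G.
      Poly_Mapping.single (m + n) (Poly_Mapping.lookup F m * Poly_Mapping.lookup G n))"
    by (simp add: sum_product mult_single)
  finally have e: "F * G = \<dots>" .
  show ?thesis
    unfolding e evh_sum evh_single mon3_add
    by (simp add: evh_def sum_product mult_ac hom)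
qed

lemma evh_const [simp]: "evh h (const3 c) v = h c"
  by (simp add: const3_def hom)

lemma evh_var [simp]: "evh h (var3 i) v = v $ i"
  by (simp add: var3_def hom)

lemma evh_1 [simp]: "evh h 1 v = 1"
  using evh_const[of 1 v] by (simp add: const3_def hom)

lemma evh_prod [simp]: "evh h (prod f A) v = (\<Prod>x\<in>A. evh h (f x) v)"
  by (induction A rule: infinite_finite_induct) auto

lemma evh_power [simp]: "evh h (F ^ n) v = evh h F v ^ n"
  by (induction n) auto

lemma evh_numeral [simp]: "evh h (numeral n) v = numeral n"
proof -
  have "evh h (of_nat k) v = of_nat k" for k
    by (induction k) auto
  from this[of "numeral n"] show ?thesis by simp
qed

lemma evh_subst [simp]: "evh h (subst3 F g) v = evh h F (\<chi> i. evh h (g $ i) v)"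
  by (simp add: subst3_def hom evh_def[of h F] mon3_def)

lemma evh_homog:
  assumes "homog d F"
  shows "evh h F (c *s v) = c ^ d * evh h F v"
  using assms unfolding evh_def homog_def sum_distrib_left
  by (intro sum.cong) (auto simp: mon3_scale mult_ac)

end

interpretation id_hom: ring_hom3 "\<lambda>x. x" by unfold_locales auto
interpretation ac: ring_hom3 to_ac by unfold_locales auto

lemma eval3_evh: "eval3 F v = evh (\<lambda>x. x) F v"
  by (simp add: eval3_def evh_def mon3_def)

lemma eval3_map_to_ac: "eval3 (Poly_Mapping.map to_ac F) v = evh to_ac F v"
proof -
  have l: "Poly_Mapping.lookup (Poly_Mapping.map to_ac F) m = to_ac (Poly_Mapping.lookup F m)" for m
    by (simp add: Poly_Mapping.map.rep_eq when_def)
  have "Poly_Mapping.keys (Poly_Mapping.map to_ac F) = Poly_Mapping.keys F"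
    by (auto simp: in_keys_iff l)
  then show ?thesis by (simp add: eval3_def evh_def mon3_def l)
qed

section \<open>Homogeneous forms\<close>

lemma homog_0 [simp]: "homog d 0"
  by (simp add: homog_def)

lemma homog_add: "homog d F \<Longrightarrow> homog d G \<Longrightarrow> homog d (F + G)"
  using keys_add[of F G] by (auto simp: homog_def)

lemma homog_uminus: "homog d F \<Longrightarrow> homog d (- F :: 'a::comm_ring_1 poly3)"
  by (auto simp: homog_def in_keys_iff)

lemma homog_diff: "homog d F \<Longrightarrow> homog d G \<Longrightarrow> homog d (F - G :: 'a::comm_ring_1 poly3)"
  using homog_add[of d F "-G"] by (simp add: homog_uminus)

lemma homog_mult: 
  fixes F G :: "'a::comm_semiring_1 poly3"
  shows "homog d F \<Longrightarrow> homog e G \<Longrightarrow> homog (d + e) (F * G)"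
  using keys_mult[of F G] by (fastforce simp: homog_def lookup_add sum.distrib)

lemma homog_const [simp]: "homog 0 (const3 c)"
  by (simp add: homog_def const3_def)

lemma homog_1 [simp]: "homog 0 (1 :: 'a::comm_semiring_1 poly3)"
  by (simp add: homog_def)

lemma homog_numeral [simp]: "homog 0 (numeral n :: 'a::comm_semiring_1 poly3)"
  by (metis homog_const const3_def single_numeral)

lemma homog_var [simp]: "homog 1 (var3 i :: 'a::comm_semiring_1 poly3)"
  by (auto simp: homog_def var3_def lookup_single when_def)

lemma homog_power: "homog d F \<Longrightarrow> homog (n * d) (F ^ n :: 'a::comm_semiring_1 poly3)"
  by (induction n) (auto intro: homog_mult simp del: One_nat_def)

lemma homog_sum: "(\<And>x. x \<in> A \<Longrightarrow> homog d (f x)) \<Longrightarrow> homog d (sum f A :: 'a::comm_semiring_1 poly3)"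
  by (induction A rule: infinite_finite_induct) (auto intro: homog_add)

lemma homog_prod:
  "(\<And>x. x \<in> A \<Longrightarrow> homog (d x) (f x)) \<Longrightarrow> homog (sum d A) (prod f A :: 'a::comm_semiring_1 poly3)"
  by (induction A rule: infinite_finite_induct) (auto intro: homog_mult)

lemma homog_subst3:
  fixes F :: "'a::comm_semiring_1 poly3"
  assumes "homog d F" "\<And>i. homog e (g $ i)"
  shows "homog (d * e) (subst3 F g)"
  unfolding subst3_def
proof (rule homog_sum)
  fix m assume "m \<in> Poly_Mapping.keys F"
  then have d: "(\<Sum>i\<in>UNIV. Poly_Mapping.lookup m i) = d" using assms(1) by (auto simp: homog_def)
  have "homog (0 + (\<Sum>i\<in>UNIV. Poly_Mapping.lookup m i * e))
     (const3 (Poly_Mapping.lookup F m) * (\<Prod>i\<in>UNIV. g $ i ^ Poly_Mapping.lookup m i))"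
    by (intro homog_mult homog_prod homog_power assms homog_const)
  then show "homog (d * e) (const3 (Poly_Mapping.lookup F m) * (\<Prod>i\<in>UNIV. g $ i ^ Poly_Mapping.lookup m i))"
    by (simp add: d[symmetric] sum_distrib_right)
qed

lemma prod_3: "prod f (UNIV :: 3 set) = f 1 * f 2 * f 3"
  for f :: "3 \<Rightarrow> 'a::comm_monoid_mult"
  unfolding UNIV_3 by (simp add: ac_simps)

section \<open>Polynomials as functions over an infinite field\<close>

lemma base_inj:
  fixes N :: nat
  assumes "a + N * b + N * N * c = a' + N * b' + N * N * c'" "a < N" "a' < N" "b < N" "b' < N"
  shows "a = a' \<and> b = b' \<and> c = c'"
proof -
  have key: "x = x' \<and> y = y'" if "x + N * y = x' + N * y'" "x < N" "x' < N" for x x' y y'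
  proof -
    have "(x + N * y) mod N = x" "(x + N * y) div N = y" "(x' + N * y') mod N = x'" "(x' + N * y') div N = y'"
      using that(2,3) by simp_all
    then show ?thesis using that(1) by metis
  qed
  have "a + N * (b + N * c) = a' + N * (b' + N * c')"
    using assms(1) by (simp only: distrib_left mult.assoc add.assoc)
  with key assms have "a = a' \<and> b + N * c = b' + N * c'" by blast
  with key assms show ?thesis by blast
qed

text \<open>By Kronecker's substitution: for large \<open>N\<close> the monomials of \<open>F\<close> become different powers of
  \<open>x\<close> at \<open>(x, x^N, x^(N * N))\<close>.\<close>

lemma poly3_nonzero_point:
  fixes F :: "'a::field poly3"
  assumes "infinite (UNIV :: 'a set)" "F \<noteq> 0"
  obtains v where "eval3 F v \<noteq> 0"
proof -
  define N where "N = Suc (Max (insert 0 {Poly_Mapping.lookup m i | m i. m \<in> Poly_Mapping.keys F \<and> i \<in> UNIV}))"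
  have "finite {Poly_Mapping.lookup m i | m i. m \<in> Poly_Mapping.keys F \<and> i \<in> (UNIV :: 3 set)}"
    by (rule finite_image_set2) auto
  then have N: "Poly_Mapping.lookup m i < N" if "m \<in> Poly_Mapping.keys F" for m i
    unfolding N_def using that by (auto simp: less_Suc_eq_le intro!: Max_ge)
  define e where "e m = Poly_Mapping.lookup m 1 + N * Poly_Mapping.lookup m 2 + N * N * Poly_Mapping.lookup m 3"
    for m :: "3 \<Rightarrow>\<^sub>0 nat"
  define r where "r = (\<Sum>m\<in>Poly_Mapping.keys F. monom (Poly_Mapping.lookup F m) (e m))"
  have inj: "inj_on e (Poly_Mapping.keys F)"
  proof (rule inj_onI)
    fix m n assume "m \<in> Poly_Mapping.keys F" "n \<in> Poly_Mapping.keys F" "e m = e n"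
    then have "Poly_Mapping.lookup m 1 = Poly_Mapping.lookup n 1 \<and> Poly_Mapping.lookup m 2 = Poly_Mapping.lookup n 2
      \<and> Poly_Mapping.lookup m 3 = Poly_Mapping.lookup n 3"
      unfolding e_def using N by (intro base_inj) auto
    then have "Poly_Mapping.lookup m i = Poly_Mapping.lookup n i" for i
      using exhaust_3[of i] by auto
    then show "m = n" by (rule poly_mapping_eqI)
  qed
  obtain m0 where m0: "m0 \<in> Poly_Mapping.keys F" using assms(2) by (metis keys_eq_empty ex_in_conv)
  have "coeff r (e m0) = (\<Sum>m\<in>Poly_Mapping.keys F. if m = m0 then Poly_Mapping.lookup F m else 0)"
    unfolding r_def coeff_sum using m0 by (intro sum.cong refl) (simp add: inj_on_eq_iff[OF inj])
  also have "\<dots> = Poly_Mapping.lookup F m0" using m0 by simp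
  finally have "r \<noteq> 0" using m0 by (auto simp: in_keys_iff)
  then have "finite {x. poly r x = 0}" by (rule poly_roots_finite)
  then have "{x. poly r x = 0} \<noteq> UNIV" using assms(1) by metis
  then obtain x where x: "poly r x \<noteq> 0" by blast
  have "eval3 F (vector [x, x ^ N, x ^ (N * N)]) = poly r x"
    unfolding eval3_def r_def poly_sum
    by (rule sum.cong) (simp_all add: prod_3 e_def poly_monom power_add power_mult vector_3)
  with x have "eval3 F (vector [x, x ^ N, x ^ (N * N)]) \<noteq> 0" by simp
  then show ?thesis by (rule that)
qed

text \<open>Over a finite field the product of all X - x vanishes everywhere, so that adding 1 gives
  a nonconstant polynomial without zeros.\<close>

lemma infinite_alg_closed: "infinite (UNIV :: 'a::alg_closed_field set)"
proof
  assume fin: "finite (UNIV :: 'a set)"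
  let ?p = "1 + (\<Prod>x\<in>UNIV. [:- x, 1:]) :: 'a poly"
  have "degree (\<Prod>x\<in>UNIV. [:- x, 1 :: 'a:]) = card (UNIV :: 'a set)"
    by (subst degree_prod_sum_eq) auto
  moreover have "card (UNIV :: 'a set) > 0" using fin by (simp add: card_gt_0_iff)
  ultimately have "degree ?p > 0"
    by (metis degree_1 degree_add_eq_right)
  then obtain x where "poly ?p x = 0" using alg_closed_imp_poly_has_root by blast
  moreover have "poly (\<Prod>x\<in>UNIV. [:- x, 1 :: 'a:]) x = 0"
    using fin by (auto simp: poly_prod intro!: prod_zero)
  ultimately show False by simp
qed

lemma poly3_eqI:
  fixes F G :: "'a::field poly3"
  assumes "infinite (UNIV :: 'a set)" "\<And>v. eval3 F v = eval3 G v"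
  shows "F = G"
proof (rule ccontr)
  assume "F \<noteq> G"
  then obtain v where "eval3 (F - G) v \<noteq> 0" using poly3_nonzero_point[OF assms(1), of "F - G"] by auto
  then show False using assms(2)[of v] by (simp add: eval3_evh)
qed

section \<open>Formal partial derivatives\<close>

lemma pderiv3_superset:
  assumes "finite A" "Poly_Mapping.keys F \<subseteq> A"
  shows "pderiv3 i F = (\<Sum>m\<in>A. Poly_Mapping.single (m - Poly_Mapping.single i 1)
       (of_nat (Poly_Mapping.lookup m i) * Poly_Mapping.lookup F m))"
  unfolding pderiv3_def using assms by (intro sum.mono_neutral_left) (auto simp: in_keys_iff)

lemma pderiv3_add [simp]: "pderiv3 i (F + G) = pderiv3 i F + pderiv3 i G"
proof -
  let ?A = "Poly_Mapping.keys F \<union> Poly_Mapping.keys G"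
  have "pderiv3 i (F + G) = (\<Sum>m\<in>?A. Poly_Mapping.single (m - Poly_Mapping.single i 1)
       (of_nat (Poly_Mapping.lookup m i) * Poly_Mapping.lookup (F + G) m))"
    using keys_add[of F G] by (intro pderiv3_superset) auto
  also have "\<dots> = pderiv3 i F + pderiv3 i G"
    by (simp add: lookup_add distrib_left single_add sum.distrib pderiv3_superset[of ?A])
  finally show ?thesis .
qed

lemma pderiv3_0 [simp]: "pderiv3 i 0 = 0"
  by (simp add: pderiv3_def)

lemma pderiv3_sum [simp]: "pderiv3 i (sum f A) = (\<Sum>x\<in>A. pderiv3 i (f x))"
  by (induction A rule: infinite_finite_induct) auto

lemma pderiv3_uminus [simp]: "pderiv3 i (- F :: 'a::comm_ring_1 poly3) = - pderiv3 i F"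
  using pderiv3_add[of i F "-F"] by (simp add: eq_neg_iff_add_eq_0 add.commute)

lemma pderiv3_diff [simp]: "pderiv3 i (F - G :: 'a::comm_ring_1 poly3) = pderiv3 i F - pderiv3 i G"
  using pderiv3_add[of i F "-G"] by simp

lemma pderiv3_single [simp]: "pderiv3 i (Poly_Mapping.single m c) =
    Poly_Mapping.single (m - Poly_Mapping.single i 1) (of_nat (Poly_Mapping.lookup m i) * c)"
  by (simp add: pderiv3_def)

lemma pderiv3_mult_single:
  fixes c d :: "'a::comm_semiring_1"
  shows "pderiv3 i (Poly_Mapping.single m c * Poly_Mapping.single n d) =
    pderiv3 i (Poly_Mapping.single m c) * Poly_Mapping.single n d +
    Poly_Mapping.single m c * pderiv3 i (Poly_Mapping.single n d)"
proof -
  let ?e = "Poly_Mapping.single i 1"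
  \<comment> \<open>Subtraction of exponents is truncated, so it commutes with addition only where
    the variable occurs; where it does not, the coefficient is 0.\<close>
  have *: "p - ?e + q = p + q - ?e" if "Poly_Mapping.lookup p i > 0" for p q :: "3 \<Rightarrow>\<^sub>0 nat"
    using that by (intro poly_mapping_eqI) (auto simp: lookup_add lookup_minus lookup_single when_def)
  have a: "Poly_Mapping.single (m - ?e + n) (of_nat (Poly_Mapping.lookup m i) * c * d) =
      Poly_Mapping.single (m + n - ?e) (of_nat (Poly_Mapping.lookup m i) * c * d)"
    using *[of m n] by (cases "Poly_Mapping.lookup m i = 0") simp_all
  have b: "Poly_Mapping.single (m + (n - ?e)) (c * (of_nat (Poly_Mapping.lookup n i) * d)) =
      Poly_Mapping.single (m + n - ?e) (c * (of_nat (Poly_Mapping.lookup n i) * d))"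
    using *[of n m] by (cases "Poly_Mapping.lookup n i = 0") (simp_all add: add.commute)
  have "pderiv3 i (Poly_Mapping.single m c * Poly_Mapping.single n d) =
      Poly_Mapping.single (m + n - ?e) (of_nat (Poly_Mapping.lookup m i) * c * d + c * (of_nat (Poly_Mapping.lookup n i) * d))"
    by (simp add: mult_single lookup_add algebra_simps)
  then show ?thesis
    by (simp only: single_add mult_single pderiv3_single a b)
qed

lemma pderiv3_mult [simp]:
  fixes F G :: "'a::comm_semiring_1 poly3"
  shows "pderiv3 i (F * G) = pderiv3 i F * G + F * pderiv3 i G"
proof -
  let ?s = "\<lambda>F m. Poly_Mapping.single m (Poly_Mapping.lookup F m)"
  have F: "F = (\<Sum>m\<in>Poly_Mapping.keys F. ?s F m)" and G: "G = (\<Sum>n\<in>Poly_Mapping.keys G. ?s G n)"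
    by (simp_all add: poly_mapping_sum_monomials)
  have "F * G = (\<Sum>m\<in>Poly_Mapping.keys F. \<Sum>n\<in>Poly_Mapping.keys G. ?s F m * ?s G n)"
    by (subst F, subst G) (simp add: sum_product)
  then have "pderiv3 i (F * G) = (\<Sum>m\<in>Poly_Mapping.keys F. \<Sum>n\<in>Poly_Mapping.keys G.
      pderiv3 i (?s F m) * ?s G n + ?s F m * pderiv3 i (?s G n))"
    by (simp only: pderiv3_sum pderiv3_mult_single)
  also have "\<dots> = pderiv3 i (\<Sum>m\<in>Poly_Mapping.keys F. ?s F m) * (\<Sum>n\<in>Poly_Mapping.keys G. ?s G n)
     + (\<Sum>m\<in>Poly_Mapping.keys F. ?s F m) * pderiv3 i (\<Sum>n\<in>Poly_Mapping.keys G. ?s G n)"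
    by (simp only: pderiv3_sum sum_product sum.distrib)
  finally show ?thesis by (simp add: poly_mapping_sum_monomials)
qed

lemma pderiv3_const [simp]: "pderiv3 i (const3 c) = 0"
  by (simp add: const3_def)

lemma pderiv3_var [simp]: "pderiv3 i (var3 j :: 'a::comm_semiring_1 poly3) = (if i = j then 1 else 0)"
  by (auto simp: var3_def lookup_single)

lemma eval3_pderiv3: "eval3 (pderiv3 i F) v =
   (\<Sum>m\<in>Poly_Mapping.keys F. of_nat (Poly_Mapping.lookup m i) * Poly_Mapping.lookup F m
       * mon3 v (m - Poly_Mapping.single i 1))" for v :: "'a::comm_ring_1 ^ 3"
  by (simp add: eval3_evh pderiv3_def)

lemma vec3_eqI: "u $ 1 = v $ 1 \<Longrightarrow> u $ 2 = v $ 2 \<Longrightarrow> u $ 3 = v $ 3 \<Longrightarrow> u = (v :: 'a ^ 3)"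
  by (simp add: vec_eq_iff forall_3)

section \<open>Restricting forms to the cuspidal cubic\<close>

definition cpt :: "'a::comm_ring_1 \<Rightarrow> 'a ^ 3" where
  "cpt s = vector [1, s, s ^ 3]"

lemma cpt_nth [simp]: "cpt s $ 1 = 1" "cpt s $ 2 = s" "cpt s $ 3 = s ^ 3"
  by (simp_all add: cpt_def vector_3)

lemma cpt_nonzero [simp]: "cpt s \<noteq> 0"
  by (metis cpt_nth(1) zero_index zero_neq_one)

definition cusp_poly :: "'a::field poly3 \<Rightarrow> 'a poly" where
  "cusp_poly F = (\<Sum>m\<in>Poly_Mapping.keys F. monom (Poly_Mapping.lookup F m)
     (Poly_Mapping.lookup m 2 + 3 * Poly_Mapping.lookup m 3))"

lemma mon3_cpt: "mon3 (cpt s) m = s ^ (Poly_Mapping.lookup m 2 + 3 * Poly_Mapping.lookup m 3)"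
  by (simp add: mon3_def prod_3 power_add power_mult)

lemma poly_cusp_poly: "poly (cusp_poly F) s = eval3 F (cpt s)"
  by (simp add: cusp_poly_def eval3_evh evh_def mon3_cpt poly_sum poly_monom)

lemma coeff_cusp_poly: "coeff (cusp_poly F) n = (\<Sum>m\<in>Poly_Mapping.keys F.
    if Poly_Mapping.lookup m 2 + 3 * Poly_Mapping.lookup m 3 = n then Poly_Mapping.lookup F m else 0)"
  by (simp add: cusp_poly_def coeff_sum)

lemma homog_exponents:
  assumes "homog d F" "m \<in> Poly_Mapping.keys F"
  shows "Poly_Mapping.lookup m 1 + Poly_Mapping.lookup m 2 + Poly_Mapping.lookup m 3 = d"
  using assms by (simp add: homog_def sum_3)

lemma degree_cusp_poly:
  assumes "homog d F"
  shows "degree (cusp_poly F) \<le> 3 * d"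
proof (intro degree_le allI impI)
  fix i assume i: "3 * d < i"
  have "Poly_Mapping.lookup m 2 + 3 * Poly_Mapping.lookup m 3 \<noteq> i" if "m \<in> Poly_Mapping.keys F" for m
    using homog_exponents[OF assms that] i by linarith
  then show "coeff (cusp_poly F) i = 0" unfolding coeff_cusp_poly by (intro sum.neutral) auto
qed

text \<open>The difference of \<open>3 * d\<close> and the exponent is \<open>3 * x + 2 * y\<close>,
  and 1 is the gap of the semigroup generated by 2 and 3.\<close>

lemma cusp_exponent_gap:
  fixes x y z d :: nat
  assumes "x + y + z = d" "d > 0"
  shows "y + 3 * z \<noteq> 3 * d - 1"
proof
  assume "y + 3 * z = 3 * d - 1"
  then have "3 * x + 2 * y = 1" using assms by linarith
  then show False by presburger
qed

text \<open>For \<open>d \<le> 2\<close> the exponent \<open>y\<close> is at most 2, hence it is the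
  remainder modulo 3.\<close>

lemma cusp_exponent_inj:
  fixes x y z x' y' z' d :: nat
  assumes "x + y + z = d" "x' + y' + z' = d" "d \<le> 2" "y + 3 * z = y' + 3 * z'"
  shows "y = y'" "z = z'"
proof -
  have "y + 3 * z < 3 + 3 * z" "y' + 3 * z' < 3 + 3 * z'" using assms by linarith+
  then show "z = z'" using assms(4) by linarith
  then show "y = y'" using assms(4) by simp
qed

text \<open>The only collision is that of y^3 and x^2 z, the two monomials in the equation of the
  cuspidal cubic.\<close>

lemma cusp_exponent_cubic:
  fixes x y z x' y' z' :: nat
  assumes "x + y + z = 3" "x' + y' + z' = 3" "y + 3 * z = y' + 3 * z'"
  shows "y = y' \<and> z = z' \<or> x = 0 \<and> y = 3 \<and> z = 0 \<and> x' = 2 \<and> y' = 0 \<and> z' = 1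
      \<or> x' = 0 \<and> y' = 3 \<and> z' = 0 \<and> x = 2 \<and> y = 0 \<and> z = 1"
proof -
  consider "z = z'" | "z < z'" | "z' < z" by linarith
  then show ?thesis
  proof cases
    case 1 then show ?thesis using assms by simp
  next
    case 2 
    then have "y = 3" "z = 0" "x = 0" using assms by linarith+
    then show ?thesis using assms 2 by (intro disjI2 disjI1) auto
  next
    case 3
    then have "y' = 3" "z' = 0" "x' = 0" using assms by linarith+
    then show ?thesis using assms 3 by (intro disjI2) auto
  qed
qed

lemma coeff_cusp_poly_gap:
  assumes "homog d F" "d > 0"
  shows "coeff (cusp_poly F) (3 * d - 1) = 0"
  unfolding coeff_cusp_poly
proof (intro sum.neutral ballI)
  fix m assume "m \<in> Poly_Mapping.keys F"
  from cusp_exponent_gap[OF homog_exponents[OF assms(1) this] assms(2)]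
  have "Poly_Mapping.lookup m 2 + 3 * Poly_Mapping.lookup m 3 \<noteq> 3 * d - 1" .
  then show "(if Poly_Mapping.lookup m 2 + 3 * Poly_Mapping.lookup m 3 = 3 * d - 1
     then Poly_Mapping.lookup F m else 0) = 0" by simp
qed

lemma lookup_eqI:
  assumes "Poly_Mapping.lookup m (1::3) = Poly_Mapping.lookup n 1"
    "Poly_Mapping.lookup m 2 = Poly_Mapping.lookup n 2" "Poly_Mapping.lookup m 3 = Poly_Mapping.lookup n 3"
  shows "m = n"
proof (rule poly_mapping_eqI)
  fix i :: 3
  show "Poly_Mapping.lookup m i = Poly_Mapping.lookup n i"
    using exhaust_3[of i] assms by (elim disjE) simp_all
qed

lemma expo_eqI:
  assumes "homog d F" "m \<in> Poly_Mapping.keys F" "n \<in> Poly_Mapping.keys F"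
    "Poly_Mapping.lookup m 2 = Poly_Mapping.lookup n 2" "Poly_Mapping.lookup m 3 = Poly_Mapping.lookup n 3"
  shows "m = n"
  using homog_exponents[OF assms(1,2)] homog_exponents[OF assms(1,3)] assms(4,5) by (intro lookup_eqI) linarith+

text \<open>In degree at most 2 different monomials restrict to different powers of the parameter,
  so nothing can cancel.\<close>

lemma cusp_poly_eq_0_imp:
  assumes "homog d F" "d \<le> 2" "cusp_poly F = 0"
  shows "F = 0"
proof (rule ccontr)
  assume "F \<noteq> 0"
  then obtain m where m: "m \<in> Poly_Mapping.keys F" by (metis keys_eq_empty ex_in_conv)
  have "coeff (cusp_poly F) (Poly_Mapping.lookup m 2 + 3 * Poly_Mapping.lookup m 3) =
      (\<Sum>n\<in>Poly_Mapping.keys F. if n = m then Poly_Mapping.lookup F m else 0)"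
    unfolding coeff_cusp_poly
  proof (intro sum.cong refl)
    fix n assume n: "n \<in> Poly_Mapping.keys F"
    have "n = m" if "Poly_Mapping.lookup n 2 + 3 * Poly_Mapping.lookup n 3 =
       Poly_Mapping.lookup m 2 + 3 * Poly_Mapping.lookup m 3"
    proof (rule expo_eqI[OF assms(1) n m])
      show "Poly_Mapping.lookup n 2 = Poly_Mapping.lookup m 2"
           "Poly_Mapping.lookup n 3 = Poly_Mapping.lookup m 3"
        using cusp_exponent_inj[OF homog_exponents[OF assms(1) n] homog_exponents[OF assms(1) m] assms(2) that] by auto
    qed
    then show "(if Poly_Mapping.lookup n 2 + 3 * Poly_Mapping.lookup n 3 =
       Poly_Mapping.lookup m 2 + 3 * Poly_Mapping.lookup m 3 then Poly_Mapping.lookup F n else 0) =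
       (if n = m then Poly_Mapping.lookup F m else 0)" by auto
  qed
  also have "\<dots> = Poly_Mapping.lookup F m" using m by simp
  finally show False using assms(3) m by (auto simp: in_keys_iff)
qed

definition cusp_cubic :: "'a::comm_ring_1 ^ 3 \<Rightarrow> 'a" where
  "cusp_cubic v = (v $ 1)\<^sup>2 * v $ 3 - (v $ 2) ^ 3"

definition X3 :: "'a::comm_ring_1 poly3 ^ 3" where
  "X3 = (\<chi> i. var3 i)"

lemma X3_nth [simp]: "X3 $ i = var3 i"
  by (simp add: X3_def)

lemma cusp_cubic_cpt [simp]: "cusp_cubic (cpt s) = 0"
  by (simp add: cusp_cubic_def)

lemma cusp_poly_eq_0_cubic:
  fixes F :: "'a::field poly3"
  assumes inf: "infinite (UNIV :: 'a set)" and "homog 3 F" "cusp_poly F = 0"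
  obtains c where "F = const3 c * cusp_cubic X3"
proof -
  define mA where "mA = Poly_Mapping.single (2::3) (3::nat)"
  define mB where "mB = Poly_Mapping.single (1::3) (2::nat) + Poly_Mapping.single 3 1"
  have lA: "Poly_Mapping.lookup mA 1 = 0" "Poly_Mapping.lookup mA 2 = 3" "Poly_Mapping.lookup mA 3 = 0"
    by (simp_all add: mA_def lookup_single)
  have lB: "Poly_Mapping.lookup mB 1 = 2" "Poly_Mapping.lookup mB 2 = 0" "Poly_Mapping.lookup mB 3 = 1"
    by (simp_all add: mB_def lookup_single lookup_add)
  have AB: "mA \<noteq> mB" using lA(1) lB(1) by auto
  let ?e = "\<lambda>m. Poly_Mapping.lookup m 2 + 3 * Poly_Mapping.lookup m (3::3)"
  have eq: "m = n \<or> {m, n} = {mA, mB}"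
    if mn: "m \<in> Poly_Mapping.keys F" "n \<in> Poly_Mapping.keys F" "?e m = ?e n" for m n
  proof -
    have hm: "Poly_Mapping.lookup m 1 + Poly_Mapping.lookup m 2 + Poly_Mapping.lookup m 3 = 3"
      and hn: "Poly_Mapping.lookup n 1 + Poly_Mapping.lookup n 2 + Poly_Mapping.lookup n 3 = 3"
      using homog_exponents[OF assms(2)] mn by auto
    have isA: "k = mA" if "Poly_Mapping.lookup k 1 = 0 \<and> Poly_Mapping.lookup k 2 = 3 \<and> Poly_Mapping.lookup k 3 = 0" for k
      using that lA by (intro lookup_eqI) auto
    have isB: "k = mB" if "Poly_Mapping.lookup k 1 = 2 \<and> Poly_Mapping.lookup k 2 = 0 \<and> Poly_Mapping.lookup k 3 = 1" for k
      using that lB by (intro lookup_eqI) auto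
    consider "Poly_Mapping.lookup m 2 = Poly_Mapping.lookup n 2 \<and> Poly_Mapping.lookup m 3 = Poly_Mapping.lookup n 3"
      | "Poly_Mapping.lookup m 1 = 0 \<and> Poly_Mapping.lookup m 2 = 3 \<and> Poly_Mapping.lookup m 3 = 0 \<and>
         Poly_Mapping.lookup n 1 = 2 \<and> Poly_Mapping.lookup n 2 = 0 \<and> Poly_Mapping.lookup n 3 = 1"
      | "Poly_Mapping.lookup n 1 = 0 \<and> Poly_Mapping.lookup n 2 = 3 \<and> Poly_Mapping.lookup n 3 = 0 \<and>
         Poly_Mapping.lookup m 1 = 2 \<and> Poly_Mapping.lookup m 2 = 0 \<and> Poly_Mapping.lookup m 3 = 1"
      using cusp_exponent_cubic[OF hm hn mn(3)] by blast
    then show ?thesis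
      by cases (use expo_eqI[OF assms(2) mn(1,2)] isA isB in auto)
  qed
  have keys: "Poly_Mapping.keys F \<subseteq> {mA, mB}"
  proof
    fix m assume m: "m \<in> Poly_Mapping.keys F"
    show "m \<in> {mA, mB}"
    proof (rule ccontr)
      assume "m \<notin> {mA, mB}"
      then have "n = m" if "n \<in> Poly_Mapping.keys F" "?e n = ?e m" for n
        using eq[OF that(1) m that(2)] by auto
      then have "coeff (cusp_poly F) (?e m) = (\<Sum>n\<in>Poly_Mapping.keys F. if n = m then Poly_Mapping.lookup F m else 0)"
        unfolding coeff_cusp_poly by (intro sum.cong) auto
      also have "\<dots> = Poly_Mapping.lookup F m" using m by simp
      finally show False using assms(3) m by (auto simp: in_keys_iff)
    qed
  qed
  have ev: "eval3 F v = Poly_Mapping.lookup F mA * mon3 v mA + Poly_Mapping.lookup F mB * mon3 v mB" for v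
    unfolding eval3_evh by (subst id_hom.evh_superset[of "{mA, mB}"]) (use keys AB in auto)
  \<comment> \<open>At s = 1 both remaining monomials have the value 1, so their coefficients are
    opposite.\<close>
  have "eval3 F (cpt 1) = 0" using poly_cusp_poly[of F 1] assms(3) by simp
  then have *: "Poly_Mapping.lookup F mA = - Poly_Mapping.lookup F mB"
    by (simp add: ev mon3_cpt eq_neg_iff_add_eq_0)
  have "F = const3 (Poly_Mapping.lookup F mB) * cusp_cubic X3"
  proof (rule poly3_eqI[OF inf])
    fix v :: "'a ^ 3"
    have "mon3 v mA = v $ 2 ^ 3" "mon3 v mB = (v $ 1)\<^sup>2 * v $ 3"
      by (simp_all add: mA_def mB_def mon3_add)
    then show "eval3 F v = eval3 (const3 (Poly_Mapping.lookup F mB) * cusp_cubic X3) v"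
      unfolding ev * by (simp add: eval3_evh cusp_cubic_def algebra_simps)
  qed
  then show ?thesis by (rule that)
qed

lemma pderiv_sum: "pderiv (\<Sum>x\<in>A. f x) = (\<Sum>x\<in>A. pderiv (f x))"
  by (induction A rule: infinite_finite_induct) (auto simp: pderiv_add)

text \<open>The chain rule along the parametrisation, whose velocity vector is (0, 1, 3
  s^2).\<close>

lemma pderiv_cusp_poly:
  "poly (pderiv (cusp_poly F)) s =
     eval3 (pderiv3 2 F) (cpt s) + 3 * s\<^sup>2 * eval3 (pderiv3 3 F) (cpt s)"
proof -
  have "poly (pderiv (cusp_poly F)) s = (\<Sum>m\<in>Poly_Mapping.keys F.
      of_nat (Poly_Mapping.lookup m 2 + 3 * Poly_Mapping.lookup m 3) * Poly_Mapping.lookup F m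
        * s ^ (Poly_Mapping.lookup m 2 + 3 * Poly_Mapping.lookup m 3 - 1))"
    by (simp add: cusp_poly_def pderiv_sum pderiv_monom poly_sum poly_monom)
  also have "\<dots> = (\<Sum>m\<in>Poly_Mapping.keys F.
      of_nat (Poly_Mapping.lookup m 2) * Poly_Mapping.lookup F m * mon3 (cpt s) (m - Poly_Mapping.single 2 1)
      + 3 * s\<^sup>2 * (of_nat (Poly_Mapping.lookup m 3) * Poly_Mapping.lookup F m * mon3 (cpt s) (m - Poly_Mapping.single 3 1)))"
  proof (intro sum.cong refl)
    fix m assume "m \<in> Poly_Mapping.keys F"
    have a: "of_nat (Poly_Mapping.lookup m 2) * s ^ (Poly_Mapping.lookup m 2 + 3 * Poly_Mapping.lookup m 3 - 1) =
       of_nat (Poly_Mapping.lookup m 2) * mon3 (cpt s) (m - Poly_Mapping.single 2 1)"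
      by (cases "Poly_Mapping.lookup m 2") (simp_all add: mon3_cpt lookup_minus lookup_single)
    have b: "of_nat (3 * Poly_Mapping.lookup m 3) * s ^ (Poly_Mapping.lookup m 2 + 3 * Poly_Mapping.lookup m 3 - 1) =
       3 * s\<^sup>2 * (of_nat (Poly_Mapping.lookup m 3) * mon3 (cpt s) (m - Poly_Mapping.single 3 1))"
    proof (cases "Poly_Mapping.lookup m 3")
      case (Suc n)
      have "Poly_Mapping.lookup m 2 + 3 * Poly_Mapping.lookup m 3 - 1 = 2 + (Poly_Mapping.lookup m 2 + 3 * n)"
        using Suc by simp
      then show ?thesis
        by (simp add: mon3_cpt lookup_minus lookup_single Suc power_add power2_eq_square algebra_simps)
    qed simp
    show "of_nat (Poly_Mapping.lookup m 2 + 3 * Poly_Mapping.lookup m 3) * Poly_Mapping.lookup F m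
        * s ^ (Poly_Mapping.lookup m 2 + 3 * Poly_Mapping.lookup m 3 - 1) =
      of_nat (Poly_Mapping.lookup m 2) * Poly_Mapping.lookup F m * mon3 (cpt s) (m - Poly_Mapping.single 2 1)
      + 3 * s\<^sup>2 * (of_nat (Poly_Mapping.lookup m 3) * Poly_Mapping.lookup F m * mon3 (cpt s) (m - Poly_Mapping.single 3 1))"
      using arg_cong[OF a, of "\<lambda>x. x * Poly_Mapping.lookup F m"] arg_cong[OF b, of "\<lambda>x. x * Poly_Mapping.lookup F m"]
      by (simp only: of_nat_add distrib_right distrib_left mult_ac)
  qed
  finally show ?thesis by (simp add: eval3_pderiv3 sum.distrib sum_distrib_left)
qed

section \<open>Points\<close>

lemma proj_pt_eqI: "c \<noteq> 0 \<Longrightarrow> proj_pt (c *s v) = proj_pt (v :: 'a::field ^ 3)"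
  unfolding proj_pt_def by (auto simp: vector_smult_assoc) (metis divide_eq_0_iff nonzero_mult_div_cancel_right times_divide_eq_left)

lemma mem_proj_pt: "v \<in> proj_pt v"
  unfolding proj_pt_def by (auto intro: exI[of _ 1])

lemma proj_pt_eqD: "proj_pt u = proj_pt v \<Longrightarrow> \<exists>c. c \<noteq> 0 \<and> u = c *s v"
  using mem_proj_pt[of u] by (auto simp: proj_pt_def)

lemma on_curve_proj_pt: "homog d F \<Longrightarrow> on_curve F (proj_pt v) \<longleftrightarrow> eval3 F v = 0"
  unfolding on_curve_def proj_pt_def eval3_evh
  using mem_proj_pt[of v] by (auto simp: id_hom.evh_homog)

lemma proj_pt_cpt_inj: "proj_pt (cpt s) = proj_pt (cpt t) \<longleftrightarrow> s = (t :: 'a::field)"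
proof
  assume "proj_pt (cpt s) = proj_pt (cpt t)"
  then obtain c where c: "cpt s = c *s cpt t" using proj_pt_eqD by blast
  have "c = 1" using arg_cong[OF c, of "\<lambda>v. v $ 1"] by simp
  then show "s = t" using arg_cong[OF c, of "\<lambda>v. v $ 2"] by simp
qed simp

lemma proj_pt_P2: "v \<noteq> 0 \<Longrightarrow> proj_pt v \<in> P2"
  by (auto simp: P2_def)

lemma coeff_prod_linear:
  assumes "finite S" "S \<noteq> {}"
  shows "coeff (\<Prod>s\<in>S. [:- s, 1:]) (card S - 1) = - \<Sum>(S :: 'a::idom set)"
  using assms
proof (induction S rule: finite_ne_induct)
  case (insert x S)
  have "coeff (\<Prod>s\<in>S. [:- s, 1:]) (card S) = 1"
    using lead_coeff_prod[of "\<lambda>s. [:- s, 1:]" S] degree_prod_sum_eq[of S "\<lambda>s. [:- s, 1:]"] by simp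
  moreover obtain n where "card S = Suc n"
    using insert by (metis card_0_eq not0_implies_Suc)
  ultimately show ?case using insert by simp
qed simp

lemma degree_prod_linear [simp]: "degree (\<Prod>s\<in>S. [:- s, 1 :: 'a::idom:]) = card S"
  by (subst degree_prod_sum_eq) auto

lemma poly_eq_0_card:
  fixes r :: "'a::idom poly"
  assumes "finite S" "\<And>s. s \<in> S \<Longrightarrow> poly r s = 0" "\<And>i. i \<ge> card S \<Longrightarrow> coeff r i = 0"
  shows "r = 0"
proof (rule ccontr)
  assume "r \<noteq> 0"
  then have "degree r < card S" using assms(3) by (meson leading_coeff_neq_0 not_le)
  moreover have "card S \<le> card {x. poly r x = 0}"
    using assms poly_roots_finite[OF \<open>r \<noteq> 0\<close>] by (intro card_mono) auto
  ultimately show False using card_poly_roots_bound[OF \<open>r \<noteq> 0\<close>] by simp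
qed

text \<open>With that many zeros \<open>r\<close> is a multiple of the product of the X - s, whose
  second coefficient is minus the sum of the s.\<close>

lemma gap_roots_sum:
  fixes r :: "'a::idom poly"
  assumes "degree r \<le> card S" "coeff r (card S - 1) = 0" "finite S" "S \<noteq> {}"
    "\<And>s. s \<in> S \<Longrightarrow> poly r s = 0" "r \<noteq> 0"
  shows "\<Sum>S = 0"
proof -
  define c where "c = coeff r (card S)"
  define g where "g = (\<Prod>s\<in>S. [:- s, 1:])"
  have g: "degree g = card S" "coeff g (card S) = 1" "\<And>s. s \<in> S \<Longrightarrow> poly g s = 0"
    using lead_coeff_prod[of "\<lambda>s. [:- s, 1:]" S] assms(3) by (auto simp: g_def poly_prod)
  have "r - smult c g = 0"
  proof (rule poly_eq_0_card[OF assms(3)])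
    fix i assume "card S \<le> i"
    then show "coeff (r - smult c g) i = 0"
      using g assms(1) by (cases "i = card S") (auto simp: c_def coeff_eq_0)
  qed (use assms g in auto)
  then have r: "r = smult c g" by simp
  then have "c * coeff g (card S - 1) = 0" using assms(2) by simp
  then have "c * \<Sum>S = 0" unfolding g_def using coeff_prod_linear[OF assms(3,4)] by simp
  then show ?thesis using r assms(6) by auto
qed

section \<open>Eight general points on the cuspidal cubic\<close>

text \<open>Three points of the cuspidal cubic are collinear iff their parameters have sum 0. Six
  points on a conic also have sum 0, and then so have the two remaining ones, as the total is 0.
  Size 1 keeps the eight points apart from the ninth base point, which has parameter 0.\<close>

locale eight_points =
  fixes R :: "'a::alg_closed_field set"
  assumes card_R: "card R = 8" and sum_R: "\<Sum>R = 0"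
    and sum_subset: "\<And>S. S \<subseteq> R \<Longrightarrow> card S \<in> {1, 2, 3} \<Longrightarrow> \<Sum>S \<noteq> 0"
begin

lemma finite_R: "finite R"
  using card_R by (metis card.infinite zero_neq_numeral)

lemma R_nonzero: "s \<in> R \<Longrightarrow> s \<noteq> 0"
  using sum_subset[of "{s}"] by auto

definition fpoly :: "'a poly" where
  "fpoly = (\<Prod>s\<in>R. [:- s, 1:])"

abbreviation a :: "nat \<Rightarrow> 'a" where "a \<equiv> coeff fpoly"

lemma degree_fpoly [simp]: "degree fpoly = 8"
  by (simp add: fpoly_def card_R)

lemma a_8: "a 8 = 1"
  using lead_coeff_prod[of "\<lambda>s. [:- s, 1:]" R] by (simp add: fpoly_def card_R)

lemma a_7: "a 7 = 0"
  using coeff_prod_linear[OF finite_R] card_R sum_R by (force simp: fpoly_def)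

lemma poly_fpoly_0_iff: "poly fpoly s = 0 \<longleftrightarrow> s \<in> R"
  using finite_R by (auto simp: fpoly_def poly_prod)

definition pts :: "('a ^ 3) set set" where
  "pts = proj_pt ` cpt ` R"

lemma card_pts_on_curve:
  assumes "homog d F"
  shows "card {x \<in> pts. on_curve F x} = card {s \<in> R. poly (cusp_poly F) s = 0}"
proof -
  have "{x \<in> pts. on_curve F x} = (\<lambda>s. proj_pt (cpt s)) ` {s \<in> R. poly (cusp_poly F) s = 0}"
    unfolding pts_def using on_curve_proj_pt[OF assms] by (auto simp: poly_cusp_poly)
  then show ?thesis by (simp add: card_image inj_on_def proj_pt_cpt_inj)
qed

lemma few_points_on_curve:
  assumes "plane_curve d F" "d \<in> {1, 2}"
  shows "card {x \<in> pts. on_curve F x} < 3 * d"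
proof (rule ccontr)
  from assms have F: "homog d F" "F \<noteq> 0" by (auto simp: plane_curve_def)
  assume "\<not> card {x \<in> pts. on_curve F x} < 3 * d"
  then have "3 * d \<le> card {s \<in> R. poly (cusp_poly F) s = 0}"
    using card_pts_on_curve[OF F(1)] by simp
  then obtain S where S: "S \<subseteq> {s \<in> R. poly (cusp_poly F) s = 0}" "card S = 3 * d"
    by (metis obtain_subset_with_card_n)
  have fin: "finite S" using S(2) assms(2) by (intro card_ge_0_finite) auto
  have "\<Sum>S = 0"
  proof (rule gap_roots_sum[OF _ _ fin])
    show "degree (cusp_poly F) \<le> card S" using degree_cusp_poly[OF F(1)] S(2) by simp
    show "coeff (cusp_poly F) (card S - 1) = 0" using coeff_cusp_poly_gap[OF F(1)] S(2) assms(2) by auto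
    show "S \<noteq> {}" using S(2) assms(2) by auto
    show "cusp_poly F \<noteq> 0" using cusp_poly_eq_0_imp[OF F(1)] F(2) assms(2) by auto
  qed (use S in auto)
  \<comment> \<open>For a line the three elements of \<open>S\<close> contradict general position,
    for a conic the two elements of its complement do.\<close>
  moreover have "\<Sum>(R - S) = \<Sum>R - \<Sum>S" using S finite_R by (intro sum_diff) auto
  moreover have "card (R - S) = 8 - card S" using S finite_R fin card_R by (subst card_Diff_subset) auto
  ultimately show False
    using sum_subset[of S] sum_subset[of "R - S"] S assms(2) sum_R by auto
qed

text \<open>Subtracting the multiple of s \<open>fpoly\<close> with the same coefficient of s^9
  leaves degree at most 7, as both sides lack s^8; eight zeros then force 0.\<close>

lemma cusp_poly_cubic_through:
  assumes "homog 3 F" "\<And>s. s \<in> R \<Longrightarrow> eval3 F (cpt s) = 0"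
  obtains c where "cusp_poly F = smult c (pCons 0 fpoly)"
proof -
  define c where "c = coeff (cusp_poly F) 9"
  have "cusp_poly F - smult c (pCons 0 fpoly) = 0"
  proof (rule poly_eq_0_card[OF finite_R])
    fix i assume "card R \<le> i"
    then consider "i = 8" | "i = 9" | "i > 9" using card_R by linarith
    then show "coeff (cusp_poly F - smult c (pCons 0 fpoly)) i = 0"
    proof cases
      case 1 then show ?thesis using coeff_cusp_poly_gap[OF assms(1)] a_7
        by (simp add: coeff_pCons eval_nat_numeral)
    next
      case 2 then show ?thesis using a_8 by (simp add: coeff_pCons c_def eval_nat_numeral)
    next
      case 3 then show ?thesis using degree_cusp_poly[OF assms(1)]
        by (auto simp: coeff_pCons coeff_eq_0 split: nat.split)
    qed
  next
    fix s assume "s \<in> R"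
    then show "poly (cusp_poly F - smult c (pCons 0 fpoly)) s = 0"
      using assms(2) poly_fpoly_0_iff by (simp add: poly_cusp_poly)
  qed
  then show ?thesis using that by simp
qed

lemma fpoly_simple: "s \<in> R \<Longrightarrow> poly (pderiv fpoly) s \<noteq> 0"
proof -
  assume s: "s \<in> R"
  have e: "fpoly = [:- s, 1:] * (\<Prod>t\<in>R - {s}. [:- t, 1:])"
    unfolding fpoly_def by (rule prod.remove[OF finite_R s])
  have "poly (pderiv fpoly) s = poly (\<Prod>t\<in>R - {s}. [:- t, 1:]) s"
    unfolding e pderiv_mult by (simp add: pderiv_pCons)
  then show ?thesis using finite_R by (auto simp: poly_prod)
qed

text \<open>A singularity at \<open>cpt s\<close> would give the restriction to the cuspidal cubic a
  multiple zero at \<open>s\<close>, but \<open>s\<close> is a simple zero of s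
  \<open>fpoly\<close>. So the restriction is 0 and the cubic is a multiple of the cuspidal one,
  which is smooth at \<open>cpt s\<close>.\<close>

lemma general_points_pts: "general_points pts"
proof -
  have "\<not> ((\<forall>x\<in>pts. on_curve F x) \<and> (\<exists>x\<in>pts. singular_at F x))" if "plane_curve 3 F" for F
  proof (intro notI, elim conjE bexE)
    fix x assume all: "\<forall>x\<in>pts. on_curve F x" and x: "x \<in> pts" "singular_at F x"
    have F: "homog 3 F" "F \<noteq> 0" using that by (auto simp: plane_curve_def)
    obtain s where s: "s \<in> R" "x = proj_pt (cpt s)" using x by (auto simp: pts_def)
    have d: "eval3 (pderiv3 i F) (cpt s) = 0" for i
      using x(2) s(2) mem_proj_pt[of "cpt s"] by (auto simp: singular_at_def on_curve_def)
    have "eval3 F (cpt t) = 0" if "t \<in> R" for t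
      using all that on_curve_proj_pt[OF F(1)] by (auto simp: pts_def)
    then obtain c where c: "cusp_poly F = smult c (pCons 0 fpoly)"
      using cusp_poly_cubic_through[OF F(1)] by blast
    have "0 = poly (pderiv (cusp_poly F)) s" by (simp add: pderiv_cusp_poly d)
    also have "\<dots> = c * (s * poly (pderiv fpoly) s)"
      using s poly_fpoly_0_iff by (simp add: c pderiv_smult pderiv_pCons)
    finally have "c = 0" using fpoly_simple[OF s(1)] R_nonzero[OF s(1)] by simp
    then have "cusp_poly F = 0" using c by simp
    then obtain e where e: "F = const3 e * cusp_cubic X3"
      using cusp_poly_eq_0_cubic[OF infinite_alg_closed F(1)] by blast
    have "eval3 (pderiv3 3 F) (cpt s) = e"
      by (simp add: e cusp_cubic_def eval3_evh power2_eq_square power3_eq_cube)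
    then have "e = 0" using d by simp
    then show False using F(2) e by (simp add: const3_def)
  qed
  then show ?thesis
    using few_points_on_curve[of 1] few_points_on_curve[of 2] by (simp add: general_points_def)
qed

end

text \<open>The pencil is spanned by the cuspidal cubic and by \<open>gcub a\<close>, whose coefficients are chosen such
  that its restriction to the cuspidal cubic is \<open>s * f s\<close> for
  \<open>f s = s^8 + a 6 * s^6 + a 5 * s^5 + \<dots> + a 0\<close>. The member with parameter \<open>(p : r)\<close> is \<open>pen a p r\<close>,
  with polar form \<open>dpen a p r\<close>, and \<open>tang a p r\<close> is the third point that it has in common with its
  tangent at the ninth base point \<open>(1 : 0 : 0)\<close>. The inverse of \<open>v\<close> on the member through \<open>v\<close> is
  the third point on the line through \<open>v\<close> and \<open>tang\<close>, which is the value of \<open>bert a\<close> at \<open>v\<close>.\<close>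

definition gcub :: "(nat \<Rightarrow> 'a::comm_ring_1) \<Rightarrow> 'a ^ 3 \<Rightarrow> 'a" where
  "gcub a v = (v $ 3) ^ 3 + a 6 * v $ 2 * (v $ 3)\<^sup>2 + a 5 * v $ 1 * (v $ 3)\<^sup>2
     + a 4 * (v $ 2)\<^sup>2 * v $ 3 + a 3 * v $ 1 * v $ 2 * v $ 3 + a 2 * (v $ 2) ^ 3
     + a 1 * v $ 1 * (v $ 2)\<^sup>2 + a 0 * (v $ 1)\<^sup>2 * v $ 2"

definition dcusp :: "'a::comm_ring_1 ^ 3 \<Rightarrow> 'a ^ 3 \<Rightarrow> 'a" where
  "dcusp u v = 2 * u $ 1 * u $ 3 * v $ 1 - 3 * (u $ 2)\<^sup>2 * v $ 2 + (u $ 1)\<^sup>2 * v $ 3"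

definition dgcub :: "(nat \<Rightarrow> 'a::comm_ring_1) \<Rightarrow> 'a ^ 3 \<Rightarrow> 'a ^ 3 \<Rightarrow> 'a" where
  "dgcub a u v =
     (a 5 * (u $ 3)\<^sup>2 + a 3 * u $ 2 * u $ 3 + a 1 * (u $ 2)\<^sup>2 + 2 * a 0 * u $ 1 * u $ 2) * v $ 1
   + (a 6 * (u $ 3)\<^sup>2 + 2 * a 4 * u $ 2 * u $ 3 + a 3 * u $ 1 * u $ 3 + 3 * a 2 * (u $ 2)\<^sup>2
       + 2 * a 1 * u $ 1 * u $ 2 + a 0 * (u $ 1)\<^sup>2) * v $ 2
   + (3 * (u $ 3)\<^sup>2 + 2 * a 6 * u $ 2 * u $ 3 + 2 * a 5 * u $ 1 * u $ 3 + a 4 * (u $ 2)\<^sup>2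
       + a 3 * u $ 1 * u $ 2) * v $ 3"

text \<open>The factor \<open>a 0\<close> makes the terms with x^2 equal to \<open>a 0\<close> x^2
  (p y - r z), so that the tangent at (1 : 0 : 0) is p y = r z.\<close>

definition pen :: "(nat \<Rightarrow> 'a::comm_ring_1) \<Rightarrow> 'a \<Rightarrow> 'a \<Rightarrow> 'a ^ 3 \<Rightarrow> 'a" where
  "pen a p r v = p * gcub a v - a 0 * r * cusp_cubic v"

definition dpen :: "(nat \<Rightarrow> 'a::comm_ring_1) \<Rightarrow> 'a \<Rightarrow> 'a \<Rightarrow> 'a ^ 3 \<Rightarrow> 'a ^ 3 \<Rightarrow> 'a" where
  "dpen a p r u v = p * dgcub a u v - a 0 * r * dcusp u v"

text \<open>On the tangent, at the point (x, r t, p t), the member has the value t^2 (t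
  \<open>tA\<close> + p x \<open>tB\<close>); the last factor has the zero x = \<open>tA\<close>, t
  = - p \<open>tB\<close>.\<close>

definition tA :: "(nat \<Rightarrow> 'a::comm_ring_1) \<Rightarrow> 'a \<Rightarrow> 'a \<Rightarrow> 'a" where
  "tA a p r = p ^ 4 + a 6 * p ^ 3 * r + a 4 * p\<^sup>2 * r\<^sup>2 + a 2 * p * r ^ 3 + a 0 * r ^ 4"

definition tB :: "(nat \<Rightarrow> 'a::comm_ring_1) \<Rightarrow> 'a \<Rightarrow> 'a \<Rightarrow> 'a" where
  "tB a p r = a 5 * p\<^sup>2 + a 3 * p * r + a 1 * r\<^sup>2"

definition tang :: "(nat \<Rightarrow> 'a::comm_ring_1) \<Rightarrow> 'a \<Rightarrow> 'a \<Rightarrow> 'a ^ 3" where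
  "tang a p r = vector [tA a p r, - (p * r * tB a p r), - (p\<^sup>2 * tB a p r)]"

text \<open>For \<open>v\<close> and w = \<open>tang\<close> on the member, its value at s v + t w
  is s t (s P + t Q) with P = \<open>dpen\<close> at (v, w) and Q = \<open>dpen\<close> at (w, v).
  The third zero is s = Q, t = - P.\<close>

definition third_pt :: "(nat \<Rightarrow> 'a::comm_ring_1) \<Rightarrow> 'a \<Rightarrow> 'a \<Rightarrow> 'a ^ 3 \<Rightarrow> 'a ^ 3" where
  "third_pt a p r v = dpen a p r (tang a p r) v *s v - dpen a p r v (tang a p r) *s tang a p r"

definition bert :: "(nat \<Rightarrow> 'a::comm_ring_1) \<Rightarrow> 'a ^ 3 \<Rightarrow> 'a ^ 3" where
  "bert a v = third_pt a (a 0 * cusp_cubic v) (gcub a v) v"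

lemma tang_nth [simp]: "tang a p r $ 1 = tA a p r" "tang a p r $ 2 = - (p * r * tB a p r)"
  "tang a p r $ 3 = - (p\<^sup>2 * tB a p r)"
  by (simp_all add: tang_def vector_3)

lemma cusp_expand: "cusp_cubic (s *s u + t *s v) =
   s ^ 3 * cusp_cubic u + s\<^sup>2 * t * dcusp u v + s * t\<^sup>2 * dcusp v u + t ^ 3 * cusp_cubic v"
  by (simp add: cusp_cubic_def dcusp_def power2_eq_square power3_eq_cube algebra_simps)

lemma gcub_expand: "gcub a (s *s u + t *s v) =
   s ^ 3 * gcub a u + s\<^sup>2 * t * dgcub a u v + s * t\<^sup>2 * dgcub a v u + t ^ 3 * gcub a v"
  by (simp add: gcub_def dgcub_def power2_eq_square power3_eq_cube algebra_simps)

lemma pen_expand: "pen a p r (s *s u + t *s v) =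
   s ^ 3 * pen a p r u + s\<^sup>2 * t * dpen a p r u v + s * t\<^sup>2 * dpen a p r v u + t ^ 3 * pen a p r v"
  unfolding pen_def dpen_def cusp_expand gcub_expand by (simp add: algebra_simps)

lemma dpen_euler: "dpen a p r u u = 3 * pen a p r u"
  by (simp add: pen_def dpen_def gcub_def dgcub_def cusp_cubic_def dcusp_def power2_eq_square power3_eq_cube algebra_simps)

lemma dpen_right: "dpen a p r u (s *s v + t *s w) = s * dpen a p r u v + t * dpen a p r u w"
  by (simp add: dpen_def dgcub_def dcusp_def algebra_simps)

lemma dpen_left: "dpen a p r (s *s u + t *s v) v =
    s\<^sup>2 * dpen a p r u v + 2 * s * t * dpen a p r v u + 3 * t\<^sup>2 * pen a p r v"
  by (simp add: pen_def dpen_def gcub_def dgcub_def cusp_cubic_def dcusp_def power2_eq_square power3_eq_cube algebra_simps)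

lemma pen_scale: "pen a (c * p) (c * r) v = c * pen a p r v" "pen a p r (c *s v) = c ^ 3 * pen a p r v"
  by (simp_all add: pen_def gcub_def cusp_cubic_def power2_eq_square power3_eq_cube algebra_simps)

lemma cusp_scale: "cusp_cubic (c *s v) = c ^ 3 * cusp_cubic v"
  by (simp add: cusp_cubic_def power2_eq_square power3_eq_cube algebra_simps)

lemma gcub_scale: "gcub a (c *s v) = c ^ 3 * gcub a v"
  by (simp add: gcub_def power2_eq_square power3_eq_cube algebra_simps)

lemma dpen_scale: "dpen a (c * p) (c * r) u v = c * dpen a p r u v"
  "dpen a p r (c *s u) v = c\<^sup>2 * dpen a p r u v" "dpen a p r u (c *s v) = c * dpen a p r u v"
  by (simp_all add: dpen_def dgcub_def dcusp_def power2_eq_square algebra_simps)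

lemma tang_scale: "tang a (c * p) (c * r) = c ^ 4 *s tang a p r"
  by (rule vec3_eqI) (simp_all add: tA_def tB_def power_mult_distrib algebra_simps eval_nat_numeral)

text \<open>The line \<open>y : z = r : p\<close> is the tangent at the base point \<open>(1 : 0 : 0)\<close>.\<close>

lemma pen_tangent_line:
  "pen a p r (vector [x, r * t, p * t]) = t\<^sup>2 * (t * tA a p r + p * x * tB a p r)"
  by (simp add: pen_def gcub_def cusp_cubic_def tA_def tB_def vector_3 algebra_simps eval_nat_numeral)

lemma pen_tang [simp]: "pen a p r (tang a p r) = 0"
proof -
  have e: "tang a p r = vector [tA a p r, r * - (p * tB a p r), p * - (p * tB a p r)]"
    by (rule vec3_eqI) (simp_all add: vector_3 power2_eq_square algebra_simps)
  show ?thesis unfolding e pen_tangent_line by (simp add: algebra_simps)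
qed

lemma pen_origin [simp]: "pen a p r (cpt 0) = 0"
  by (simp add: pen_def gcub_def)

lemma dpen_origin: "dpen a p r (cpt 0) v = a 0 * (p * v $ 2 - r * v $ 3)"
  by (simp add: dpen_def dgcub_def dcusp_def algebra_simps)

lemma dpen_origin_tang [simp]: "dpen a p r (cpt 0) (tang a p r) = 0"
  by (simp add: dpen_origin power2_eq_square algebra_simps)

lemma pen_member: "pen a (a 0 * cusp_cubic v) (gcub a v) v = 0"
  by (simp add: pen_def algebra_simps)

lemma third_pt:
  fixes a p r v
  defines "w \<equiv> tang a p r" and "y \<equiv> third_pt a p r v"
  assumes "pen a p r v = 0"
  shows pen_third_pt: "pen a p r y = 0"
    and dpen_tang_third_pt: "dpen a p r w y = (dpen a p r w v)\<^sup>2"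
    and dpen_third_pt_tang: "dpen a p r y w = - ((dpen a p r w v)\<^sup>2 * dpen a p r v w)"
proof -
  have y: "y = dpen a p r w v *s v + (- dpen a p r v w) *s w"
    by (simp add: y_def third_pt_def w_def vec_eq_iff)
  have w: "pen a p r w = 0" by (simp add: w_def)
  show "pen a p r y = 0"
    unfolding y pen_expand using assms(3) w by (simp add: algebra_simps power2_eq_square)
  show "dpen a p r w y = (dpen a p r w v)\<^sup>2"
    unfolding y dpen_right using w by (simp add: dpen_euler power2_eq_square)
  show "dpen a p r y w = - ((dpen a p r w v)\<^sup>2 * dpen a p r v w)"
    unfolding y dpen_left using w by (simp add: algebra_simps power2_eq_square)
qed

text \<open>\<open>tang\<close> has degree 4 in the parameter, and \<open>dpen\<close> is linear in
  it, quadratic in its first and linear in its second vector: 9 = 1 + 2 * 4 = 1 + 4 + 4.\<close>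

lemma third_pt_scale: "third_pt a (c * p) (c * r) v = c ^ 9 *s third_pt a p r v"
  by (rule vec3_eqI) (simp_all add: third_pt_def tang_scale dpen_scale algebra_simps eval_nat_numeral)

text \<open>With P and Q as the two values of \<open>dpen\<close> at \<open>v\<close>, the point Q v
  - P w has the values - Q^2 P and Q^2 instead, and Q^2 (Q v - P w) + Q^2 P w = Q^3 v.\<close>

lemma third_pt_involution:
  assumes "pen a p r v = 0"
  shows "third_pt a p r (third_pt a p r v) = (dpen a p r (tang a p r) v) ^ 3 *s v"
  unfolding third_pt_def[of a p r "third_pt a p r v"] dpen_tang_third_pt[OF assms] dpen_third_pt_tang[OF assms]
  by (rule vec3_eqI) (simp_all add: third_pt_def algebra_simps eval_nat_numeral)

lemma bert_member: "a 0 * (cusp_cubic v * gcub a (bert a v)) = a 0 * (gcub a v * cusp_cubic (bert a v))"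
  using pen_third_pt[OF pen_member[of a v]] by (simp add: bert_def pen_def algebra_simps)

lemma bert_involution:
  fixes v :: "'a::field ^ 3"
  assumes "a 0 \<noteq> 0" "cusp_cubic v \<noteq> 0"
  shows "bert a (bert a v) = (cusp_cubic (bert a v) / cusp_cubic v) ^ 9 *s
     ((dpen a (a 0 * cusp_cubic v) (gcub a v) (tang a (a 0 * cusp_cubic v) (gcub a v)) v) ^ 3 *s v)"
proof -
  let ?y = "bert a v" and ?c = "cusp_cubic (bert a v) / cusp_cubic v"
  \<comment> \<open>A point and its image lie on the same member, so their parameters are
    proportional with the factor \<open>?c\<close>.\<close>
  have 1: "a 0 * cusp_cubic ?y = ?c * (a 0 * cusp_cubic v)" using assms by simp
  have "cusp_cubic v * gcub a ?y = gcub a v * cusp_cubic ?y"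
    using bert_member[of a v] assms(1) by (metis mult_left_cancel)
  then have 2: "gcub a ?y = ?c * gcub a v" using assms by (simp add: field_simps)
  have "bert a ?y = third_pt a (a 0 * cusp_cubic ?y) (gcub a ?y) ?y" by (simp only: bert_def)
  also have "\<dots> = ?c ^ 9 *s third_pt a (a 0 * cusp_cubic v) (gcub a v) ?y"
    by (simp only: 1 2 third_pt_scale)
  also have "third_pt a (a 0 * cusp_cubic v) (gcub a v) ?y =
     (dpen a (a 0 * cusp_cubic v) (gcub a v) (tang a (a 0 * cusp_cubic v) (gcub a v)) v) ^ 3 *s v"
    unfolding bert_def by (rule third_pt_involution[OF pen_member])
  finally show ?thesis .
qed

text \<open>On the cuspidal cubic, the member \<open>p = 0\<close>, the involution is \<open>s \<mapsto> - s\<close>. These values show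
  that various forms do not vanish identically.\<close>

lemma tang_0: "tang a 0 r = (a 0 * r ^ 4) *s cpt 0"
  by (rule vec3_eqI) (simp_all add: tA_def)

lemma dpen_tang_cpt: "dpen a 0 r (tang a 0 r) (cpt s) = - (a 0 ^ 3 * r ^ 9 * s ^ 3)"
  by (simp add: tang_0 dpen_scale dpen_def dcusp_def algebra_simps eval_nat_numeral)

lemma bert_cpt: "bert a (cpt s) = (a 0 ^ 3 * gcub a (cpt s) ^ 9 * s ^ 3) *s cpt (- s)"
  by (rule vec3_eqI) (simp_all add: bert_def third_pt_def tang_0 dpen_scale dpen_def dcusp_def algebra_simps eval_nat_numeral)

lemma gcub_cpt: "gcub a (cpt s) = s * (s ^ 8 + a 6 * s ^ 6 + a 5 * s ^ 5 + a 4 * s ^ 4 + a 3 * s ^ 3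
   + a 2 * s\<^sup>2 + a 1 * s + a 0)"
  by (simp add: gcub_def algebra_simps eval_nat_numeral)

section \<open>Linear independence and proportionality of vectors\<close>

text \<open>Vanishing of the minors: the zero vector is parallel to every vector, so transitivity
  needs a nonzero middle term.\<close>

definition par :: "'a::comm_ring_1 ^ 3 \<Rightarrow> 'a ^ 3 \<Rightarrow> bool" where
  "par u v \<longleftrightarrow> (\<forall>i j. u $ i * v $ j = u $ j * v $ i)"

lemma par_sym: "par u v \<Longrightarrow> par v u"
  by (simp add: par_def mult.commute)

lemma par_3: "par u v \<longleftrightarrow> u $ 1 * v $ 2 = u $ 2 * v $ 1 \<and> u $ 1 * v $ 3 = u $ 3 * v $ 1
   \<and> u $ 2 * v $ 3 = u $ 3 * v $ 2"
  unfolding par_def by (auto simp: forall_3 mult.commute)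

lemma par_scaleE:
  fixes u v :: "'a::field ^ 3"
  assumes "par u v" "v \<noteq> 0"
  obtains c where "u = c *s v"
proof -
  obtain i where i: "v $ i \<noteq> 0" using assms(2) by (auto simp: vec_eq_iff)
  have "u = (u $ i / v $ i) *s v"
    using assms(1) i by (simp add: vec_eq_iff par_def field_simps)
  then show ?thesis by (rule that)
qed

lemma par_scale: "par (c *s v) v" "par v (c *s v)"
  by (auto simp: par_def)

lemma par_trans:
  fixes u v :: "'a::field ^ 3"
  assumes "par u v" "par v w" "v \<noteq> 0"
  shows "par u w"
proof -
  obtain c d where "u = c *s v" "w = d *s v"
    using assms par_sym par_scaleE by metis
  then show ?thesis by (simp add: par_def)
qed

lemma not_par_indep:
  fixes u v :: "'a::field ^ 3"
  assumes "\<not> par u v" "s *s u + t *s v = 0"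
  shows "s = 0" "t = 0"
proof -
  have e: "s * u $ i + t * v $ i = 0" for i
    using arg_cong[OF assms(2), of "\<lambda>x. x $ i"] by simp
  obtain i j where ij: "u $ i * v $ j \<noteq> u $ j * v $ i" using assms(1) by (auto simp: par_def)
  have "s * (u $ i * v $ j - u $ j * v $ i) = (s * u $ i + t * v $ i) * v $ j - (s * u $ j + t * v $ j) * v $ i"
    "t * (u $ i * v $ j - u $ j * v $ i) = (s * u $ j + t * v $ j) * u $ i - (s * u $ i + t * v $ i) * u $ j"
    by (simp_all add: algebra_simps)
  then have "s * (u $ i * v $ j - u $ j * v $ i) = 0" "t * (u $ i * v $ j - u $ j * v $ i) = 0"
    unfolding e by simp_all
  then show "s = 0" "t = 0" using ij by simp_all
qed

lemma combination_divide:
  fixes u v x :: "'a::field ^ 3"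
  assumes "l \<noteq> 0" "l * x $ 1 = s * u $ 1 + t * v $ 1" "l * x $ 2 = s * u $ 2 + t * v $ 2"
    "l * x $ 3 = s * u $ 3 + t * v $ 3"
  shows "x = (s / l) *s u + (t / l) *s v"
proof -
  have *: "y = (s / l) * b + (t / l) * c" if "l * y = s * b + t * c" for y b c
    using that assms(1) by (simp add: field_simps)
  show ?thesis using assms(2-4) by (intro vec3_eqI) (simp_all only: vector_add_component vector_smult_component *)
qed

definition det3 :: "'a::comm_ring_1 ^ 3 \<Rightarrow> 'a ^ 3 \<Rightarrow> 'a ^ 3 \<Rightarrow> 'a" where
  "det3 x u v = x $ 1 * (u $ 2 * v $ 3 - u $ 3 * v $ 2) + x $ 2 * (u $ 3 * v $ 1 - u $ 1 * v $ 3)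
     + x $ 3 * (u $ 1 * v $ 2 - u $ 2 * v $ 1)"

text \<open>Cramer's rule, with one of the minors \<open>l1\<close>, \<open>l2\<close>,
  \<open>l3\<close> of \<open>u\<close> and \<open>v\<close> as denominator.\<close>

lemma det3_span:
  fixes u v :: "'a::field ^ 3"
  assumes "\<not> par u v" "det3 x u v = 0"
  shows "\<exists>s t. x = s *s u + t *s v"
proof -
  define l1 l2 l3 where l: "l1 = u $ 2 * v $ 3 - u $ 3 * v $ 2" "l2 = u $ 3 * v $ 1 - u $ 1 * v $ 3"
     "l3 = u $ 1 * v $ 2 - u $ 2 * v $ 1"
  have x: "l1 * x $ 1 + l2 * x $ 2 + l3 * x $ 3 = 0" using assms(2) by (simp add: det3_def l mult.commute)
  consider "l1 \<noteq> 0" | "l2 \<noteq> 0" | "l3 \<noteq> 0" using assms(1) by (auto simp: par_3 l)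
  then show ?thesis
  proof cases
    assume n: "l1 \<noteq> 0"
    let ?s = "(x $ 2 * v $ 3 - x $ 3 * v $ 2)" and ?t = "(u $ 2 * x $ 3 - u $ 3 * x $ 2)"
    have "l1 * x $ 1 = - (l2 * x $ 2) - l3 * x $ 3" using x by (simp add: algebra_simps eq_neg_iff_add_eq_0)
    then have "l1 * x $ 1 = ?s * u $ 1 + ?t * v $ 1" by (simp add: l algebra_simps)
    moreover have "l1 * x $ 2 = ?s * u $ 2 + ?t * v $ 2" "l1 * x $ 3 = ?s * u $ 3 + ?t * v $ 3"
      by (simp_all add: l algebra_simps)
    ultimately have "x = (?s / l1) *s u + (?t / l1) *s v"
      using n by (intro combination_divide)
    then show ?thesis by blast
  next
    assume n: "l2 \<noteq> 0"
    let ?s = "(x $ 3 * v $ 1 - x $ 1 * v $ 3)" and ?t = "(u $ 3 * x $ 1 - u $ 1 * x $ 3)"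
    have "l2 * x $ 2 = - (l1 * x $ 1) - l3 * x $ 3" using x by (simp add: algebra_simps eq_neg_iff_add_eq_0)
    then have "l2 * x $ 2 = ?s * u $ 2 + ?t * v $ 2" by (simp add: l algebra_simps)
    moreover have "l2 * x $ 1 = ?s * u $ 1 + ?t * v $ 1" "l2 * x $ 3 = ?s * u $ 3 + ?t * v $ 3"
      by (simp_all add: l algebra_simps)
    ultimately have "x = (?s / l2) *s u + (?t / l2) *s v"
      using n by (intro combination_divide)
    then show ?thesis by blast
  next
    assume n: "l3 \<noteq> 0"
    let ?s = "(x $ 1 * v $ 2 - x $ 2 * v $ 1)" and ?t = "(u $ 1 * x $ 2 - u $ 2 * x $ 1)"
    have "l3 * x $ 3 = - (l1 * x $ 1) - l2 * x $ 2" using x by (simp add: algebra_simps eq_neg_iff_add_eq_0)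
    then have "l3 * x $ 3 = ?s * u $ 3 + ?t * v $ 3" by (simp add: l algebra_simps)
    moreover have "l3 * x $ 1 = ?s * u $ 1 + ?t * v $ 1" "l3 * x $ 2 = ?s * u $ 2 + ?t * v $ 2"
      by (simp_all add: l algebra_simps)
    ultimately have "x = (?s / l3) *s u + (?t / l3) *s v"
      using n by (intro combination_divide)
    then show ?thesis by blast
  qed
qed

lemma plane_form:
  fixes u v :: "'a::field ^ 3"
  assumes "\<not> par u v"
  obtains l :: "'a ^ 3" where "l \<noteq> 0"
    "\<forall>x. l $ 1 * x $ 1 + l $ 2 * x $ 2 + l $ 3 * x $ 3 = 0 \<longrightarrow> (\<exists>s t. x = s *s u + t *s v)"
proof -
  define l :: "'a ^ 3" where "l = vector [u $ 2 * v $ 3 - u $ 3 * v $ 2, u $ 3 * v $ 1 - u $ 1 * v $ 3,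
     u $ 1 * v $ 2 - u $ 2 * v $ 1]"
  have "l \<noteq> 0" using assms by (auto simp: l_def vec_eq_iff forall_3 vector_3 par_3)
  moreover have "det3 x u v = l $ 1 * x $ 1 + l $ 2 * x $ 2 + l $ 3 * x $ 3" for x
    by (simp add: det3_def l_def vector_3 mult.commute)
  then have "\<forall>x. l $ 1 * x $ 1 + l $ 2 * x $ 2 + l $ 3 * x $ 3 = 0 \<longrightarrow> (\<exists>s t. x = s *s u + t *s v)"
    using det3_span[OF assms] by simp
  ultimately show ?thesis by (rule that)
qed

section \<open>The pencil of cubics through the eight points\<close>

lemma poly_infinite_eqI:
  fixes p r :: "'a::idom poly"
  assumes "infinite (UNIV :: 'a set)" "\<And>x. poly p x = poly r x"
  shows "p = r"
proof (rule ccontr)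
  assume "p \<noteq> r"
  then have "finite {x. poly (p - r) x = 0}" by (intro poly_roots_finite) simp
  then show False using assms by simp
qed

text \<open>A difference quotient in the third coordinate. Over a polynomial ring it shows that the
  restrictions of \<open>gcub\<close> to two curves with the same x and y are congruent modulo the
  difference of their z.\<close>

lemma gcub_diff:
  assumes "u $ 1 = v $ 1" "u $ 2 = v $ 2"
  shows "gcub a u - gcub a v = (u $ 3 - v $ 3) * ((u $ 3)\<^sup>2 + u $ 3 * v $ 3 + (v $ 3)\<^sup>2
     + a 6 * v $ 2 * (u $ 3 + v $ 3) + a 5 * v $ 1 * (u $ 3 + v $ 3) + a 4 * (v $ 2)\<^sup>2 + a 3 * v $ 1 * v $ 2)"
  using assms by (simp add: gcub_def power2_eq_square power3_eq_cube algebra_simps)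

lemma poly_gcub: "poly (gcub (\<lambda>i. [:a i:]) v) x = gcub a (\<chi> i. poly (v $ i) x)"
  by (simp add: gcub_def)

context eight_points
begin

lemma poly_fpoly: "poly fpoly s = s ^ 8 + a 6 * s ^ 6 + a 5 * s ^ 5 + a 4 * s ^ 4 + a 3 * s ^ 3
   + a 2 * s\<^sup>2 + a 1 * s + a 0"
proof -
  have "{..8::nat} = {0,1,2,3,4,5,6,7,8}" by auto
  then have "poly fpoly s = (\<Sum>i\<in>{0,1,2,3,4,5,6,7,8}. a i * s ^ i)"
    by (simp add: poly_altdef)
  then show ?thesis by (simp add: a_7 a_8)
qed

lemma gcub_cpt_fpoly: "gcub a (cpt s) = s * poly fpoly s"
  by (simp add: gcub_cpt poly_fpoly)

lemma a_0_nonzero: "a 0 \<noteq> 0"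
  using poly_fpoly_0_iff[of 0] R_nonzero by (auto simp: poly_0_coeff_0)

lemma gcub_cpt_0_iff: "gcub a (cpt s) = 0 \<longleftrightarrow> s \<in> insert 0 R"
  by (auto simp: gcub_cpt_fpoly poly_fpoly_0_iff)

lemma base_points:
  assumes "cusp_cubic v = 0" "gcub a v = 0" "v \<noteq> 0"
  obtains c s where "c \<noteq> 0" "s \<in> insert 0 R" "v = c *s cpt s"
proof (cases "v $ 1 = 0")
  case True
  then have 2: "v $ 2 = 0" using assms(1) by (simp add: cusp_cubic_def)
  then have "v $ 3 = 0" using True assms(2) by (simp add: gcub_def)
  then show ?thesis using True 2 assms(3) by (metis vec3_eqI zero_index)
next
  case False
  let ?s = "v $ 2 / v $ 1"
  have "v $ 3 = v $ 1 * ?s ^ 3"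
    using assms(1) False by (simp add: cusp_cubic_def field_simps eval_nat_numeral)
  then have v: "v = v $ 1 *s cpt ?s" using False by (intro vec3_eqI) simp_all
  have "gcub a (cpt ?s) = 0" using assms(2) False by (subst (asm) v) (simp add: gcub_scale)
  then show ?thesis using that[OF False _ v] by (simp only: gcub_cpt_0_iff)
qed

text \<open>A line z = m y + n x meets the cuspidal cubic at the zeros of g = y^3 - m y - n. If a
  member contained the line, g would divide y \<open>fpoly\<close>, which has nine different zeros;
  so g would have three different zeros in \<open>insert 0 R\<close>, and their sum is 0.\<close>

lemma no_line:
  assumes "p \<noteq> 0 \<or> r \<noteq> 0" "\<not> par u v"
  obtains s t where "pen a p r (s *s u + t *s v) \<noteq> 0"
proof (rule ccontr)
  assume "\<not> thesis"
  then have z: "pen a p r (s *s u + t *s v) = 0" for s t using that by blast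
  obtain l :: "'a ^ 3" where l: "l \<noteq> 0" "\<forall>x. l $ 1 * x $ 1 + l $ 2 * x $ 2 + l $ 3 * x $ 3 = 0 \<longrightarrow> (\<exists>s t. x = s *s u + t *s v)"
    by (rule plane_form[OF assms(2)])
  have 0: "pen a p r x = 0" if "l $ 1 * x $ 1 + l $ 2 * x $ 2 + l $ 3 * x $ 3 = 0" for x
    using l(2) that z by metis
  show False
  proof (cases "l $ 3 = 0")
    case l3: True
    \<comment> \<open>The line passes through (0 : 0 : 1), where \<open>gcub\<close> is 1 and the
      cuspidal cubic is 0.\<close>
    have "pen a p r (vector [0, 0, 1]) = 0" by (rule 0) (simp add: vector_3 l3)
    then have p: "p = 0" by (simp add: pen_def gcub_def cusp_cubic_def vector_3)
    show False
    proof (cases "l $ 2 = 0")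
      case True
      then have "l $ 1 \<noteq> 0" using l(1) l3 by (metis vec3_eqI zero_index)
      have "pen a p r (vector [0, 1, 0]) = 0" by (rule 0) (simp add: vector_3 True)
      then show False using p assms(1) a_0_nonzero by (simp add: pen_def cusp_cubic_def vector_3)
    next
      case False
      let ?n = "- l $ 1 / l $ 2"
      have "pen a p r (vector [1, ?n, ?n ^ 3 + 1]) = 0" by (rule 0) (simp add: vector_3 l3 False)
      then show False using p assms(1) a_0_nonzero by (simp add: pen_def cusp_cubic_def vector_3)
    qed
  next
    case False
    define m where "m = - l $ 2 / l $ 3"
    define n where "n = - l $ 1 / l $ 3"
    have line: "pen a p r (vector [1, y, m * y + n]) = 0" for y
      by (rule 0) (use False in \<open>simp add: vector_3 m_def n_def field_simps\<close>)
    define g where "g = [:- n, - m, 0, 1:]"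
    have g: "poly g y = y ^ 3 - (m * y + n)" for y
      by (simp add: g_def algebra_simps power3_eq_cube)
    have g0: "g \<noteq> 0" "degree g = 3" by (auto simp: g_def)
    have p: "p \<noteq> 0"
    proof
      assume p: "p = 0"
      have "g = 0"
      proof (rule poly_infinite_eqI[OF infinite_alg_closed])
        fix y show "poly g y = poly 0 y"
          using line[of y] p assms(1) a_0_nonzero by (simp add: g pen_def cusp_cubic_def vector_3)
      qed
      then show False using g0 by simp
    qed
    \<comment> \<open>\<open>U\<close> runs through the cuspidal cubic and \<open>V\<close> through
      the line, with the same x and y.\<close>
    define U :: "'a poly ^ 3" where "U = vector [1, [:0, 1:], [:0, 1:] ^ 3]"
    define V :: "'a poly ^ 3" where "V = vector [1, [:0, 1:], [:n, m:]]"
    have UV: "U $ 1 = V $ 1" "U $ 2 = V $ 2" "U $ 3 - V $ 3 = g"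
      by (simp_all add: U_def V_def vector_3 g_def eval_nat_numeral)
    have pU: "(\<chi> i. poly (U $ i) y) = cpt y" and pV: "(\<chi> i. poly (V $ i) y) = vector [1, y, m * y + n]" for y
      by (rule vec3_eqI; simp add: U_def V_def vector_3)+
    have 1: "gcub (\<lambda>i. [:a i:]) U = pCons 0 fpoly"
      by (rule poly_infinite_eqI[OF infinite_alg_closed]) (simp add: poly_gcub pU gcub_cpt_fpoly)
    have 2: "gcub (\<lambda>i. [:a i:]) V = smult (- (a 0 * r / p)) g"
    proof (rule poly_infinite_eqI[OF infinite_alg_closed])
      fix y
      have "p * gcub a (vector [1, y, m * y + n]) = a 0 * r * (m * y + n - y ^ 3)"
        using line[of y] by (simp add: pen_def cusp_cubic_def vector_3)
      then show "poly (gcub (\<lambda>i. [:a i:]) V) y = poly (smult (- (a 0 * r / p)) g) y"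
        unfolding poly_gcub pV using p by (simp add: g field_simps)
    qed
    have "g dvd pCons 0 fpoly - smult (- (a 0 * r / p)) g"
      using gcub_diff[OF UV(1,2), of "\<lambda>i. [:a i:]"] unfolding 1 2 UV(3) by simp
    then have "g dvd pCons 0 fpoly"
      by (metis dvd_smult dvd_refl dvd_diff_left_iff)
    then obtain k where k: "pCons 0 fpoly = g * k" by (rule dvdE)
    have fz: "fpoly \<noteq> 0" using degree_fpoly by force
    then have k0: "k \<noteq> 0" using k by auto
    have "degree (pCons 0 fpoly) = degree g + degree k"
      unfolding k using g0 k0 by (intro degree_mult_eq) auto
    then have dk: "degree k = 6" using fz g0 by simp
    define S where "S = {y. poly g y = 0}"
    have "{y. poly (pCons 0 fpoly) y = 0} = insert 0 R" by (auto simp: poly_fpoly_0_iff)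
    then have SR: "insert 0 R = S \<union> {y. poly k y = 0}" unfolding k S_def by auto
    have "card (insert 0 R) = 9" using finite_R card_R R_nonzero by (subst card_insert_disjoint) auto
    then have "9 \<le> card S + card {y. poly k y = 0}" unfolding SR using card_Un_le by metis
    moreover have "card S \<le> 3" "card {y. poly k y = 0} \<le> 6"
      using card_poly_roots_bound[OF g0(1)] card_poly_roots_bound[OF k0] g0 dk by (auto simp: S_def)
    ultimately have cS: "card S = 3" by simp
    then have fS: "finite S" by (intro card_ge_0_finite) simp
    have g2: "coeff g 2 = 0" by (simp add: g_def eval_nat_numeral)
    have S: "poly g s = 0" if "s \<in> S" for s using that by (simp add: S_def)
    have sumS: "\<Sum>S = 0"
      by (rule gap_roots_sum[of g S]) (use cS g0 g2 fS S in auto)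
    \<comment> \<open>A zero at the ninth base point is removed without changing the sum; two or
      three elements of \<open>R\<close> remain.\<close>
    have "S - {0} \<subseteq> R" using SR by auto
    moreover have "card (S - {0}) \<in> {1, 2, 3}" using cS fS by (cases "0 \<in> S") auto
    moreover have "\<Sum>(S - {0}) = 0" using sumS fS by (subst sum_diff1) auto
    ultimately show False using sum_subset by blast
  qed
qed

end

section \<open>Finiteness of the singular members of the pencil\<close>

lemma order_simple_root:
  fixes p r :: "'a::idom poly"
  assumes "p = [:- x, 1:] * r" "poly r x \<noteq> 0"
  shows "order x p = 1"
proof -
  have "r \<noteq> 0" using assms(2) by auto
  then have "order x p = order x ([:- x, 1:] ^ 1) + order x r"
    unfolding assms(1) power_one_right by (intro order_mult) (metis mult_eq_0_iff pCons_eq_0_iff one_neq_zero)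
  then show ?thesis using order_0I[OF assms(2)] by (simp only: order_power_n_n add_0_right)
qed

text \<open>The order at \<open>x\<close> would be even on the left and odd on the right.\<close>

lemma square_times_simple_root:
  fixes U V D :: "'a::idom poly"
  assumes "V\<^sup>2 = U\<^sup>2 * D" "U \<noteq> 0" "order x D = 1" and D: "D \<noteq> 0"
  shows False
proof -
  have V: "V \<noteq> 0" using assms(1,2) D by auto
  have "order x (V\<^sup>2) = 2 * order x V" "order x (U\<^sup>2) = 2 * order x U"
    using V assms(2) by (simp_all add: power2_eq_square order_mult)
  moreover have "order x (U\<^sup>2 * D) = order x (U\<^sup>2) + order x D"
    using assms(2) D by (intro order_mult) simp
  ultimately have "2 * order x V = 2 * order x U + 1" using assms(1,3) by simp
  then show False by presburger
qed

lemma finite_poly_roots_of_family: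
  fixes P :: "'a::idom \<Rightarrow> 'a poly"
  assumes "finite N" "\<And>n. n \<in> N \<Longrightarrow> P n \<noteq> 0"
  shows "finite {m. \<exists>n\<in>N. poly (P n) m = 0}"
proof -
  have "{m. \<exists>n\<in>N. poly (P n) m = 0} = (\<Union>n\<in>N. {m. poly (P n) m = 0})" by auto
  then show ?thesis using assms by (auto intro!: poly_roots_finite)
qed

context eight_points
begin

text \<open>If \<open>fpoly\<close> were even, - s would be a zero with s. As s + (- s) = 0, general
  position forces s = - s, hence characteristic 2; but then an even polynomial has derivative 0 and
  no simple zeros.\<close>

lemma odd_part_nonzero: "\<not> (a 5 = 0 \<and> a 3 = 0 \<and> a 1 = 0)"
proof
  assume odd: "a 5 = 0 \<and> a 3 = 0 \<and> a 1 = 0"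
  obtain s where s: "s \<in> R" using card_R by fastforce
  have "poly fpoly (- s) = poly fpoly s" using odd by (simp add: poly_fpoly)
  also have "\<dots> = 0" using s by (simp only: poly_fpoly_0_iff)
  finally have "- s \<in> R" by (simp only: poly_fpoly_0_iff)
  moreover have "\<Sum>{s, - s} = 0" if "s \<noteq> - s" using that by simp
  ultimately have e: "- s = s" using sum_subset[of "{s, - s}"] s by (cases "s = - s") auto
  then have "2 * s = 0" by (metis mult_2 add.right_inverse)
  then have two: "(2 :: 'a) = 0" using R_nonzero[OF s] by simp
  have "{..8::nat} = {0,1,2,3,4,5,6,7,8}" by auto
  then have "fpoly = (\<Sum>i\<in>{0,1,2,3,4,5,6,7,8}. monom (a i) i)"
    using poly_as_sum_of_monoms[of fpoly] by simp
  then have f: "fpoly = monom (a 0) 0 + (monom (a 2) 2 + (monom (a 4) 4 + (monom (a 6) 6 + monom 1 8)))"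
    using odd a_7 a_8 by simp
  have "(4::'a) = 2 * 2" "(6::'a) = 2 * 3" "(8::'a) = 2 * 4" by simp_all
  then have "pderiv fpoly = 0"
    by (subst f) (simp add: pderiv_add pderiv_monom two)
  then show False using fpoly_simple[OF s] by simp
qed

text \<open>Separating even and odd powers, \<open>fpoly s = s^8 * A (1 / s\<^sup>2) + s^5 * B (1 / s\<^sup>2)\<close> with
  \<open>B = opoly\<close> and \<open>A n = epoly n + a 0 * n^4\<close>; hence \<open>npoly = A\<^sup>2 - n\<^sup>3 * B\<^sup>2\<close> vanishes at the \<open>1 / s\<^sup>2\<close>.\<close>

definition epoly :: "'a poly" where "epoly = [:1, a 6, a 4, a 2:]"
definition opoly :: "'a poly" where "opoly = [:a 5, a 3, a 1:]"
definition npoly :: "'a poly" where "npoly = [:1, a 6, a 4, a 2, a 0:]\<^sup>2 - [:0, 1:] ^ 3 * opoly\<^sup>2"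

lemma npoly_root:
  assumes "s \<in> R"
  shows "poly npoly (1 / s\<^sup>2) = 0"
proof -
  have s: "s \<noteq> 0" using assms R_nonzero by auto
  have "poly [:1, a 6, a 4, a 2, a 0:] (1 / s\<^sup>2) * s ^ 8 + poly opoly (1 / s\<^sup>2) * s ^ 5 = poly fpoly s"
    using s unfolding poly_fpoly opoly_def by (simp add: field_simps eval_nat_numeral)
  then have "poly [:1, a 6, a 4, a 2, a 0:] (1 / s\<^sup>2) * s ^ 8 = - (poly opoly (1 / s\<^sup>2) * s ^ 5)"
    using assms poly_fpoly_0_iff by (simp add: eq_neg_iff_add_eq_0)
  then have "(poly [:1, a 6, a 4, a 2, a 0:] (1 / s\<^sup>2) * s ^ 8)\<^sup>2 = (poly opoly (1 / s\<^sup>2) * s ^ 5)\<^sup>2"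
    by simp
  moreover have "poly npoly (1 / s\<^sup>2) * s ^ 16 =
     (poly [:1, a 6, a 4, a 2, a 0:] (1 / s\<^sup>2) * s ^ 8)\<^sup>2 - (poly opoly (1 / s\<^sup>2) * s ^ 5)\<^sup>2"
  proof -
    define A where "A = poly [:1, a 6, a 4, a 2, a 0:] (1 / s\<^sup>2)"
    define B where "B = poly opoly (1 / s\<^sup>2)"
    have "poly npoly (1 / s\<^sup>2) = A\<^sup>2 - (1 / s\<^sup>2) ^ 3 * B\<^sup>2"
      by (simp add: npoly_def A_def B_def del: poly_pCons) (simp add: power_divide)
    also have "\<dots> * s ^ 16 = (A * s ^ 8)\<^sup>2 - (B * s ^ 5)\<^sup>2"
      using s by (simp add: field_simps eval_nat_numeral)
    finally show ?thesis by (simp only: A_def B_def)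
  qed
  ultimately show ?thesis using s by simp
qed

text \<open>The values 1 / s^2 are different because s + t is not 0 for two elements of
  \<open>R\<close>. They are eight zeros of a polynomial of degree 8 and therefore all
  simple.\<close>

lemma npoly_simple_root:
  obtains x where "order x npoly = 1" "npoly \<noteq> 0"
proof -
  define T where "T = (\<lambda>s. 1 / s\<^sup>2) ` R"
  have inj: "inj_on (\<lambda>s. 1 / s\<^sup>2) R"
  proof (rule inj_onI)
    fix s t assume st: "s \<in> R" "t \<in> R" "1 / s\<^sup>2 = 1 / t\<^sup>2"
    then have "s\<^sup>2 = t\<^sup>2" by simp
    then have "s = t \<or> s = - t" by (simp add: power2_eq_iff)
    moreover have False if "s = - t" "s \<noteq> t"
      using sum_subset[of "{s, t}"] that st by auto
    ultimately show "s = t" by blast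
  qed
  have T: "card T = 8" "finite T" using inj card_R finite_R by (simp_all add: T_def card_image)
  define g where "g = (\<Prod>t\<in>T. [:- t, 1:])"
  have g: "degree g = 8" "coeff g 8 = 1" "\<And>t. t \<in> T \<Longrightarrow> poly g t = 0"
    using lead_coeff_prod[of "\<lambda>s. [:- s, 1:]" T] T by (auto simp: g_def poly_prod)
  have n8: "coeff npoly 8 = (a 0)\<^sup>2" "degree npoly \<le> 8"
  proof -
    have "degree ([:1, a 6, a 4, a 2, a 0:]\<^sup>2) \<le> 4 * 2"
      by (rule order_trans[OF degree_power_le]) simp
    moreover have "degree ([:0, 1:] ^ 3 * opoly\<^sup>2) \<le> 7"
    proof -
      have "degree (opoly\<^sup>2) \<le> 2 * 2"
        by (rule order_trans[OF degree_power_le]) (simp add: opoly_def)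
      then show ?thesis
        using degree_mult_le[of "[:0, 1 :: 'a:] ^ 3" "opoly\<^sup>2"] degree_power_le[of "[:0, 1 :: 'a:]" 3] by simp
    qed
    ultimately show "degree npoly \<le> 8" unfolding npoly_def by (intro degree_diff_le) auto
    show "coeff npoly 8 = (a 0)\<^sup>2"
      by (simp add: npoly_def opoly_def power2_eq_square power3_eq_cube coeff_pCons eval_nat_numeral)
  qed
  have "npoly - smult ((a 0)\<^sup>2) g = 0"
  proof (rule poly_eq_0_card[OF T(2)])
    fix i assume "card T \<le> i"
    then show "coeff (npoly - smult ((a 0)\<^sup>2) g) i = 0"
      using n8 g T by (cases "i = 8") (auto simp: coeff_eq_0)
  qed (use g npoly_root in \<open>auto simp: T_def\<close>)
  then have n: "npoly = smult ((a 0)\<^sup>2) g" by simp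
  obtain t where t: "t \<in> T" using T(1) by fastforce
  have "npoly = [:- t, 1:] * smult ((a 0)\<^sup>2) (\<Prod>s\<in>T - {t}. [:- s, 1:])"
    unfolding n g_def by (subst prod.remove[OF T(2) t]) simp
  then have "order t npoly = 1"
    by (rule order_simple_root) (use a_0_nonzero T(2) in \<open>auto simp: poly_prod\<close>)
  moreover have "npoly \<noteq> 0" using n8 a_0_nonzero by auto
  ultimately show ?thesis by (rule that)
qed

text \<open>The line \<open>y : z = n\<close> through \<open>(1 : 0 : 0)\<close> meets the member with parameter \<open>m\<close> in two further
  points, the zeros of a quadratic polynomial with discriminant \<open>D2 n * m\<^sup>2 + D1 n * m + D0 n\<close>; at a
  singular point this discriminant has a double zero in \<open>n\<close>. Outside characteristic \<open>2\<close> this is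
  excluded for almost all \<open>m\<close>, as the discriminant with respect to \<open>m\<close>, which is \<open>npoly\<close> up to a
  factor, is not a square.\<close>

definition D0 :: "'a poly" where "D0 = opoly\<^sup>2 - smult (4 * a 0) ([:0, 1:] * epoly)"
definition D1 :: "'a poly" where "D1 = smult (4 * a 0) (epoly - monom (a 0) 4)"
definition D2 :: "'a poly" where "D2 = monom (4 * (a 0)\<^sup>2) 3"

lemma disc_disc: "D1\<^sup>2 - 4 * (D2 * D0) = smult (16 * (a 0)\<^sup>2) npoly"
  by (rule poly_infinite_eqI[OF infinite_alg_closed])
     (simp add: D0_def D1_def D2_def npoly_def epoly_def opoly_def poly_monom algebra_simps eval_nat_numeral)

lemma sing_finite_odd:
  assumes two: "(2 :: 'a) \<noteq> 0"
  shows "finite {m. \<exists>n. poly D2 n * m\<^sup>2 + poly D1 n * m + poly D0 n = 0 \<and>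
     poly (pderiv D2) n * m\<^sup>2 + poly (pderiv D1) n * m + poly (pderiv D0) n = 0}" (is "finite ?M")
proof -
  have "(4::'a) = 2 * 2" "(16::'a) = 2 * 2 * 2 * 2" by simp_all
  then have four: "(4::'a) \<noteq> 0" "(16::'a) \<noteq> 0" using two by (metis mult_eq_0_iff)+
  \<comment> \<open>Eliminating m^2 from the two equations expresses U m in the coefficients, so
    that U (2 D2 m + D1) = V. The square of 2 D2 m + D1 is the discriminant
    \<open>D1\<^sup>2 - 4 * (D2 * D0)\<close>, hence Q vanishes at n. Q = 0 would make the
    discriminant the square of a rational function, against its simple zero.\<close>
  define U where "U = D2 * pderiv D1 - D1 * pderiv D2"
  define V where "V = U * D1 - 2 * D2 * (D2 * pderiv D0 - D0 * pderiv D2)"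
  define Q where "Q = V\<^sup>2 - U\<^sup>2 * (D1\<^sup>2 - 4 * (D2 * D0))"
  have U: "U = smult (16 * a 0 ^ 3) ([:0, 1:]\<^sup>2 * ([:0, 1:] * pderiv epoly - 3 * epoly - monom (a 0) 4))"
    by (rule poly_infinite_eqI[OF infinite_alg_closed])
       (simp add: U_def D1_def D2_def pderiv_monom pderiv_smult pderiv_diff poly_monom algebra_simps eval_nat_numeral)
  have "coeff ([:0, 1:] * pderiv epoly - 3 * epoly - monom (a 0) 4) 4 = - a 0"
    by (simp add: epoly_def pderiv_pCons eval_nat_numeral numeral_poly)
  then have "[:0, 1:] * pderiv epoly - 3 * epoly - monom (a 0) 4 \<noteq> 0" using a_0_nonzero by (metis coeff_0 neg_equal_0_iff_equal)
  then have U0: "U \<noteq> 0" unfolding U using four a_0_nonzero by simp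
  have Q0: "Q \<noteq> 0"
  proof
    assume "Q = 0"
    then have e: "V\<^sup>2 = U\<^sup>2 * smult (16 * (a 0)\<^sup>2) npoly" by (simp add: Q_def disc_disc)
    obtain x where x: "order x npoly = 1" "npoly \<noteq> 0" by (rule npoly_simple_root)
    then have "order x (smult (16 * (a 0)\<^sup>2) npoly) = 1"
      using four a_0_nonzero by (simp add: order_smult)
    moreover have "smult (16 * (a 0)\<^sup>2) npoly \<noteq> 0" using four a_0_nonzero x(2) by simp
    ultimately show False by (rule square_times_simple_root[OF e U0])
  qed
  have "?M \<subseteq> {m. \<exists>n\<in>{n. poly Q n = 0}. poly [:poly D0 n, poly D1 n, poly D2 n:] m = 0}"
  proof (intro subsetI CollectI; elim CollectE exE conjE)
    fix m n
    define d0 d1 d2 e0 e1 e2 where d: "d0 = poly D0 n" "d1 = poly D1 n" "d2 = poly D2 n"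
      "e0 = poly (pderiv D0) n" "e1 = poly (pderiv D1) n" "e2 = poly (pderiv D2) n"
    assume "poly D2 n * m\<^sup>2 + poly D1 n * m + poly D0 n = 0"
      "poly (pderiv D2) n * m\<^sup>2 + poly (pderiv D1) n * m + poly (pderiv D0) n = 0"
    then have 1: "d2 * m\<^sup>2 + d1 * m + d0 = 0" and 2: "e2 * m\<^sup>2 + e1 * m + e0 = 0" by (simp_all add: d)
    have u: "poly U n = d2 * e1 - d1 * e2" by (simp add: U_def d)
    have v: "poly V n = poly U n * d1 - 2 * d2 * (d2 * e0 - d0 * e2)" by (simp add: V_def d)
    have "poly U n * (2 * d2 * m + d1) - poly V n = 2 * d2 * (d2 * (e2 * m\<^sup>2 + e1 * m + e0) - e2 * (d2 * m\<^sup>2 + d1 * m + d0))"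
      unfolding v u by (simp add: algebra_simps power2_eq_square)
    then have 3: "poly V n = poly U n * (2 * d2 * m + d1)" unfolding 1 2 by simp
    have "(2 * d2 * m + d1)\<^sup>2 = d1\<^sup>2 - 4 * (d2 * d0) + 4 * d2 * (d2 * m\<^sup>2 + d1 * m + d0)"
      by (simp add: algebra_simps power2_eq_square)
    then have 4: "(2 * d2 * m + d1)\<^sup>2 = d1\<^sup>2 - 4 * (d2 * d0)" unfolding 1 by simp
    have "poly Q n = (poly V n)\<^sup>2 - (poly U n)\<^sup>2 * (d1\<^sup>2 - 4 * (d2 * d0))"
      by (simp add: Q_def d)
    also have "\<dots> = 0" unfolding 3 power_mult_distrib 4 by simp
    finally have "poly Q n = 0" .
    moreover have "poly [:poly D0 n, poly D1 n, poly D2 n:] m = 0"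
      using 1 by (simp add: d algebra_simps power2_eq_square)
    ultimately show "\<exists>n\<in>{n. poly Q n = 0}. poly [:poly D0 n, poly D1 n, poly D2 n:] m = 0" by blast
  qed
  moreover have "finite {m. \<exists>n\<in>{n. poly Q n = 0}. poly [:poly D0 n, poly D1 n, poly D2 n:] m = 0}"
  proof (rule finite_poly_roots_of_family)
    fix n
    \<comment> \<open>\<open>D2\<close> vanishes only at n = 0, where \<open>D1\<close> has the
      value \<open>4 * a 0\<close>.\<close>
    show "[:poly D0 n, poly D1 n, poly D2 n:] \<noteq> 0"
      using four a_0_nonzero by (cases "n = 0") (auto simp: D1_def D2_def epoly_def poly_monom)
  qed (use Q0 poly_roots_finite in auto)
  ultimately show ?thesis by (rule finite_subset)
qed

text \<open>In characteristic \<open>2\<close> the quadratic polynomial has derivative \<open>opoly n\<close>, so that only finitely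
  many \<open>n\<close> are possible at a singular point.\<close>

lemma sing_finite_even:
  assumes two: "(2 :: 'a) = 0"
  shows "finite {m. \<exists>n. poly opoly n = 0 \<and>
     a 0 * ((poly (pderiv epoly) n + 3 * a 0 * m * n\<^sup>2) * (m - n) + (poly epoly n + a 0 * m * n ^ 3))\<^sup>2
     = (poly epoly n + a 0 * m * n ^ 3) * (poly (pderiv opoly) n)\<^sup>2 * (m - n)}" (is "finite ?M")
proof -
  have "(3::'a) = 1 + 2" by simp
  then have three: "(3::'a) \<noteq> 0" using two by simp
  define P where "P n = smult (a 0) (([:poly (pderiv epoly) n, 3 * a 0 * n\<^sup>2:] * [:- n, 1:] + [:poly epoly n, a 0 * n ^ 3:])\<^sup>2)
     - smult ((poly (pderiv opoly) n)\<^sup>2) ([:poly epoly n, a 0 * n ^ 3:] * [:- n, 1:])" for n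
  have "?M \<subseteq> {m. \<exists>n\<in>{n. poly opoly n = 0}. poly (P n) m = 0}"
    by (auto simp: P_def algebra_simps)
  moreover have "finite {m. \<exists>n\<in>{n. poly opoly n = 0}. poly (P n) m = 0}"
  proof (rule finite_poly_roots_of_family)
    show "finite {n. poly opoly n = 0}"
      using odd_part_nonzero by (intro poly_roots_finite) (auto simp: opoly_def)
    fix n
    show "P n \<noteq> 0"
    proof (cases "n = 0")
      case True
      then have "poly (P n) 0 = a 0" by (simp add: P_def epoly_def)
      then show ?thesis using a_0_nonzero by auto
    next
      case False
      have "coeff (P n) 4 = a 0 * (3 * a 0 * n\<^sup>2)\<^sup>2"
        by (simp add: P_def power2_eq_square eval_nat_numeral coeff_pCons)
      then show ?thesis using a_0_nonzero three False by auto
    qed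
  qed
  ultimately show ?thesis by (rule finite_subset)
qed

lemma finite_singular:
  "finite {m. \<exists>v. v \<noteq> 0 \<and> pen a 1 m v = 0 \<and> (\<forall>i. dpen a 1 m v (axis i 1) = 0)}" (is "finite ?S")
proof -
  define M1 where "M1 = {m. \<exists>n. poly D2 n * m\<^sup>2 + poly D1 n * m + poly D0 n = 0 \<and>
     poly (pderiv D2) n * m\<^sup>2 + poly (pderiv D1) n * m + poly (pderiv D0) n = 0}"
  define M2 where "M2 = {m. \<exists>n. poly opoly n = 0 \<and>
     a 0 * ((poly (pderiv epoly) n + 3 * a 0 * m * n\<^sup>2) * (m - n) + (poly epoly n + a 0 * m * n ^ 3))\<^sup>2
     = (poly epoly n + a 0 * m * n ^ 3) * (poly (pderiv opoly) n)\<^sup>2 * (m - n)}"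
  define M where "M = (if (2::'a) = 0 then M2 else M1)"
  \<comment> \<open>Singular points (W : 1 : 0): the equation of the member determines m from W, and
    the derivative with respect to z then becomes a quartic equation for W.\<close>
  define M3 where "M3 = (\<lambda>x. - (a 2 + a 1 * x + a 0 * x\<^sup>2) / a 0) ` {x. poly [:a 4, a 3, a 2, a 1, a 0:] x = 0}"
  have "finite M" using sing_finite_odd sing_finite_even by (simp add: M_def M1_def M2_def)
  moreover have "finite M3"
    unfolding M3_def using a_0_nonzero by (intro finite_imageI poly_roots_finite) simp
  moreover have "?S \<subseteq> M \<union> M3"
  proof (intro subsetI, elim CollectE exE conjE)
    fix m v
    assume v0: "v \<noteq> 0" and F: "pen a 1 m v = 0" and d: "\<forall>i. dpen a 1 m v (axis i 1) = 0"
    obtain x y z where v: "v $ 1 = x" "v $ 2 = y" "v $ 3 = z" by simp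
    have d1: "a 5 * z\<^sup>2 + a 3 * y * z + a 1 * y\<^sup>2 + 2 * a 0 * x * y - a 0 * m * (2 * x * z) = 0"
      using d[rule_format, of 1] by (simp add: dpen_def dgcub_def dcusp_def v axis_def)
    have d2: "a 6 * z\<^sup>2 + 2 * a 4 * y * z + a 3 * x * z + 3 * a 2 * y\<^sup>2 + 2 * a 1 * x * y + a 0 * x\<^sup>2
        + a 0 * m * (3 * y\<^sup>2) = 0"
      using d[rule_format, of 2] by (simp add: dpen_def dgcub_def dcusp_def v axis_def)
    have d3: "3 * z\<^sup>2 + 2 * a 6 * y * z + 2 * a 5 * x * z + a 4 * y\<^sup>2 + a 3 * x * y - a 0 * m * x\<^sup>2 = 0"
      using d[rule_format, of 3] by (simp add: dpen_def dgcub_def dcusp_def v axis_def)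
    have F': "z ^ 3 + a 6 * y * z\<^sup>2 + a 5 * x * z\<^sup>2 + a 4 * y\<^sup>2 * z + a 3 * x * y * z + a 2 * y ^ 3
       + a 1 * x * y\<^sup>2 + a 0 * x\<^sup>2 * y - a 0 * m * (x\<^sup>2 * z - y ^ 3) = 0"
      using F by (simp add: pen_def gcub_def cusp_cubic_def v)
    show "m \<in> M \<union> M3"
    proof (cases "z = 0")
      case z: True
      have y: "y \<noteq> 0"
      proof
        assume y: "y = 0"
        then have "a 0 * x\<^sup>2 = 0" using d2 z by simp
        then have "x = 0" using a_0_nonzero by simp
        then show False using v0 y z v by (metis vec3_eqI zero_index)
      qed
      obtain W where x: "x = W * y" using y by (metis nonzero_eq_divide_eq)
      have "y ^ 3 * (a 2 + a 1 * W + a 0 * W\<^sup>2 + a 0 * m) = 0"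
        using F' unfolding z x by (simp add: algebra_simps power2_eq_square power3_eq_cube)
      then have "a 2 + a 1 * W + a 0 * W\<^sup>2 + a 0 * m = 0" using y by simp
      then have 1: "a 0 * m = - (a 2 + a 1 * W + a 0 * W\<^sup>2)" by (metis eq_neg_iff_add_eq_0 add.commute)
      have "y\<^sup>2 * (a 4 + a 3 * W - a 0 * m * W\<^sup>2) = 0"
        using d3 unfolding z x by (simp add: algebra_simps power2_eq_square)
      then have "a 4 + a 3 * W - a 0 * m * W\<^sup>2 = 0" using y by simp
      then have "poly [:a 4, a 3, a 2, a 1, a 0:] W = 0"
        unfolding 1 by (simp add: algebra_simps power2_eq_square)
      moreover have "m = - (a 2 + a 1 * W + a 0 * W\<^sup>2) / a 0"
        using 1 a_0_nonzero by (metis nonzero_mult_div_cancel_left)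
      ultimately show ?thesis unfolding M3_def by blast
    next
      case z: False
      obtain W where x: "x = W * z" using z by (metis nonzero_eq_divide_eq)
      obtain n where y: "y = n * z" using z by (metis nonzero_eq_divide_eq)
      \<comment> \<open>At the affine point (W, n, 1) the member has the value A + W B + a 0 (n - m)
        W^2. The equations \<open>K\<close>, \<open>KX\<close> and \<open>Kn\<close> below express
        that this value and its derivatives in W and n vanish.\<close>
      define A where "A = poly epoly n + a 0 * m * n ^ 3"
      define A' where "A' = poly (pderiv epoly) n + 3 * a 0 * m * n\<^sup>2"
      define B where "B = poly opoly n"
      define B' where "B' = poly (pderiv opoly) n"
      have "z\<^sup>2 * (B + 2 * a 0 * (n - m) * W) = 0"
        using d1 unfolding x y B_def opoly_def by (simp add: algebra_simps power2_eq_square)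
      then have "B + 2 * a 0 * (n - m) * W = 0" using z by simp
      then have KX: "B = 2 * a 0 * (m - n) * W" by (simp add: algebra_simps eq_neg_iff_add_eq_0)
      have "z\<^sup>2 * (A' + W * B' + a 0 * W\<^sup>2) = 0"
        using d2 unfolding x y A'_def B'_def opoly_def epoly_def
        by (simp add: algebra_simps power2_eq_square pderiv_pCons)
      then have "A' + W * B' + a 0 * W\<^sup>2 = 0" using z by simp
      then have Kn: "A' = - (W * B') - a 0 * W\<^sup>2" by (simp add: algebra_simps eq_neg_iff_add_eq_0)
      have "z ^ 3 * (A + W * B + a 0 * (n - m) * W\<^sup>2) = 0"
        using F' unfolding x y A_def B_def opoly_def epoly_def
        by (simp add: algebra_simps power2_eq_square power3_eq_cube)
      then have "A + W * B + a 0 * (n - m) * W\<^sup>2 = 0" using z by simp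
      then have "A = - (W * B) + a 0 * (m - n) * W\<^sup>2" by (simp add: algebra_simps eq_neg_iff_add_eq_0)
      then have K: "A = a 0 * (n - m) * W\<^sup>2" unfolding KX by (simp add: algebra_simps power2_eq_square)
      show ?thesis
      proof (cases "(2::'a) = 0")
        case True
        have B: "B = 0" unfolding KX True by simp
        have "A = a 0 * (n - m) * W\<^sup>2 + 2 * (a 0 * (m - n) * W\<^sup>2)" unfolding K True by simp
        then have K': "A = a 0 * (m - n) * W\<^sup>2" by (simp add: algebra_simps)
        \<comment> \<open>The terms with W^2 cancel; squaring and using \<open>K'\<close> once more
          removes W altogether.\<close>
        have T: "A' * (m - n) + A = - (W * B' * (m - n))"
          unfolding Kn K' by (simp add: algebra_simps power2_eq_square)
        have "a 0 * (A' * (m - n) + A)\<^sup>2 = A * B'\<^sup>2 * (m - n)"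
          unfolding T unfolding K' by (simp add: algebra_simps power2_eq_square)
        then show ?thesis using B True unfolding M_def M2_def A_def A'_def B_def B'_def by auto
      next
        case False
        have e1: "poly D2 n * m\<^sup>2 + poly D1 n * m + poly D0 n = B\<^sup>2 - 4 * a 0 * (n - m) * A"
          unfolding D0_def D1_def D2_def B_def A_def
          by (simp add: poly_monom algebra_simps power2_eq_square power3_eq_cube eval_nat_numeral)
        also have "\<dots> = 0" unfolding K KX by (simp add: algebra_simps power2_eq_square)
        finally have 1: "poly D2 n * m\<^sup>2 + poly D1 n * m + poly D0 n = 0" .
        have "poly (pderiv D2) n * m\<^sup>2 + poly (pderiv D1) n * m + poly (pderiv D0) n
           = 2 * B * B' - 4 * a 0 * A - 4 * a 0 * (n - m) * A'"
          unfolding D0_def D1_def D2_def B_def A_def B'_def A'_def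
          by (simp add: poly_monom pderiv_monom pderiv_diff pderiv_smult pderiv_mult pderiv_pCons power2_eq_square
             algebra_simps power3_eq_cube eval_nat_numeral)
        also have "\<dots> = 0" unfolding K KX Kn by (simp add: algebra_simps power2_eq_square)
        finally show ?thesis using 1 False unfolding M_def M1_def by auto
      qed
    qed
  qed
  ultimately show ?thesis by (meson finite_UnI finite_subset)
qed

end

section \<open>Ring homomorphisms and homogeneity\<close>

definition vmap :: "('a \<Rightarrow> 'b) \<Rightarrow> 'a ^ 3 \<Rightarrow> 'b ^ 3" where
  "vmap h v = (\<chi> i. h (v $ i))"

lemma vmap_nth [simp]: "vmap h v $ i = h (v $ i)"
  by (simp add: vmap_def)

context ring_hom3
begin

lemma h_diff: "h (x - y) = h x - h y"
  using h_add[of x "- y"] by (simp add: h_uminus)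

lemma h_power: "h (x ^ n) = h x ^ n"
  by (induction n) (simp_all add: hom)

lemma h_of_nat: "h (of_nat n) = of_nat n"
  by (induction n) (simp_all add: hom)

lemma h_numeral: "h (numeral n) = numeral n"
  using h_of_nat[of "numeral n"] by simp

lemmas homs = hom h_uminus h_diff h_power h_numeral

lemma h_cusp: "h (cusp_cubic v) = cusp_cubic (vmap h v)"
  by (simp add: cusp_cubic_def homs)

lemma h_gcub: "h (gcub a v) = gcub (\<lambda>i. h (a i)) (vmap h v)"
  by (simp add: gcub_def homs)

lemma h_pen: "h (pen a p r v) = pen (\<lambda>i. h (a i)) (h p) (h r) (vmap h v)"
  by (simp add: pen_def h_gcub h_cusp homs)

lemma h_dpen: "h (dpen a p r u v) = dpen (\<lambda>i. h (a i)) (h p) (h r) (vmap h u) (vmap h v)"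
  by (simp add: dpen_def dgcub_def dcusp_def homs)

lemma h_tang: "vmap h (tang a p r) = tang (\<lambda>i. h (a i)) (h p) (h r)"
  by (rule vec3_eqI) (simp_all add: tA_def tB_def homs)

lemma h_bert: "vmap h (bert a v) = bert (\<lambda>i. h (a i)) (vmap h v)"
proof -
  have "h (tang a p r $ i) = tang (\<lambda>i. h (a i)) (h p) (h r) $ i" for p r i
    using h_tang[of a p r] by (metis vmap_nth)
  then show ?thesis
    by (simp add: vec_eq_iff bert_def third_pt_def homs h_dpen h_tang h_cusp h_gcub)
qed

lemma evh_ring_hom: "ring_hom3 (\<lambda>F. evh h F v)"
  by unfold_locales simp_all

end

definition evt :: "('a::zero \<Rightarrow> 'b::comm_semiring_1) \<Rightarrow> 'a poly3 ^ 3 \<Rightarrow> 'b ^ 3 \<Rightarrow> 'b ^ 3" where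
  "evt h f v = (\<chi> i. evh h (f $ i) v)"

lemma evt_nth [simp]: "evt h f v $ i = evh h (f $ i) v"
  by (simp add: evt_def)

abbreviation poly_const :: "(nat \<Rightarrow> 'a::comm_ring_1) \<Rightarrow> nat \<Rightarrow> 'a poly3" where
  "poly_const a \<equiv> \<lambda>i. const3 (a i)"

text \<open>The formulas for \<open>bert\<close> make sense over every commutative ring; at the
  generic point over the polynomial ring they yield the forms, and the lemmas on ring homomorphisms
  identify their values.\<close>

definition bert_triple :: "(nat \<Rightarrow> 'a::comm_ring_1) \<Rightarrow> 'a poly3 ^ 3" where
  "bert_triple a = bert (poly_const a) X3"

context ring_hom3
begin

lemma evt_X3 [simp]: "vmap (\<lambda>F. evh h F v) X3 = v"
  by (simp add: vec_eq_iff)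

lemma evh_cusp: "evh h (cusp_cubic u) v = cusp_cubic (evt h u v)"
  using ring_hom3.h_cusp[OF evh_ring_hom, of u v] by (simp add: evt_def vmap_def)

lemma evh_gcub: "evh h (gcub (poly_const a) u) v = gcub (\<lambda>i. h (a i)) (evt h u v)"
  using ring_hom3.h_gcub[OF evh_ring_hom, of "poly_const a" u v] by (simp add: evt_def vmap_def)

lemma evh_pen: "evh h (pen (poly_const a) p r u) v = pen (\<lambda>i. h (a i)) (evh h p v) (evh h r v) (evt h u v)"
  using ring_hom3.h_pen[OF evh_ring_hom, of "poly_const a" p r u v] by (simp add: evt_def vmap_def)

lemma evt_bert: "evt h (bert_triple a) v = bert (\<lambda>i. h (a i)) v"
  using ring_hom3.h_bert[OF evh_ring_hom, of v "poly_const a" X3]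
  by (simp add: bert_triple_def) (simp add: evt_def vmap_def)

lemma evt_X3' [simp]: "evt h X3 v = v"
  by (simp add: vec_eq_iff)

end

lemma homog_mult_eq:
  fixes F G :: "'a::comm_semiring_1 poly3"
  shows "homog d F \<Longrightarrow> homog e G \<Longrightarrow> d + e = n \<Longrightarrow> homog n (F * G)"
  using homog_mult by blast

lemma homog_power_eq:
  fixes F :: "'a::comm_semiring_1 poly3"
  shows "homog d F \<Longrightarrow> k * d = n \<Longrightarrow> homog n (F ^ k)"
  using homog_power by blast

lemmas homog_rules = homog_mult_eq homog_power_eq homog_const homog_numeral homog_add homog_diff homog_uminus

lemma homog_cusp: "(\<And>i. homog d (u $ i)) \<Longrightarrow> homog (3 * d) (cusp_cubic u)"
  unfolding cusp_cubic_def by ((rule homog_rules | assumption | simp)+)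

lemma homog_gcub: "(\<And>i. homog d (u $ i)) \<Longrightarrow> homog (3 * d) (gcub (poly_const a) u)"
  unfolding gcub_def by ((rule homog_rules | assumption | simp)+)

lemma homog_dcusp: "(\<And>i. homog d (u $ i)) \<Longrightarrow> (\<And>i. homog e (v $ i)) \<Longrightarrow> homog (2 * d + e) (dcusp u v)"
  unfolding dcusp_def by ((rule homog_rules | assumption | simp)+)

lemma homog_dgcub:
  "(\<And>i. homog d (u $ i)) \<Longrightarrow> (\<And>i. homog e (v $ i)) \<Longrightarrow> homog (2 * d + e) (dgcub (poly_const a) u v)"
  unfolding dgcub_def by ((rule homog_rules | assumption | simp)+)

lemma homog_dpen:
  assumes "homog m p" "homog m r" "\<And>i. homog d (u $ i)" "\<And>i. homog e (v $ i)"
  shows "homog (m + (2 * d + e)) (dpen (poly_const a) p r u v)"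
  unfolding dpen_def
  using homog_mult[OF assms(1) homog_dgcub[OF assms(3,4)]]
    homog_mult[OF homog_mult[OF homog_const assms(2)] homog_dcusp[OF assms(3,4)]]
  by (intro homog_diff) simp_all

lemma homog_tang:
  assumes "homog m p" "homog m r"
  shows "homog (4 * m) (tang (poly_const a) p r $ i)"
proof -
  have "homog (4 * m) (tA (poly_const a) p r)"
    unfolding tA_def by ((rule homog_rules assms | simp)+)
  moreover have B: "homog (2 * m) (tB (poly_const a) p r)"
    unfolding tB_def by ((rule homog_rules assms | simp)+)
  moreover have "homog (4 * m) (- (p * r * tB (poly_const a) p r))" "homog (4 * m) (- (p\<^sup>2 * tB (poly_const a) p r))"
    by ((rule homog_rules assms B | simp)+)
  ultimately show ?thesis using exhaust_3[of i] by (elim disjE) (simp_all only: tang_nth)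
qed

lemma homog_X3: "homog 1 (X3 $ i)"
  by (simp del: One_nat_def)

text \<open>The parameters of the member through the generic point are cubic forms and
  \<open>tang\<close> has degree 12, so both terms of \<open>third_pt\<close> have degree 29 = 28 +
  1 = 17 + 12.\<close>

lemma homog_bert: "homog 29 (bert_triple a $ i)"
proof -
  define p where "p = const3 (a 0) * cusp_cubic (X3 :: 'a poly3 ^ 3)"
  define r where "r = gcub (poly_const a) X3"
  have p: "homog 3 p" unfolding p_def using homog_mult[OF homog_const homog_cusp[OF homog_X3]] by simp
  have r: "homog 3 r" unfolding r_def using homog_gcub[OF homog_X3] by simp
  have t: "homog 12 (tang (poly_const a) p r $ i)" for i using homog_tang[OF p r] by simp
  have Q: "homog 28 (dpen (poly_const a) p r (tang (poly_const a) p r) X3)"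
    using homog_dpen[OF p r t homog_X3] by simp
  have P: "homog 17 (dpen (poly_const a) p r X3 (tang (poly_const a) p r))"
    using homog_dpen[OF p r homog_X3 t] by simp
  have e: "bert_triple a $ i = dpen (poly_const a) p r (tang (poly_const a) p r) X3 * X3 $ i -
     dpen (poly_const a) p r X3 (tang (poly_const a) p r) * tang (poly_const a) p r $ i"
    by (simp add: bert_triple_def bert_def third_pt_def p_def r_def)
  show ?thesis
    unfolding e using homog_mult[OF Q homog_X3[of i]] homog_mult[OF P t[of i]] by (intro homog_diff) simp_all
qed

section \<open>Rational maps over an infinite field\<close>

abbreviation sub_triple :: "'a::comm_semiring_1 poly3 ^ 3 \<Rightarrow> 'a poly3 ^ 3 \<Rightarrow> 'a poly3 ^ 3" where
  "sub_triple f g \<equiv> (\<chi> i. subst3 (f $ i) g)"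

abbreviation evp :: "'a::comm_ring_1 poly3 ^ 3 \<Rightarrow> 'a ^ 3 \<Rightarrow> 'a ^ 3" where
  "evp \<equiv> evt (\<lambda>x. x)"

lemma (in ring_hom3) evt_sub: "evt h (sub_triple f g) v = evt h f (evt h g v)"
  by (simp add: vec_eq_iff evt_def)

lemma (in ring_hom3) evt_homog:
  assumes "\<And>i. homog d (f $ i)"
  shows "evt h f (c *s v) = c ^ d *s evt h f v"
  using assms by (simp add: vec_eq_iff evh_homog)

text \<open>Density of the complement of a curve: \<open>E * P\<close> vanishes at every point,
  hence is 0, and the polynomial ring is a domain.\<close>

lemma evh_zeroI:
  fixes E :: "'a::field poly3"
  assumes inf: "infinite (UNIV :: 'a set)" and "P \<noteq> 0"
    and "\<And>v. evh (\<lambda>x. x) P v \<noteq> 0 \<Longrightarrow> evh (\<lambda>x. x) E v = 0"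
  shows "E = 0"
proof -
  have "E * P = 0"
    by (rule poly3_eqI[OF inf]) (use assms(3) in \<open>auto simp: eval3_evh\<close>)
  then show ?thesis using assms(2) by simp
qed

lemma rat_eqI:
  fixes f g :: "'a::field poly3 ^ 3"
  assumes inf: "infinite (UNIV :: 'a set)" and "rat_triple f" "rat_triple g" "P \<noteq> 0"
    and "\<And>v. evh (\<lambda>x. x) P v \<noteq> 0 \<Longrightarrow> par (evp f v) (evp g v)"
  shows "rat_eq f g"
proof -
  have "f $ i * g $ j - f $ j * g $ i = 0" for i j
    by (rule evh_zeroI[OF inf assms(4)]) (use assms(5) in \<open>auto simp: par_def\<close>)
  then show ?thesis using assms(2,3) by (simp add: rat_eq_def)
qed

lemma rat_eq_par: "rat_eq f g \<Longrightarrow> par (evp f v) (evp g v)"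
  unfolding rat_eq_def par_def by (metis evt_nth id_hom.evh_mult)

lemma rat_eq_par_ac: "rat_eq f g \<Longrightarrow> par (evt to_ac f v) (evt to_ac g v)"
  unfolding rat_eq_def par_def by (metis evt_nth ac.evh_mult)

lemma rat_eq_sym: "rat_eq f g \<Longrightarrow> rat_eq g f"
  by (simp add: rat_eq_def mult.commute)

lemma rat_eq_refl: "rat_triple f \<Longrightarrow> rat_eq f f"
  by (simp add: rat_eq_def mult.commute)

lemma rat_triple_component: "rat_triple f \<Longrightarrow> \<exists>i. f $ i \<noteq> 0"
  by (auto simp: rat_triple_def vec_eq_iff)

lemma rat_eq_trans:
  fixes f g k :: "'a::field poly3 ^ 3"
  assumes inf: "infinite (UNIV :: 'a set)" and "rat_eq f g" "rat_eq g k"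
  shows "rat_eq f k"
proof -
  obtain i where i: "g $ i \<noteq> 0" using assms(2) rat_triple_component[of g] unfolding rat_eq_def by blast
  show ?thesis
  proof (rule rat_eqI[OF inf _ _ i])
    fix v assume "evh (\<lambda>x. x) (g $ i) v \<noteq> 0"
    then have "evp g v \<noteq> 0" by (metis evt_nth zero_index)
    then show "par (evp f v) (evp k v)" using assms(2,3) rat_eq_par par_trans by blast
  qed (use assms in \<open>auto simp: rat_eq_def\<close>)
qed

lemma rat_class_eq:
  fixes f g :: "'a::field poly3 ^ 3"
  assumes inf: "infinite (UNIV :: 'a set)" and "rat_eq f g"
  shows "rat_class f = rat_class g"
  unfolding rat_class_def using rat_eq_trans[OF inf] rat_eq_sym assms(2) by blast

lemma rat_triple_sub:
  assumes "rat_triple f" "rat_triple g" "sub_triple f g \<noteq> 0"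
  shows "rat_triple (sub_triple f g)"
  using assms unfolding rat_triple_def by (auto intro!: homog_subst3)

lemma rat_eq_sub:
  fixes f g a b :: "'a::field poly3 ^ 3"
  assumes inf: "infinite (UNIV :: 'a set)" and fa: "rat_eq f a" and gb: "rat_eq g b"
    and "sub_triple f g \<noteq> 0" "sub_triple a b \<noteq> 0"
  shows "rat_eq (sub_triple f g) (sub_triple a b)"
proof -
  have t: "rat_triple f" "rat_triple g" "rat_triple a" "rat_triple b" using fa gb by (auto simp: rat_eq_def)
  obtain i where i: "b $ i \<noteq> 0" using t(4) rat_triple_component by auto
  obtain d where d: "\<And>i. homog d (f $ i)" using t(1) by (auto simp: rat_triple_def)
  show ?thesis
  proof (rule rat_eqI[OF inf _ _ i])
    fix v assume "evh (\<lambda>x. x) (b $ i) v \<noteq> 0"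
    then have b0: "evp b v \<noteq> 0" by (metis evt_nth zero_index)
    obtain c where c: "evp g v = c *s evp b v" using par_scaleE[OF rat_eq_par[OF gb] b0] .
    have "evp (sub_triple f g) v = c ^ d *s evp f (evp b v)"
      unfolding id_hom.evt_sub c by (rule id_hom.evt_homog[OF d])
    moreover have "par (evp f (evp b v)) (evp a (evp b v))" by (rule rat_eq_par[OF fa])
    ultimately show "par (evp (sub_triple f g) v) (evp (sub_triple a b) v)"
      unfolding id_hom.evt_sub[of a] by (simp add: par_def)
  qed (use t assms rat_triple_sub in auto)
qed

text \<open>Pairs of representatives whose composite vanishes identically contribute nothing,
  because \<open>rat_eq\<close> demands a nonzero triple; all other pairs give proportional
  composites.\<close>

lemma rat_comp_class:
  fixes a b :: "'a::field poly3 ^ 3"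
  assumes inf: "infinite (UNIV :: 'a set)" and a: "rat_triple a" and b: "rat_triple b"
    and nz: "sub_triple a b \<noteq> 0"
  shows "rat_class a \<circ>\<^sub>R rat_class b = rat_class (sub_triple a b)"
proof (intro equalityI subsetI)
  fix k assume "k \<in> rat_class a \<circ>\<^sub>R rat_class b"
  then obtain f g where fg: "rat_eq a f" "rat_eq b g" "rat_eq (sub_triple f g) k"
    by (auto simp: rat_comp_def rat_class_def)
  then have "sub_triple f g \<noteq> 0" by (auto simp: rat_eq_def rat_triple_def)
  then have "rat_eq (sub_triple f g) (sub_triple a b)"
    using rat_eq_sub[OF inf] rat_eq_sym fg nz by blast
  then show "k \<in> rat_class (sub_triple a b)"
    using rat_eq_trans[OF inf rat_eq_sym fg(3)] by (simp add: rat_class_def)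
next
  fix k assume "k \<in> rat_class (sub_triple a b)"
  then show "k \<in> rat_class a \<circ>\<^sub>R rat_class b"
    using rat_eq_refl[OF a] rat_eq_refl[OF b] by (auto simp: rat_class_def rat_comp_def)
qed

lemma evp_nonzero: "evp f v \<noteq> 0 \<Longrightarrow> f \<noteq> 0"
proof
  assume "evp f v \<noteq> 0" "f = 0"
  moreover have "evp 0 v = 0" by (simp add: vec_eq_iff)
  ultimately show False by simp
qed

lemma rat_triple_X3: "rat_triple (X3 :: 'a::field poly3 ^ 3)"
  unfolding rat_triple_def using evp_nonzero[of X3 "cpt 0"] homog_X3 by auto

definition lin_triple :: "'a::field ^ 3 ^ 3 \<Rightarrow> 'a poly3 ^ 3" where
  "lin_triple A = (\<chi> i. \<Sum>j\<in>UNIV. const3 (A $ i $ j) * var3 j)"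

lemma (in ring_hom3) evt_lin: "evt h (\<chi> i. \<Sum>j\<in>UNIV. const3 (A $ i $ j) * var3 j) v = (\<chi> i j. h (A $ i $ j)) *v v"
  by (simp add: vec_eq_iff matrix_vector_mult_def)

lemma evp_lin: "evp (lin_triple A) v = A *v v"
  unfolding lin_triple_def id_hom.evt_lin by simp

lemma homog_lin: "homog 1 (lin_triple A $ i)"
proof -
  have "homog (0 + 1) (const3 (A $ i $ j) * var3 j)" for j
    by (intro homog_mult homog_const homog_var)
  then show ?thesis by (auto simp: lin_triple_def intro!: homog_sum)
qed

lemma rat_triple_lin:
  assumes "invertible A"
  shows "rat_triple (lin_triple A)"
proof -
  obtain B where "A ** B = mat 1" using assms by (auto simp: invertible_def)
  then have "A *v (B *v cpt 0) = cpt 0" by (simp add: matrix_vector_mul_assoc)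
  then have "evp (lin_triple A) (B *v cpt 0) \<noteq> 0" by (simp add: evp_lin)
  then show ?thesis using homog_lin evp_nonzero by (auto simp: rat_triple_def)
qed

lemma PGL_map_lin: "PGL_map A = rat_class (lin_triple A)"
  by (simp add: PGL_map_def lin_triple_def)

lemma rat_id_X3: "rat_id = rat_class X3"
  by (simp add: rat_id_def X3_def)

lemma matrix_inv_right: "invertible A \<Longrightarrow> A ** matrix_inv A = mat 1"
  and matrix_inv_left: "invertible A \<Longrightarrow> matrix_inv A ** A = mat 1"
  unfolding invertible_def matrix_inv_def by (metis (mono_tags, lifting) someI_ex)+

lemma invertible_matrix_inv: "invertible A \<Longrightarrow> invertible (matrix_inv A)"
  unfolding invertible_def using matrix_inv_left matrix_inv_right invertible_def by metis

lemma PGL_conj_class: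
  fixes f :: "'a::field poly3 ^ 3"
  assumes inf: "infinite (UNIV :: 'a set)" and A: "invertible A" and f: "rat_triple f"
  shows "PGL_map A \<circ>\<^sub>R rat_class f \<circ>\<^sub>R PGL_map (matrix_inv A) =
     rat_class (sub_triple (sub_triple (lin_triple A) f) (lin_triple (matrix_inv A)))"
    and "sub_triple (sub_triple (lin_triple A) f) (lin_triple (matrix_inv A)) \<noteq> 0"
proof -
  obtain i where "f $ i \<noteq> 0" using f rat_triple_component by auto
  then obtain v where "eval3 (f $ i) v \<noteq> 0" using poly3_nonzero_point[OF inf] by metis
  then have v: "evp f v \<noteq> 0" by (metis evt_nth zero_index eval3_evh)
  have inj: "A *v x = 0 \<Longrightarrow> x = 0" for x
    using matrix_inv_left[OF A] by (metis matrix_vector_mul_assoc matrix_vector_mul_lid matrix_vector_mult_0_right)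
  have "evp (sub_triple (lin_triple A) f) v \<noteq> 0"
    unfolding id_hom.evt_sub evp_lin using v inj by auto
  then have 1: "sub_triple (lin_triple A) f \<noteq> 0" by (rule evp_nonzero)
  have "evp (sub_triple (sub_triple (lin_triple A) f) (lin_triple (matrix_inv A))) (A *v v) \<noteq> 0"
    unfolding id_hom.evt_sub evp_lin matrix_vector_mul_assoc matrix_inv_left[OF A]
    using v inj by auto
  then show 2: "sub_triple (sub_triple (lin_triple A) f) (lin_triple (matrix_inv A)) \<noteq> 0" by (rule evp_nonzero)
  note tA = rat_triple_lin[OF A] and tB = rat_triple_lin[OF invertible_matrix_inv[OF A]]
  show "PGL_map A \<circ>\<^sub>R rat_class f \<circ>\<^sub>R PGL_map (matrix_inv A) =
     rat_class (sub_triple (sub_triple (lin_triple A) f) (lin_triple (matrix_inv A)))"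
    unfolding PGL_map_lin rat_comp_class[OF inf tA f 1]
    by (rule rat_comp_class[OF inf rat_triple_sub[OF tA f 1] tB 2])
qed

text \<open>This turns equality of images under \<open>PGL3_conj\<close> into conjugacy: a class
  lies in its own image, hence in that of the other class.\<close>

lemma PGL3_conj_refl:
  fixes f :: "'a::field poly3 ^ 3"
  assumes inf: "infinite (UNIV :: 'a set)" and f: "rat_triple f"
  shows "(rat_class f, rat_class f) \<in> PGL3_conj"
proof -
  have I: "invertible (mat 1 :: 'a ^ 3 ^ 3)" by (auto simp: invertible_def intro!: exI[of _ "mat 1"])
  have m: "matrix_inv (mat 1 :: 'a ^ 3 ^ 3) = mat 1" using matrix_inv_left[OF I] by simp
  let ?g = "sub_triple (sub_triple (lin_triple (mat 1)) f) (lin_triple (matrix_inv (mat 1)))"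
  have "f $ i = ?g $ i" for i
  proof (rule poly3_eqI[OF inf])
    fix v
    have "evp f v = evp ?g v" by (simp only: id_hom.evt_sub evp_lin m matrix_vector_mul_lid)
    then show "eval3 (f $ i) v = eval3 (?g $ i) v" unfolding eval3_evh by (metis evt_nth)
  qed
  then have "f = ?g" by (subst vec_eq_iff) blast
  then have "rat_class f = PGL_map (mat 1) \<circ>\<^sub>R rat_class f \<circ>\<^sub>R PGL_map (matrix_inv (mat 1))"
    unfolding PGL_conj_class(1)[OF inf I f] by simp
  then show ?thesis unfolding PGL3_conj_def using I by auto
qed

section \<open>The Bertini involution is birational\<close>

definition bertini_map :: "(nat \<Rightarrow> 'a::field) \<Rightarrow> ('a poly3 ^ 3) set" where
  "bertini_map a = rat_class (bert_triple a)"

text \<open>The involution sends \<open>cpt s\<close> to \<open>cpt (- s)\<close>; the test points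
  for the nonvanishing of forms need both of them off the base locus.\<close>

lemma good_parameter:
  fixes a :: "nat \<Rightarrow> 'a::field"
  assumes inf: "infinite (UNIV :: 'a set)"
  obtains s where "s \<noteq> 0" "gcub a (cpt s) \<noteq> 0" "gcub a (cpt (- s)) \<noteq> 0"
proof -
  define p where "p = [:a 0, a 1, a 2, a 3, a 4, a 5, a 6, 0, 1:]"
  have p: "gcub a (cpt s) = s * poly p s" for s
    by (simp add: gcub_cpt p_def algebra_simps eval_nat_numeral)
  define q where "q = [:0, 1:] * p * pcompose p [:0, - 1:]"
  have p0: "p \<noteq> 0" by (simp add: p_def)
  then have "pcompose p [:0, - 1:] \<noteq> 0" by (subst pcompose_eq_0_iff) auto
  then have "q \<noteq> 0" using p0 by (simp add: q_def)
  then have "finite {s. poly q s = 0}" by (rule poly_roots_finite)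
  then have "{s. poly q s = 0} \<noteq> UNIV" using inf by metis
  then obtain s where "poly q s \<noteq> 0" by blast
  then have "s \<noteq> 0" "poly p s \<noteq> 0" "poly p (- s) \<noteq> 0" by (auto simp: q_def poly_pcompose)
  then show ?thesis using that by (simp add: p)
qed

lemma cusp_cubic_X3_nonzero: "cusp_cubic (X3 :: 'a::comm_ring_1 poly3 ^ 3) \<noteq> 0"
proof
  assume "cusp_cubic (X3 :: 'a poly3 ^ 3) = 0"
  from arg_cong[OF this, of "\<lambda>F. evh (\<lambda>x. x) F (vector [0, 1, 0])"]
  show False by (simp add: id_hom.evh_cusp) (simp add: cusp_cubic_def vector_3)
qed

text \<open>If the image lay in the cuspidal cubic, then by \<open>bert_member\<close> also in
  \<open>gcub\<close>, first off the cuspidal cubic and then everywhere by density; but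
  \<open>gcub\<close> is nonzero at the image of \<open>cpt s\<close>.\<close>

lemma bert_triple_nonzero:
  fixes a :: "nat \<Rightarrow> 'a::field"
  assumes inf: "infinite (UNIV :: 'a set)" and "a 0 \<noteq> 0"
  shows "rat_triple (bert_triple a)" "cusp_cubic (bert_triple a) \<noteq> 0"
proof -
  obtain s where s: "s \<noteq> 0" "gcub a (cpt s) \<noteq> 0" "gcub a (cpt (- s)) \<noteq> 0"
    using good_parameter[OF inf] by blast
  have ev: "evp (bert_triple a) v = bert a v" for v by (simp add: id_hom.evt_bert)
  have "bert a (cpt s) $ 1 \<noteq> 0" using s assms(2) by (simp add: bert_cpt)
  then have "evp (bert_triple a) (cpt s) \<noteq> 0" unfolding ev by (metis zero_index)
  then have "bert_triple a \<noteq> 0" by (rule evp_nonzero)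
  then show "rat_triple (bert_triple a)" using homog_bert by (auto simp: rat_triple_def)
  show "cusp_cubic (bert_triple a) \<noteq> 0"
  proof
    assume z: "cusp_cubic (bert_triple a) = 0"
    have c0: "cusp_cubic (bert a v) = 0" for v
      using arg_cong[OF z, of "\<lambda>F. evh (\<lambda>x. x) F v"] by (simp add: id_hom.evh_cusp ev)
    have "gcub (poly_const a) (bert_triple a) = 0"
    proof (rule evh_zeroI[OF inf cusp_cubic_X3_nonzero])
      fix v assume "evh (\<lambda>x. x) (cusp_cubic (X3 :: 'a poly3 ^ 3)) v \<noteq> 0"
      then have "cusp_cubic v \<noteq> 0" by (simp add: id_hom.evh_cusp)
      then have "gcub a (bert a v) = 0" using bert_member[of a v] c0[of v] assms(2) by simp
      then show "evh (\<lambda>x. x) (gcub (poly_const a) (bert_triple a)) v = 0"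
        by (simp add: id_hom.evh_gcub ev)
    qed
    from arg_cong[OF this, of "\<lambda>F. evh (\<lambda>x. x) F (cpt s)"]
    have "gcub a (bert a (cpt s)) = 0" by (simp add: id_hom.evh_gcub ev)
    then show False using s assms(2) by (simp add: bert_cpt gcub_scale)
  qed
qed

text \<open>The map is its own inverse. That its square is not identically zero is tested at a point
  where the scalar factors in \<open>bert_involution\<close> do not vanish.\<close>

lemma bertini_map_Bir2:
  fixes a :: "nat \<Rightarrow> 'a::field"
  assumes inf: "infinite (UNIV :: 'a set)" and a0: "a 0 \<noteq> 0"
  shows "bertini_map a \<in> Bir2"
proof -
  note t = bert_triple_nonzero[of a, OF inf a0]
  have ev: "evp (bert_triple a) v = bert a v" for v by (simp add: id_hom.evt_bert)
  define Q where "Q = dpen (poly_const a) (const3 (a 0) * cusp_cubic X3) (gcub (poly_const a) X3)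
     (tang (poly_const a) (const3 (a 0) * cusp_cubic X3) (gcub (poly_const a) X3)) X3"
  have Q: "evh (\<lambda>x. x) Q v = dpen a (a 0 * cusp_cubic v) (gcub a v) (tang a (a 0 * cusp_cubic v) (gcub a v)) v" for v
  proof -
    interpret e: ring_hom3 "\<lambda>F. evh (\<lambda>x. x) F v" by (rule id_hom.evh_ring_hom)
    show ?thesis unfolding Q_def by (simp add: e.h_dpen e.h_tang e.h_cusp e.h_gcub e.hom)
  qed
  have "Q \<noteq> 0"
  proof
    assume z: "Q = 0"
    obtain s where s: "s \<noteq> 0" "gcub a (cpt s) \<noteq> 0" using good_parameter[OF inf] by blast
    have "evh (\<lambda>x. x) Q (cpt s) = 0" by (simp add: z)
    then show False using s a0 by (simp add: Q dpen_tang_cpt)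
  qed
  then have "cusp_cubic X3 * cusp_cubic (bert_triple a) * Q \<noteq> 0"
    using t(2) cusp_cubic_X3_nonzero by simp
  then obtain v where "eval3 (cusp_cubic X3 * cusp_cubic (bert_triple a) * Q) v \<noteq> 0"
    using poly3_nonzero_point[OF inf] by blast
  then have v: "cusp_cubic v \<noteq> 0" "cusp_cubic (bert a v) \<noteq> 0" "evh (\<lambda>x. x) Q v \<noteq> 0"
    by (simp_all add: eval3_evh id_hom.evh_cusp ev)
  have "v \<noteq> 0" using v(1) by (auto simp: cusp_cubic_def)
  then have "bert a (bert a v) \<noteq> 0"
    using v(1,2) v(3)[unfolded Q] by (subst bert_involution[of a v, OF a0 v(1)]) auto
  then have "evp (sub_triple (bert_triple a) (bert_triple a)) v \<noteq> 0"
    by (simp only: id_hom.evt_sub ev) simp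
  then have nz: "sub_triple (bert_triple a) (bert_triple a) \<noteq> 0" by (rule evp_nonzero)
  have "rat_eq (sub_triple (bert_triple a) (bert_triple a)) X3"
  proof (rule rat_eqI[OF inf rat_triple_sub[OF t(1) t(1) nz] rat_triple_X3 cusp_cubic_X3_nonzero])
    fix v assume "evh (\<lambda>x. x) (cusp_cubic (X3 :: 'a poly3 ^ 3)) v \<noteq> 0"
    then have "cusp_cubic v \<noteq> 0" by (simp add: id_hom.evh_cusp)
    from bert_involution[of a v, OF a0 this]
    have "par (bert a (bert a v)) v" by (simp add: par_def)
    then show "par (evp (sub_triple (bert_triple a) (bert_triple a)) v) (evp X3 v)"
      unfolding id_hom.evt_sub ev by simp
  qed
  then have "bertini_map a \<circ>\<^sub>R bertini_map a = rat_id"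
    unfolding bertini_map_def rat_id_X3 rat_comp_class[OF inf t(1) t(1) nz] by (rule rat_class_eq[OF inf])
  moreover have "bertini_map a \<in> Rat2" using t(1) by (auto simp: bertini_map_def Rat2_def)
  ultimately show ?thesis by (auto simp: Bir2_def)
qed

section \<open>Fibres of the Bertini involution\<close>

lemma det3_scale: "det3 x (c *s u) v = c * det3 x u v" "det3 x u (c *s v) = c * det3 x u v"
  by (simp_all add: det3_def algebra_simps)

lemma det3_combination: "det3 x (s *s x - t *s v) v = 0"
  by (simp add: det3_def algebra_simps)

lemma det3_kernel:
  fixes g1 g2 g3 :: "'a::idom"
  assumes "\<And>z. z \<in> {x, u, v} \<Longrightarrow> g1 * z $ 1 + g2 * z $ 2 + g3 * z $ 3 = 0" "det3 x u v \<noteq> 0"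
  shows "g1 = 0" "g2 = 0" "g3 = 0"
proof -
  define gx gu gv where g: "gx = g1 * x $ 1 + g2 * x $ 2 + g3 * x $ 3"
    "gu = g1 * u $ 1 + g2 * u $ 2 + g3 * u $ 3" "gv = g1 * v $ 1 + g2 * v $ 2 + g3 * v $ 3"
  have z: "gx = 0" "gu = 0" "gv = 0" using assms(1) by (simp_all add: g)
  have "g1 * det3 x u v = gx * (u $ 2 * v $ 3 - u $ 3 * v $ 2) + gu * (v $ 2 * x $ 3 - v $ 3 * x $ 2)
      + gv * (x $ 2 * u $ 3 - x $ 3 * u $ 2)"
    "g2 * det3 x u v = gx * (u $ 3 * v $ 1 - u $ 1 * v $ 3) + gu * (v $ 3 * x $ 1 - v $ 1 * x $ 3)
      + gv * (x $ 3 * u $ 1 - x $ 1 * u $ 3)"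
    "g3 * det3 x u v = gx * (u $ 1 * v $ 2 - u $ 2 * v $ 1) + gu * (v $ 1 * x $ 2 - v $ 2 * x $ 1)
      + gv * (x $ 1 * u $ 2 - x $ 2 * u $ 1)"
    by (simp_all add: g det3_def algebra_simps)
  then show "g1 = 0" "g2 = 0" "g3 = 0" using assms(2) by (simp_all add: z)
qed

lemma finite_at_most_one: "(\<And>i j. i \<in> A \<Longrightarrow> j \<in> A \<Longrightarrow> i = j) \<Longrightarrow> finite A"
  by (metis finite.emptyI finite.insertI finite_subset insertCI subsetI ex_in_conv)

context eight_points
begin

text \<open>By \<open>no_line\<close> the restriction to the line is a nonzero binary cubic form.
  Nonparallel points have different ratios s / t, except for at most one point with t = 0.\<close>

lemma line_meets_finite:
  assumes "p \<noteq> 0 \<or> r \<noteq> 0" "\<not> par u v"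
    and x: "\<And>i. i \<in> I \<Longrightarrow> x i \<noteq> 0" "\<And>i. i \<in> I \<Longrightarrow> \<exists>s t. x i = s *s u + t *s v"
      "\<And>i. i \<in> I \<Longrightarrow> pen a p r (x i) = 0" "\<And>i j. i \<in> I \<Longrightarrow> j \<in> I \<Longrightarrow> i \<noteq> j \<Longrightarrow> \<not> par (x i) (x j)"
  shows "finite I"
proof -
  obtain s t where st: "\<And>i. i \<in> I \<Longrightarrow> x i = s i *s u + t i *s v" using x(2) by metis
  define P where "P = [:pen a p r v, dpen a p r v u, dpen a p r u v, pen a p r u:]"
  have "P \<noteq> 0"
  proof
    assume "P = 0"
    then have "pen a p r (s *s u + t *s v) = 0" for s t unfolding pen_expand by (simp add: P_def)
    then show False using no_line[OF assms(1,2)] by metis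
  qed
  then have fin: "finite {c. poly P c = 0}" by (rule poly_roots_finite)
  define J where "J = {i \<in> I. t i \<noteq> 0}"
  have "(\<lambda>i. s i / t i) ` J \<subseteq> {c. poly P c = 0}"
  proof clarify
    fix i assume i: "i \<in> J"
    have "0 = pen a p r (s i *s u + t i *s v)" using i x(3) st by (simp add: J_def)
    also have "\<dots> = t i ^ 3 * poly P (s i / t i)"
      unfolding pen_expand using i by (simp add: J_def P_def field_simps eval_nat_numeral)
    finally show "poly P (s i / t i) = 0" using i by (simp add: J_def)
  qed
  then have "finite ((\<lambda>i. s i / t i) ` J)" using fin finite_subset by blast
  moreover have "inj_on (\<lambda>i. s i / t i) J"
  proof (rule inj_onI, rule ccontr)
    fix i j assume ij: "i \<in> J" "j \<in> J" "s i / t i = s j / t j" "i \<noteq> j"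
    then have e: "s i * t j = s j * t i" by (simp add: J_def field_simps)
    have "x i $ k * x j $ l - x i $ l * x j $ k = (s i * t j - s j * t i) * (u $ k * v $ l - u $ l * v $ k)" for k l
      using ij st by (simp add: J_def algebra_simps)
    then have "par (x i) (x j)" by (simp add: par_def e)
    then show False using x(4) ij by (auto simp: J_def)
  qed
  ultimately have "finite J" by (rule finite_imageD)
  moreover have "finite {i \<in> I. t i = 0}"
  proof (rule finite_at_most_one, rule ccontr)
    fix i j assume ij: "i \<in> {i \<in> I. t i = 0}" "j \<in> {i \<in> I. t i = 0}" "i \<noteq> j"
    then have "x i = s i *s u" "x j = s j *s u" using st by simp_all
    then have "par (x i) (x j)" by (simp add: par_def mult_ac)
    then show False using x(4) ij by auto
  qed
  moreover have "I = J \<union> {i \<in> I. t i = 0}" by (auto simp: J_def)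
  ultimately show ?thesis by (metis finite_Un)
qed

text \<open>If \<open>tA\<close> and \<open>tB\<close> both vanished, the member would contain its
  tangent at (1 : 0 : 0); for p = 0 the value of \<open>tA\<close> is
  \<open>a 0 * r ^ 4\<close>.\<close>

lemma tang_nonzero:
  assumes "p \<noteq> 0 \<or> r \<noteq> 0"
  shows "tang a p r \<noteq> 0"
proof
  assume z: "tang a p r = 0"
  have A: "tA a p r = 0" using arg_cong[OF z, of "\<lambda>v. v $ 1"] by simp
  have p: "p \<noteq> 0" using A a_0_nonzero assms by (auto simp: tA_def)
  have B: "tB a p r = 0" using arg_cong[OF z, of "\<lambda>v. v $ 3"] p by simp
  have "\<not> par (vector [1, 0, 0]) (vector [0, r, p])" using p by (simp add: par_3 vector_3)
  then obtain s t where "pen a p r (s *s vector [1, 0, 0] + t *s vector [0, r, p]) \<noteq> 0"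
    using no_line[OF assms] by blast
  moreover have "s *s vector [1, 0, 0] + t *s vector [0, r, p] = (vector [s, r * t, p * t] :: 'a ^ 3)"
    by (rule vec3_eqI) (simp_all add: vector_3)
  ultimately have "pen a p r (vector [s, r * t, p * t]) \<noteq> 0" by metis
  then show False unfolding pen_tangent_line by (simp add: A B)
qed

text \<open>This is the smoothness of the member at w = \<open>tang\<close>. If w is the point q =
  (1 : 0 : 0), its tangent form is p y - r z up to a factor. Otherwise the member restricts to the
  line through w and q as s^2 t \<open>dpen\<close> at (w, q), which is not 0 by
  \<open>no_line\<close>.\<close>

lemma tang_smooth:
  assumes "p \<noteq> 0 \<or> r \<noteq> 0"
  shows "\<exists>z. dpen a p r (tang a p r) z \<noteq> 0"
proof (cases "par (tang a p r) (cpt 0)")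
  case True
  then obtain c where c: "tang a p r = c *s cpt 0" by (rule par_scaleE) simp
  then have "c \<noteq> 0" using tang_nonzero[OF assms] by auto
  then have "dpen a p r (tang a p r) (vector [0, p, 0]) \<noteq> 0 \<or> dpen a p r (tang a p r) (vector [0, 0, r]) \<noteq> 0"
    unfolding c dpen_scale dpen_origin using assms a_0_nonzero by (auto simp: vector_3)
  then show ?thesis by blast
next
  case False
  then obtain s t where "pen a p r (s *s tang a p r + t *s cpt 0) \<noteq> 0"
    using no_line[OF assms] by blast
  then have "dpen a p r (tang a p r) (cpt 0) \<noteq> 0" unfolding pen_expand by auto
  then show ?thesis by blast
qed

lemma dpen_coords: "dpen a p r u z = dpen a p r u (axis 1 1) * z $ 1 + dpen a p r u (axis 2 1) * z $ 2
    + dpen a p r u (axis 3 1) * z $ 3"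
  by (simp add: dpen_def dgcub_def dcusp_def axis_def algebra_simps)

text \<open>The preimages of \<open>y\<close> lie on the member through \<open>y\<close> and on a line: the one that joins \<open>y\<close> to
  the point \<open>tang\<close> of this member, or the tangent at \<open>tang\<close> if the two points coincide. The map \<open>h\<close>
  is any polynomial representative of the involution, which may be defined where \<open>bert a\<close> vanishes.\<close>

lemma finite_fibre:
  fixes h :: "'a ^ 3 \<Rightarrow> 'a ^ 3" and x :: "'i \<Rightarrow> 'a ^ 3"
  assumes y: "\<not> (cusp_cubic y = 0 \<and> gcub a y = 0)"
    and x: "\<And>i. i \<in> I \<Longrightarrow> x i \<noteq> 0" "\<And>i j. i \<in> I \<Longrightarrow> j \<in> I \<Longrightarrow> i \<noteq> j \<Longrightarrow> \<not> par (x i) (x j)"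
    and hx: "\<And>i. i \<in> I \<Longrightarrow> \<exists>k. k \<noteq> 0 \<and> h (x i) = k *s y"
    and h1: "\<And>v. cusp_cubic v * gcub a (h v) = gcub a v * cusp_cubic (h v)"
    and h2: "\<And>v. det3 v (h v) (tang a (a 0 * cusp_cubic v) (gcub a v)) = 0"
    and h3: "\<And>v. par (bert a v) (h v)"
  shows "finite I"
proof -
  define p where "p = a 0 * cusp_cubic y"
  define r where "r = gcub a y"
  define w where "w = tang a p r"
  have pr: "p \<noteq> 0 \<or> r \<noteq> 0" using y a_0_nonzero by (auto simp: p_def r_def)
  have w0: "w \<noteq> 0" unfolding w_def by (rule tang_nonzero[OF pr])
  have y0: "y \<noteq> 0" using y by (auto simp: cusp_cubic_def gcub_def)
  \<comment> \<open>Preimages at base points, at most nine of them; only for the others does a point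
    determine its member.\<close>
  define J where "J = {i \<in> I. cusp_cubic (x i) = 0 \<and> gcub a (x i) = 0}"
  have "\<exists>s. s \<in> insert 0 R \<and> par (x i) (cpt s)" if "i \<in> J" for i
  proof -
    have "cusp_cubic (x i) = 0" "gcub a (x i) = 0" "x i \<noteq> 0" using that x(1) by (auto simp: J_def)
    then obtain c s where "s \<in> insert 0 R" "x i = c *s cpt s" by (rule base_points)
    then show ?thesis using par_scale(1) by metis
  qed
  then obtain f where f: "\<And>i. i \<in> J \<Longrightarrow> f i \<in> insert 0 R \<and> par (x i) (cpt (f i))" by metis
  have "inj_on f J"
  proof (rule inj_onI, rule ccontr)
    fix i j assume ij: "i \<in> J" "j \<in> J" "f i = f j" "i \<noteq> j"
    have "par (x i) (cpt (f i))" "par (cpt (f i)) (x j)"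
      using f[OF ij(1)] f[OF ij(2)] ij(3) par_sym by metis+
    then have "par (x i) (x j)" using par_trans cpt_nonzero by blast
    then show False using x(2) ij by (auto simp: J_def)
  qed
  moreover have "f ` J \<subseteq> insert 0 R" using f by auto
  ultimately have finJ: "finite J" using finite_R by (metis finite.insertI finite_imageD finite_subset)
  \<comment> \<open>Since \<open>h\<close> preserves the members, the parameter of
    \<open>x i\<close> is proportional to that of \<open>y\<close>.\<close>
  have sc: "\<exists>k. k \<noteq> 0 \<and> a 0 * cusp_cubic (x i) = k * p \<and> gcub a (x i) = k * r" if i: "i \<in> I - J" for i
  proof -
    obtain k where k: "k \<noteq> 0" "h (x i) = k *s y" using hx i by blast
    have "k ^ 3 * (cusp_cubic (x i) * r) = k ^ 3 * (gcub a (x i) * cusp_cubic y)"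
      using h1[of "x i"] unfolding k(2) by (simp add: gcub_scale cusp_scale r_def algebra_simps)
    then have e: "cusp_cubic (x i) * r = gcub a (x i) * cusp_cubic y" using k(1) by simp
    show ?thesis
    proof (cases "cusp_cubic y = 0")
      case True
      then have r: "r \<noteq> 0" using y by (simp add: r_def)
      then have "cusp_cubic (x i) = 0" using e True by simp
      then show ?thesis using True r i by (intro exI[of _ "gcub a (x i) / r"]) (auto simp: p_def J_def)
    next
      case False
      let ?k = "cusp_cubic (x i) / cusp_cubic y"
      have "gcub a (x i) = ?k * r" using e False by (simp add: field_simps)
      moreover from this have "?k \<noteq> 0" using i False by (auto simp: J_def)
      ultimately show ?thesis using False by (intro exI[of _ ?k]) (simp add: p_def)
    qed
  qed
  have on: "pen a p r (x i) = 0" if i: "i \<in> I - J" for i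
  proof -
    obtain k where k: "k \<noteq> 0" "a 0 * cusp_cubic (x i) = k * p" "gcub a (x i) = k * r" using sc[OF i] by blast
    have "k * pen a p r (x i) = 0" using pen_member[of a "x i"] unfolding k pen_scale .
    then show ?thesis using k(1) by simp
  qed
  have "finite (I - J)"
  proof (cases "par y w")
    case False
    show ?thesis
    proof (rule line_meets_finite[OF pr False])
      fix i assume i: "i \<in> I - J"
      obtain k where k: "k \<noteq> 0" "a 0 * cusp_cubic (x i) = k * p" "gcub a (x i) = k * r" using sc[OF i] by blast
      obtain e where e: "e \<noteq> 0" "h (x i) = e *s y" using hx i by blast
      have "e * (k ^ 4 * det3 (x i) y w) = 0"
        using h2[of "x i"] unfolding k(2,3) e(2) tang_scale det3_scale w_def
        by (simp only: mult.left_commute)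
      then have "det3 (x i) y w = 0" using e(1) k(1) by simp
      then show "\<exists>s t. x i = s *s y + t *s w" by (rule det3_span[OF False])
    qed (use x on in auto)
  next
    case True
    \<comment> \<open>If \<open>y\<close> is the point \<open>w\<close>, the third point on the line
      through \<open>x i\<close> and \<open>w\<close> is \<open>w\<close> again; for
      \<open>x i\<close> different from \<open>w\<close> this puts \<open>x i\<close> on the tangent
      at \<open>w\<close>.\<close>
    define K where "K = {i \<in> I - J. \<not> par (x i) w}"
    have Q: "dpen a p r w (x i) = 0" if i: "i \<in> K" for i
    proof -
      have iJ: "i \<in> I - J" and np: "\<not> par (x i) w" using i by (auto simp: K_def)
      obtain k where k: "k \<noteq> 0" "a 0 * cusp_cubic (x i) = k * p" "gcub a (x i) = k * r" using sc[OF iJ] by blast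
      obtain e where e: "e \<noteq> 0" "h (x i) = e *s y" using hx iJ by blast
      have "bert a (x i) = k ^ 9 *s third_pt a p r (x i)" unfolding bert_def k(2,3) by (rule third_pt_scale)
      then have pp: "par (k ^ 9 *s third_pt a p r (x i)) (e *s y)" using h3[of "x i"] e by simp
      have "k ^ 9 * e * (third_pt a p r (x i) $ m * y $ n) = k ^ 9 * e * (third_pt a p r (x i) $ n * y $ m)" for m n
        using pp[unfolded par_def, rule_format, of m n] by (simp only: vector_smult_component mult_ac)
      then have "par (third_pt a p r (x i)) y" using k(1) e(1) by (simp add: par_def)
      then have "par (third_pt a p r (x i)) w" using par_trans True y0 by blast
      then obtain c where "third_pt a p r (x i) = c *s w" using w0 by (rule par_scaleE)
      then have "dpen a p r w (x i) *s x i + (- dpen a p r (x i) w - c) *s w = 0"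
        by (simp add: third_pt_def w_def vec_eq_iff algebra_simps)
      then show ?thesis by (rule not_par_indep(1)[OF np])
    qed
    have "finite K"
    proof (cases "K = {}")
      case False
      then obtain i0 where i0: "i0 \<in> K" by blast
      obtain z where z: "dpen a p r w z \<noteq> 0" using tang_smooth[OF pr] by (auto simp: w_def)
      have np: "\<not> par w (x i0)" using i0 par_sym by (auto simp: K_def)
      show ?thesis
      proof (rule line_meets_finite[OF pr np])
        fix i assume i: "i \<in> K"
        \<comment> \<open>Three independent zeros would make the linear form
          \<open>dpen a p r w\<close> vanish, against smoothness at \<open>w\<close>; so all
          \<open>x i\<close> lie on the line through \<open>w\<close> and
          \<open>x i0\<close>.\<close>
        have "det3 (x i) w (x i0) = 0"
        proof (rule ccontr)
          assume "det3 (x i) w (x i0) \<noteq> 0"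
          moreover have "dpen a p r w w = 0" by (simp add: dpen_euler w_def)
          then have "dpen a p r w (axis 1 1) * v $ 1 + dpen a p r w (axis 2 1) * v $ 2
            + dpen a p r w (axis 3 1) * v $ 3 = 0" if "v \<in> {x i, w, x i0}" for v
            unfolding dpen_coords[symmetric] using that Q[OF i] Q[OF i0] by auto
          ultimately have "dpen a p r w z = 0"
            unfolding dpen_coords[of p r w z] using det3_kernel by (metis mult_zero_left add_0_left)
          then show False using z by simp
        qed
        then show "\<exists>s t. x i = s *s w + t *s x i0" by (rule det3_span[OF np])
      qed (use x on in \<open>auto simp: K_def\<close>)
    qed simp
    moreover have "finite {i \<in> I - J. par (x i) w}"
    proof (rule finite_at_most_one, rule ccontr)
      fix i j assume ij: "i \<in> {i \<in> I - J. par (x i) w}" "j \<in> {i \<in> I - J. par (x i) w}" "i \<noteq> j"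
      then have "par (x i) (x j)" using par_trans[of "x i" w "x j"] par_sym w0 by auto
      then show False using x(2) ij by auto
    qed
    moreover have "I - J = K \<union> {i \<in> I - J. par (x i) w}" by (auto simp: K_def)
    ultimately show ?thesis by (metis finite_Un)
  qed
  then show ?thesis using finJ by (metis finite_Diff2)
qed

section \<open>Contracted curves\<close>

text \<open>The points \<open>tang a n 1\<close> move on a curve that is not a line: in the
  expansion by powers of n the constant term gives l1 = 0, and then the odd coefficients of
  \<open>fpoly\<close>, not all 0, give l2 = l3 = 0.\<close>

lemma tang_not_in_plane:
  assumes "l1 \<noteq> 0 \<or> l2 \<noteq> 0 \<or> l3 \<noteq> 0"
  shows "finite {n. l1 * tang a n 1 $ 1 + l2 * tang a n 1 $ 2 + l3 * tang a n 1 $ 3 = 0}"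
proof -
  define P where "P = [:l1 * a 0, l1 * a 2 - l2 * a 1, l1 * a 4 - l2 * a 3 - l3 * a 1,
     l1 * a 6 - l2 * a 5 - l3 * a 3, l1 - l3 * a 5:]"
  have "P \<noteq> 0"
  proof
    assume "P = 0"
    then have e: "l1 * a 0 = 0" "l1 * a 2 - l2 * a 1 = 0" "l1 * a 4 - l2 * a 3 - l3 * a 1 = 0"
      "l1 * a 6 - l2 * a 5 - l3 * a 3 = 0" "l1 - l3 * a 5 = 0" unfolding P_def pCons_eq_0_iff by blast+
    have l1: "l1 = 0" using e(1) a_0_nonzero by simp
    have "l2 = 0 \<and> l3 = 0" using e odd_part_nonzero unfolding l1
      by (cases "a 1 = 0"; cases "a 3 = 0") auto
    then show False using l1 assms by simp
  qed
  then have "finite {n. poly P n = 0}" by (rule poly_roots_finite)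
  moreover have "poly P n = l1 * tang a n 1 $ 1 + l2 * tang a n 1 $ 2 + l3 * tang a n 1 $ 3" for n
    by (simp add: P_def tA_def tB_def algebra_simps eval_nat_numeral)
  ultimately show ?thesis by simp
qed

text \<open>On the members of the pencil the inverses of a base point \<open>cpt s\<close> are the points
  \<open>third_pt a n 1 (cpt s)\<close>. They form a curve because \<open>tang a n 1\<close> is not always in the tangent at
  \<open>cpt s\<close>.\<close>

lemma contracted_tangent:
  assumes "s \<in> R" "(2 :: 'a) = 0 \<longrightarrow> a 5 \<noteq> 0 \<longrightarrow> a 5 * s\<^sup>2 + a 3 \<noteq> 0"
  shows "finite {n. dpen a n 1 (cpt s) (tang a n 1) = 0}"
proof -
  define gx where "gx = a 5 * s ^ 6 + a 3 * s ^ 4 + a 1 * s\<^sup>2 + 2 * a 0 * s"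
  define gy where "gy = a 6 * s ^ 6 + 2 * a 4 * s ^ 4 + a 3 * s ^ 3 + 3 * a 2 * s\<^sup>2 + 2 * a 1 * s + a 0"
  define gz where "gz = 3 * s ^ 6 + 2 * a 6 * s ^ 4 + 2 * a 5 * s ^ 3 + a 4 * s\<^sup>2 + a 3 * s"
  \<comment> \<open>The expansion in powers of n. Outside characteristic 2 the constant term is
    nonzero; in characteristic 2 the coefficients of n and n^5 decide.\<close>
  define P where "P = [:- (2 * (a 0)\<^sup>2 * s ^ 3),
     gx * a 0 - a 0 * (2 * s ^ 3 * a 2 + 3 * s\<^sup>2 * a 1),
     gx * a 2 - gy * a 1 - a 0 * (2 * s ^ 3 * a 4 + 3 * s\<^sup>2 * a 3 - a 1),
     gx * a 4 - gy * a 3 - gz * a 1 - a 0 * (2 * s ^ 3 * a 6 + 3 * s\<^sup>2 * a 5 - a 3),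
     gx * a 6 - gy * a 5 - gz * a 3 - a 0 * (2 * s ^ 3 - a 5),
     gx - gz * a 5:]"
  have s0: "s \<noteq> 0" using R_nonzero assms(1) by auto
  have dg: "dgcub a (cpt s) v = gx * v $ 1 + gy * v $ 2 + gz * v $ 3" for v
    by (simp add: dgcub_def gx_def gy_def gz_def algebra_simps eval_nat_numeral)
  have P: "poly P n = dpen a n 1 (cpt s) (tang a n 1)" for n
    unfolding dpen_def dg
    by (simp add: P_def dcusp_def tA_def tB_def algebra_simps eval_nat_numeral)
  have "P \<noteq> 0"
  proof (cases "(2 :: 'a) = 0")
    case False
    then show ?thesis using s0 a_0_nonzero by (simp add: P_def)
  next
    case two: True
    show ?thesis
    proof
      assume P0: "P = 0"
      have c1: "gx * a 0 - a 0 * (2 * s ^ 3 * a 2 + 3 * s\<^sup>2 * a 1) = 0" and c5: "gx - gz * a 5 = 0"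
        using P0 unfolding P_def pCons_eq_0_iff by blast+
      have e: "gx * a 0 - a 0 * (2 * s ^ 3 * a 2 + 3 * s\<^sup>2 * a 1) =
          a 0 * (s ^ 4 * (a 5 * s\<^sup>2 + a 3)) + 2 * (a 0 * (a 0 * s - s ^ 3 * a 2 - s\<^sup>2 * a 1))"
        by (simp add: gx_def algebra_simps eval_nat_numeral)
      have "a 0 * (s ^ 4 * (a 5 * s\<^sup>2 + a 3)) = 0" using c1 unfolding e by (simp only: two mult_zero_left add_0_right)
      then have 1: "a 5 * s\<^sup>2 + a 3 = 0" using a_0_nonzero s0 by simp
      then have 5: "a 5 = 0" using assms(2) two by blast
      then have 3: "a 3 = 0" using 1 by simp
      have "a 1 * s\<^sup>2 = 0" using c5 by (simp add: gx_def 5 3 two)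
      then show False using s0 5 3 odd_part_nonzero by simp
    qed
  qed
  then have "finite {n. poly P n = 0}" by (rule poly_roots_finite)
  then show ?thesis by (simp add: P)
qed

lemma contracted:
  assumes s: "s \<in> R" and two: "(2 :: 'a) = 0 \<longrightarrow> a 5 \<noteq> 0 \<longrightarrow> a 5 * s\<^sup>2 + a 3 \<noteq> 0"
  shows "\<exists>I (u :: 'a \<Rightarrow> 'a ^ 3). infinite I \<and> (\<forall>n\<in>I. u n \<noteq> 0) \<and>
    (\<forall>m\<in>I. \<forall>n\<in>I. m \<noteq> n \<longrightarrow> \<not> par (u m) (u n)) \<and>
    (\<forall>n\<in>I. \<exists>k. k \<noteq> 0 \<and> bert a (u n) = k *s cpt s)"
proof -
  have s0: "s \<noteq> 0" using R_nonzero s by auto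
  define u where "u n = third_pt a n 1 (cpt s)" for n
  define Q where "Q n = dpen a n 1 (tang a n 1) (cpt s)" for n
  define P where "P n = dpen a n 1 (cpt s) (tang a n 1)" for n
  have u: "u n = Q n *s cpt s - P n *s tang a n 1" for n by (simp add: u_def third_pt_def Q_def P_def)
  have base: "pen a n 1 (cpt s) = 0" for n
    using gcub_cpt_0_iff[of s] s by (simp add: pen_def)
  have finQ: "finite {n. Q n = 0}"
  proof -
    define Qp where "Qp = dpen (\<lambda>i. [:a i:]) [:0, 1:] 1 (tang (\<lambda>i. [:a i:]) [:0, 1:] 1) (cpt [:s:])"
    have "poly Qp n = Q n" for n
    proof -
      interpret e: ring_hom3 "\<lambda>p. poly p n" by unfold_locales simp_all
      have "vmap (\<lambda>p. poly p n) (cpt [:s:]) = cpt s" by (rule vec3_eqI) simp_all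
      then show ?thesis unfolding Qp_def Q_def by (simp add: e.h_dpen e.h_tang)
    qed
    moreover have "Q 0 \<noteq> 0" using s0 a_0_nonzero by (simp add: Q_def dpen_tang_cpt)
    ultimately have "Qp \<noteq> 0" by (metis poly_0)
    then show ?thesis using poly_roots_finite[of Qp] \<open>\<And>n. poly Qp n = Q n\<close> by simp
  qed
  have finP: "finite {n. P n = 0}" unfolding P_def by (rule contracted_tangent[OF s two])
  define B where "B t = {n. det3 (tang a n 1) (cpt s) (cpt t) = 0}" for t
  have finB: "finite (B t)" if "t \<noteq> s" for t
  proof -
    have "det3 v (cpt s) (cpt t) = (s * t ^ 3 - s ^ 3 * t) * v $ 1 + (s ^ 3 - t ^ 3) * v $ 2 + (t - s) * v $ 3" for v
      by (simp add: det3_def algebra_simps)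
    then show ?thesis unfolding B_def using tang_not_in_plane[of _ _ "t - s"] that by simp
  qed
  define Bs where "Bs = {n. - s * tang a n 1 $ 1 + 1 * tang a n 1 $ 2 + 0 * tang a n 1 $ 3 = 0}"
  have finBs: "finite Bs" unfolding Bs_def by (rule tang_not_in_plane) simp
  \<comment> \<open>Excluded are the member n = 0, where \<open>gcub\<close> is not controlled by
    the cuspidal cubic; Q = 0, where the image of \<open>u n\<close> would vanish; P = 0, where
    \<open>u n\<close> is \<open>cpt s\<close>; \<open>Bs\<close>, where \<open>tang\<close> may be
    \<open>cpt s\<close>; and \<open>B t\<close>, where \<open>u n\<close> may be the base point
    \<open>cpt t\<close>.\<close>
  define I where "I = UNIV - ({0} \<union> {n. Q n = 0} \<union> {n. P n = 0} \<union> Bs \<union> (\<Union>t\<in>insert 0 R - {s}. B t))"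
  have "infinite I"
    unfolding I_def using infinite_alg_closed finQ finP finBs finB finite_R by (intro Diff_infinite_finite) auto
  moreover have nz: "u n \<noteq> 0" and nb: "cusp_cubic (u n) \<noteq> 0" if n: "n \<in> I" for n
  proof -
    have n': "n \<noteq> 0" "Q n \<noteq> 0" "P n \<noteq> 0" "n \<notin> Bs" "\<And>t. t \<in> insert 0 R \<Longrightarrow> t \<noteq> s \<Longrightarrow> n \<notin> B t"
      using n by (auto simp: I_def)
    have np: "\<not> par (cpt s) (tang a n 1)"
    proof
      assume "par (cpt s) (tang a n 1)"
      then have "- s * tang a n 1 $ 1 + 1 * tang a n 1 $ 2 + 0 * tang a n 1 $ 3 = 0" by (simp add: par_3)
      then show False using n'(4) unfolding Bs_def by blast
    qed
    show un: "u n \<noteq> 0"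
    proof
      assume "u n = 0"
      then have "Q n *s cpt s + (- P n) *s tang a n 1 = 0" by (simp add: u vec_eq_iff)
      from not_par_indep(1)[OF np this] show False using n'(2) by simp
    qed
    show "cusp_cubic (u n) \<noteq> 0"
    proof
      assume c: "cusp_cubic (u n) = 0"
      have "pen a n 1 (u n) = 0" unfolding u_def by (rule pen_third_pt[OF base])
      then have "gcub a (u n) = 0" using c n'(1) by (simp add: pen_def)
      then obtain k t where t: "k \<noteq> 0" "t \<in> insert 0 R" "u n = k *s cpt t"
        using base_points[OF c _ un] by blast
      show False
      proof (cases "t = s")
        case True
        have "(Q n - k) *s cpt s + (- P n) *s tang a n 1 = 0"
          using t(3) unfolding u True by (simp add: vec_eq_iff algebra_simps)
        from not_par_indep(2)[OF np this] show False using n'(3) by simp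
      next
        case False
        have e: "P n *s tang a n 1 = Q n *s cpt s - k *s cpt t"
          using t(3) unfolding u by (simp add: vec_eq_iff algebra_simps)
        have "det3 (P n *s tang a n 1) (cpt s) (cpt t) = 0"
          unfolding e by (simp add: det3_def algebra_simps)
        then have "P n * det3 (tang a n 1) (cpt s) (cpt t) = 0" by (simp add: det3_def algebra_simps)
        then show False using n'(3) n'(5)[OF t(2) False] by (simp add: B_def)
      qed
    qed
  qed
  have g: "gcub a (u n) * n = a 0 * cusp_cubic (u n)" for n
    using pen_third_pt[OF base[of n]] by (simp add: pen_def u_def algebra_simps)
  moreover have "\<not> par (u m) (u n)" if mn: "m \<in> I" "n \<in> I" "m \<noteq> n" for m n
  proof
    assume "par (u m) (u n)"
    then obtain c where c: "u m = c *s u n" using nz[OF mn(2)] by (rule par_scaleE)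
    have "c \<noteq> 0" using c nz[OF mn(1)] by auto
    \<comment> \<open>Off the base points a point determines the parameter of its member, so
      parallel vectors would give m = n.\<close>
    have "c ^ 3 * (gcub a (u n) * m) = c ^ 3 * (gcub a (u n) * n)"
      using g[of m] unfolding c gcub_scale cusp_scale g[of n] by (simp add: algebra_simps)
    then have "gcub a (u n) = 0" using \<open>c \<noteq> 0\<close> mn(3) by simp
    then show False using g[of n] nb[OF mn(2)] a_0_nonzero by simp
  qed
  moreover have "\<exists>k. k \<noteq> 0 \<and> bert a (u n) = k *s cpt s" if n: "n \<in> I" for n
  proof -
    have n': "n \<noteq> 0" "Q n \<noteq> 0" using n by (auto simp: I_def)
    define k where "k = gcub a (u n)"
    have k: "k \<noteq> 0" using g[of n] nb[OF n] a_0_nonzero by (auto simp: k_def)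
    have "bert a (u n) = third_pt a (k * n) (k * 1) (u n)" unfolding bert_def k_def using g[of n] by simp
    also have "\<dots> = k ^ 9 *s ((Q n) ^ 3 *s cpt s)"
      unfolding third_pt_scale u_def third_pt_involution[OF base] Q_def ..
    finally show ?thesis using k n'(2) by (intro exI[of _ "k ^ 9 * Q n ^ 3"]) (simp add: vector_smult_assoc)
  qed
  ultimately show ?thesis using nz by (intro exI[of _ I] exI[of _ u]) blast
qed

end

text \<open>The curve contracted to a base point is mapped to a curve contracted by the other involution,
  whose fibres off its base points are finite.\<close>

lemma conj_points:
  fixes M M' :: "'a::alg_closed_field ^ 3 ^ 3"
  assumes E: "eight_points R" and E': "eight_points R'"
    and inv: "M ** M' = mat 1" "M' ** M = mat 1"
    and conj: "\<And>v. par (bert (coeff (eight_points.fpoly R')) v) (M *v bert (coeff (eight_points.fpoly R)) (M' *v v))"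
    and s: "s \<in> R" and two: "(2 :: 'a) = 0 \<longrightarrow> coeff (eight_points.fpoly R) 5 \<noteq> 0 \<longrightarrow>
      coeff (eight_points.fpoly R) 5 * s\<^sup>2 + coeff (eight_points.fpoly R) 3 \<noteq> 0"
  shows "\<exists>s'\<in>insert 0 R'. \<exists>c. c \<noteq> 0 \<and> M *v cpt s = c *s cpt s'"
proof -
  interpret E: eight_points R by (rule E)
  interpret E': eight_points R' by (rule E')
  define h where "h v = M *v bert E.a (M' *v v)" for v
  have MM: "M *v (M' *v v) = v" "M' *v (M *v v) = v" for v
    using inv by (simp_all add: matrix_vector_mul_assoc)
  have lin: "M *v (c *s v) = c *s (M *v v)" "M' *v (c *s v) = c *s (M' *v v)" for c v
    by (simp_all add: vec_eq_iff matrix_vector_mult_def sum_distrib_left mult_ac)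
  define H where "H = sub_triple (sub_triple (lin_triple M) (bert_triple E.a)) (lin_triple M')"
  have H: "evp H v = h v" for v
    unfolding H_def id_hom.evt_sub evp_lin id_hom.evt_bert h_def ..
  define b where "b = bert_triple E'.a"
  have b: "evp b v = bert E'.a v" for v unfolding b_def id_hom.evt_bert ..
  have "rat_triple b" unfolding b_def by (rule bert_triple_nonzero[of E'.a, OF infinite_alg_closed E'.a_0_nonzero])
  then obtain i where i: "b $ i \<noteq> 0" using rat_triple_component by blast
  \<comment> \<open>Where \<open>bert\<close> vanishes, \<open>conj\<close> says nothing about
    \<open>h\<close>. The identities for \<open>h\<close> are therefore proved off the zeros of one
    component and extended by density.\<close>
  have prp: "\<exists>c. h v = c *s bert E'.a v" if "evh (\<lambda>x. x) (b $ i) v \<noteq> 0" for v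
  proof -
    have "bert E'.a v \<noteq> 0" using that b by (metis evt_nth zero_index)
    then show ?thesis using par_scaleE[OF par_sym[OF conj]] by (metis h_def)
  qed
  have h1: "cusp_cubic v * gcub E'.a (h v) = gcub E'.a v * cusp_cubic (h v)" for v
  proof -
    have "cusp_cubic X3 * gcub (poly_const E'.a) H - gcub (poly_const E'.a) X3 * cusp_cubic H = 0"
    proof (rule evh_zeroI[OF infinite_alg_closed i])
      fix v assume "evh (\<lambda>x. x) (b $ i) v \<noteq> 0"
      then obtain c where c: "h v = c *s bert E'.a v" using prp by blast
      have "cusp_cubic v * gcub E'.a (bert E'.a v) = gcub E'.a v * cusp_cubic (bert E'.a v)"
        using bert_member[of E'.a v] E'.a_0_nonzero by (metis mult_left_cancel)
      then have "cusp_cubic v * gcub E'.a (h v) = gcub E'.a v * cusp_cubic (h v)"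
        unfolding c gcub_scale cusp_scale by (simp add: mult.left_commute)
      then show "evh (\<lambda>x. x) (cusp_cubic X3 * gcub (poly_const E'.a) H - gcub (poly_const E'.a) X3 * cusp_cubic H) v = 0"
        by (simp add: id_hom.evh_cusp id_hom.evh_gcub H)
    qed
    from arg_cong[OF this, of "\<lambda>F. evh (\<lambda>x. x) F v"] show ?thesis
      by (simp add: id_hom.evh_cusp id_hom.evh_gcub H)
  qed
  have h2: "det3 v (h v) (tang E'.a (E'.a 0 * cusp_cubic v) (gcub E'.a v)) = 0" for v
  proof -
    define t where "t = tang (poly_const E'.a) (const3 (E'.a 0) * cusp_cubic X3) (gcub (poly_const E'.a) X3)"
    have t: "evp t v = tang E'.a (E'.a 0 * cusp_cubic v) (gcub E'.a v)" for v
    proof -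
      interpret e: ring_hom3 "\<lambda>F. evh (\<lambda>x. x) F v" by (rule id_hom.evh_ring_hom)
      have "evp t v = vmap (\<lambda>F. evh (\<lambda>x. x) F v) t" by (simp add: vec_eq_iff)
      then show ?thesis unfolding t_def by (simp add: e.h_tang e.h_cusp e.h_gcub e.hom)
    qed
    have ev: "evh (\<lambda>x. x) (det3 X3 H t) v = det3 v (h v) (evp t v)" for v
      unfolding H[symmetric] by (simp add: det3_def)
    have "det3 X3 H t = 0"
    proof (rule evh_zeroI[OF infinite_alg_closed i])
      fix v assume "evh (\<lambda>x. x) (b $ i) v \<noteq> 0"
      then obtain c where c: "h v = c *s bert E'.a v" using prp by blast
      show "evh (\<lambda>x. x) (det3 X3 H t) v = 0"
        unfolding ev t c det3_scale bert_def third_pt_def det3_combination by simp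
    qed
    then have "det3 v (h v) (evp t v) = 0" using ev[of v] by simp
    then show ?thesis unfolding t .
  qed
  obtain I and u :: "'a \<Rightarrow> 'a ^ 3" where "infinite I \<and> (\<forall>n\<in>I. u n \<noteq> 0) \<and> (\<forall>m\<in>I. \<forall>n\<in>I. m \<noteq> n \<longrightarrow> \<not> par (u m) (u n))
      \<and> (\<forall>n\<in>I. \<exists>k. k \<noteq> 0 \<and> bert E.a (u n) = k *s cpt s)"
    using E.contracted[OF s two] by blast
  then have I: "infinite I" "\<And>n. n \<in> I \<Longrightarrow> u n \<noteq> 0"
    "\<And>m n. m \<in> I \<Longrightarrow> n \<in> I \<Longrightarrow> m \<noteq> n \<Longrightarrow> \<not> par (u m) (u n)"
    "\<And>n. n \<in> I \<Longrightarrow> \<exists>k. k \<noteq> 0 \<and> bert E.a (u n) = k *s cpt s" by simp_all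
  define y where "y = M *v cpt s"
  have M0: "M *v v \<noteq> 0" if "v \<noteq> 0" for v
    using that MM(2)[of v] by (metis matrix_vector_mult_0_right)
  have "cusp_cubic y = 0 \<and> gcub E'.a y = 0"
  proof (rule ccontr)
    assume nb: "\<not> (cusp_cubic y = 0 \<and> gcub E'.a y = 0)"
    have "finite I"
    proof (rule E'.finite_fibre[OF nb, of I "\<lambda>n. M *v u n" h])
      show "M *v u n \<noteq> 0" if "n \<in> I" for n using M0 I(2)[OF that] by blast
      show "\<not> par (M *v u m) (M *v u n)" if mn: "m \<in> I" "n \<in> I" "m \<noteq> n" for m n
      proof
        assume "par (M *v u m) (M *v u n)"
        then obtain c where "M *v u m = c *s (M *v u n)" using M0[OF I(2)[OF mn(2)]] by (rule par_scaleE)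
        then have "u m = c *s u n" using MM(2) lin by metis
        then show False using I(3)[OF mn] par_scale(1) by metis
      qed
      show "\<exists>k. k \<noteq> 0 \<and> h (M *v u n) = k *s y" if "n \<in> I" for n
        using I(4)[OF that] unfolding h_def MM y_def by (auto simp: lin)
      show "par (bert E'.a v) (h v)" for v unfolding h_def by (rule conj)
    qed (rule h1 h2)+
    then show False using I(1) by simp
  qed
  moreover have "y \<noteq> 0" unfolding y_def by (rule M0) simp
  ultimately show ?thesis using E'.base_points[of y] unfolding y_def by metis
qed

section \<open>Extending embeddings into the algebraic closure\<close>

text \<open>The graph of an embedding over \<open>'k\<close> of a subring of the algebraic closure. As every element is
  algebraic over \<open>'k\<close>, such a subring is a field.\<close>

definition emb_graph :: "('k::field alg_closure \<times> 'k alg_closure) set \<Rightarrow> bool" where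
  "emb_graph \<Gamma> \<longleftrightarrow> (\<forall>c. (to_ac c, to_ac c) \<in> \<Gamma>) \<and>
     (\<forall>x x' y y'. (x, x') \<in> \<Gamma> \<longrightarrow> (y, y') \<in> \<Gamma> \<longrightarrow> (x + y, x' + y') \<in> \<Gamma> \<and> (x * y, x' * y') \<in> \<Gamma>) \<and>
     (\<forall>y. (0, y) \<in> \<Gamma> \<longrightarrow> y = 0)"

text \<open>The second polynomial is the image of the first under the embedding, applied to the
  coefficients.\<close>

definition pair_polys :: "('a::zero \<times> 'a) set \<Rightarrow> ('a poly \<times> 'a poly) set" where
  "pair_polys \<Gamma> = {(p, p'). \<forall>i. (coeff p i, coeff p' i) \<in> \<Gamma>}"

lemma poly_map_to_ac_algebraic:
  fixes x :: "'k::field alg_closure"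
  obtains p :: "'k poly" where "p \<noteq> 0" "poly (map_poly to_ac p) x = 0"
    "\<And>r :: 'k poly. r \<noteq> 0 \<Longrightarrow> poly (map_poly to_ac r) x = 0 \<Longrightarrow> degree p \<le> degree r"
proof -
  define S where "S = {p :: 'k poly. p \<noteq> 0 \<and> poly (map_poly to_ac p) x = 0}"
  have "\<exists>p. p \<in> S" unfolding S_def using alg_closure_algebraic[of x] by blast
  then obtain p where "p \<in> S" "\<And>r. r \<in> S \<Longrightarrow> degree p \<le> degree r"
    using ex_has_least_nat[of "\<lambda>p. p \<in> S" _ degree] by blast
  then show ?thesis using that by (auto simp: S_def)
qed

context
  fixes \<Gamma> :: "('k::field alg_closure \<times> 'k alg_closure) set"
  assumes emb: "emb_graph \<Gamma>"
begin

lemma eg_const: "(to_ac c, to_ac c) \<in> \<Gamma>"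
  and eg_add: "(x, x') \<in> \<Gamma> \<Longrightarrow> (y, y') \<in> \<Gamma> \<Longrightarrow> (x + y, x' + y') \<in> \<Gamma>"
  and eg_mult: "(x, x') \<in> \<Gamma> \<Longrightarrow> (y, y') \<in> \<Gamma> \<Longrightarrow> (x * y, x' * y') \<in> \<Gamma>"
  and eg_zero: "(0, y) \<in> \<Gamma> \<Longrightarrow> y = 0"
  using emb by (auto simp: emb_graph_def)

lemma eg_0: "(0, 0) \<in> \<Gamma>" and eg_1: "(1, 1) \<in> \<Gamma>"
  using eg_const[of 0] eg_const[of 1] by simp_all

lemma eg_uminus: "(x, x') \<in> \<Gamma> \<Longrightarrow> (- x, - x') \<in> \<Gamma>"
  using eg_mult[OF eg_const[of "- 1"], of x x'] by simp

lemma eg_diff: "(x, x') \<in> \<Gamma> \<Longrightarrow> (y, y') \<in> \<Gamma> \<Longrightarrow> (x - y, x' - y') \<in> \<Gamma>"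
  using eg_add[OF _ eg_uminus, of x x' y y'] by simp

lemma eg_single_valued: "(x, y) \<in> \<Gamma> \<Longrightarrow> (x, y') \<in> \<Gamma> \<Longrightarrow> y = y'"
  using eg_zero[of "y - y'"] eg_diff[of x y x y'] by simp

lemma eg_sum: "(\<And>i. i \<in> A \<Longrightarrow> (f i, g i) \<in> \<Gamma>) \<Longrightarrow> (sum f A, sum g A) \<in> \<Gamma>"
  by (induction A rule: infinite_finite_induct) (auto intro: eg_add eg_0)

lemma eg_poly: "(x, x') \<in> \<Gamma> \<Longrightarrow> (poly (map_poly to_ac p) x, poly (map_poly to_ac p) x') \<in> \<Gamma>"
  by (induction p) (auto simp: map_poly_pCons eg_0 intro!: eg_add eg_mult eg_const)

text \<open>A relation of least degree for x has nonzero constant term, so 1 / x is a polynomial in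
  x over k, and the embedding respects such polynomials.\<close>

lemma eg_inverse:
  assumes "(x, x') \<in> \<Gamma>" "x \<noteq> 0"
  shows "(inverse x, inverse x') \<in> \<Gamma>" "x' \<noteq> 0"
proof -
  obtain p :: "'k poly" where p: "p \<noteq> 0" "poly (map_poly to_ac p) x = 0"
    and least: "\<And>r :: 'k poly. r \<noteq> 0 \<Longrightarrow> poly (map_poly to_ac r) x = 0 \<Longrightarrow> degree p \<le> degree r"
    using poly_map_to_ac_algebraic[of x] by blast
  obtain c r where cr: "p = pCons c r" by (cases p)
  have e: "to_ac c + x * poly (map_poly to_ac r) x = 0" using p(2) by (simp add: cr map_poly_pCons)
  have c: "c \<noteq> 0"
  proof
    assume "c = 0"
    then have r: "r \<noteq> 0" "poly (map_poly to_ac r) x = 0" using p e assms(2) by (auto simp: cr)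
    from least[OF this] r(1) show False by (simp add: cr)
  qed
  define q where "q = smult (- inverse c) r"
  have "poly (map_poly to_ac q) z = - inverse (to_ac c) * poly (map_poly to_ac r) z" for z
    unfolding q_def by (subst map_poly_smult) auto
  then have "x * poly (map_poly to_ac q) x = - inverse (to_ac c) * (x * poly (map_poly to_ac r) x)" by simp
  also have "x * poly (map_poly to_ac r) x = - to_ac c" using e by (simp add: eq_neg_iff_add_eq_0 add.commute)
  finally have 1: "x * poly (map_poly to_ac q) x = 1" using c by simp
  have q: "(poly (map_poly to_ac q) x, poly (map_poly to_ac q) x') \<in> \<Gamma>" by (rule eg_poly[OF assms(1)])
  from eg_mult[OF assms(1) this] have 2: "x' * poly (map_poly to_ac q) x' = 1"
    unfolding 1 using eg_single_valued[OF _ eg_1] by blast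
  then show "x' \<noteq> 0" by auto
  have "inverse x = poly (map_poly to_ac q) x" "inverse x' = poly (map_poly to_ac q) x'"
    using 1 2 by (metis inverse_unique)+
  then show "(inverse x, inverse x') \<in> \<Gamma>" using q by simp
qed

lemma pp_add: "(p, p') \<in> pair_polys \<Gamma> \<Longrightarrow> (r, r') \<in> pair_polys \<Gamma> \<Longrightarrow> (p + r, p' + r') \<in> pair_polys \<Gamma>"
  and pp_diff: "(p, p') \<in> pair_polys \<Gamma> \<Longrightarrow> (r, r') \<in> pair_polys \<Gamma> \<Longrightarrow> (p - r, p' - r') \<in> pair_polys \<Gamma>"
  and pp_mult: "(p, p') \<in> pair_polys \<Gamma> \<Longrightarrow> (r, r') \<in> pair_polys \<Gamma> \<Longrightarrow> (p * r, p' * r') \<in> pair_polys \<Gamma>"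
  and pp_smult: "(c, c') \<in> \<Gamma> \<Longrightarrow> (p, p') \<in> pair_polys \<Gamma> \<Longrightarrow> (smult c p, smult c' p') \<in> pair_polys \<Gamma>"
  and pp_monom: "(c, c') \<in> \<Gamma> \<Longrightarrow> (monom c n, monom c' n) \<in> pair_polys \<Gamma>"
  by (auto simp: pair_polys_def coeff_mult eg_0 intro: eg_add eg_diff eg_mult eg_sum)

lemma pp_map: "(map_poly to_ac p, map_poly to_ac p) \<in> pair_polys \<Gamma>"
  by (auto simp: pair_polys_def coeff_map_poly eg_const)

lemma pp_zero_iff: "(p, p') \<in> pair_polys \<Gamma> \<Longrightarrow> coeff p' i = 0 \<longleftrightarrow> coeff p i = 0"
  using eg_zero eg_inverse(2) unfolding pair_polys_def by (metis (mono_tags, lifting) case_prodD mem_Collect_eq)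

lemma pp_degree: "(p, p') \<in> pair_polys \<Gamma> \<Longrightarrow> degree p' = degree p"
  unfolding degree_def by (simp add: pp_zero_iff)

text \<open>The extension sends r(x) to r'(y). It is well defined because r(x) = 0 makes r a
  multiple of the minimal polynomial p; dividing r by p and r' by p' in parallel transfers this to
  r'(y) = 0.\<close>

lemma extend_step:
  assumes p: "(p, p') \<in> pair_polys \<Gamma>" "lead_coeff p = 1" "poly p x = 0" "poly p' y = 0"
    and least: "\<And>r r'. (r, r') \<in> pair_polys \<Gamma> \<Longrightarrow> r \<noteq> 0 \<Longrightarrow> poly r x = 0 \<Longrightarrow> degree p \<le> degree r"
  obtains \<Delta> where "emb_graph \<Delta>" "\<Gamma> \<subseteq> \<Delta>" "(x, y) \<in> \<Delta>"
proof -
  have key: "poly r' y = 0" if "(r, r') \<in> pair_polys \<Gamma>" "poly r x = 0" for r r'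
    using that
  \<comment> \<open>This measure places the zero remainder below the nonzero constants, whose degree
    is also 0.\<close>
  proof (induction "if r = 0 then 0 else Suc (degree r)" arbitrary: r r' rule: less_induct)
    case less
    show ?case
    proof (cases "r = 0")
      case True
      then have "r' = 0" using pp_zero_iff[OF less.prems(1)] by (simp add: poly_eq_iff)
      then show ?thesis by simp
    next
      case False
      define n where "n = degree r - degree p"
      have dn: "degree r = n + degree p" using least[OF less.prems(1) False less.prems(2)] by (simp add: n_def)
      define c c' where "c = coeff r (degree r)" and "c' = coeff r' (degree r)"
      have cc: "(c, c') \<in> \<Gamma>" using less.prems(1) by (simp add: pair_polys_def c_def c'_def)
      define s s' where "s = r - monom c n * p" and "s' = r' - monom c' n * p'"
      have s: "(s, s') \<in> pair_polys \<Gamma>"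
        unfolding s_def s'_def by (intro pp_diff pp_mult pp_monom less.prems(1) p(1) cc)
      have "s = 0 \<or> degree s < degree r"
      proof (rule disjCI)
        assume "\<not> degree s < degree r"
        have "degree (monom c n * p) \<le> degree r"
          using degree_mult_le[of "monom c n" p] degree_monom_le[of c n] dn by linarith
        then have "degree s \<le> degree r" unfolding s_def by (intro degree_diff_le) auto
        moreover have "coeff s (degree r) = 0"
          unfolding s_def using p(2) by (simp add: coeff_monom_mult dn c_def)
        ultimately show "s = 0"
          using \<open>\<not> degree s < degree r\<close> by (metis leading_coeff_0_iff order_le_neq_trans)
      qed
      then have "poly s' y = 0"
        using False less.prems(2) p(3) by (intro less.hyps[OF _ s]) (auto simp: s_def)
      then show ?thesis using p(4) by (simp add: s'_def)
    qed
  qed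
  define \<Delta> where "\<Delta> = {(poly r x, poly r' y) | r r'. (r, r') \<in> pair_polys \<Gamma>}"
  have in\<Delta>: "(poly r x, poly r' y) \<in> \<Delta>" if "(r, r') \<in> pair_polys \<Gamma>" for r r'
    using that by (auto simp: \<Delta>_def)
  have c: "(z, z') \<in> \<Delta>" if "(z, z') \<in> \<Gamma>" for z z'
    using in\<Delta>[OF pp_monom[OF that, of 0]] by (simp add: poly_monom)
  have "emb_graph \<Delta>"
    unfolding emb_graph_def
  proof (intro conjI allI impI)
    show "(to_ac c, to_ac c) \<in> \<Delta>" for c by (intro c eg_const)
    fix u u' v v' assume "(u, u') \<in> \<Delta>" "(v, v') \<in> \<Delta>"
    then obtain r r' s s' where rs: "(r, r') \<in> pair_polys \<Gamma>" "(s, s') \<in> pair_polys \<Gamma>"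
      and [simp]: "u = poly r x" "u' = poly r' y" "v = poly s x" "v' = poly s' y"
      by (auto simp: \<Delta>_def)
    show "(u + v, u' + v') \<in> \<Delta>" "(u * v, u' * v') \<in> \<Delta>"
      using in\<Delta>[OF pp_add[OF rs]] in\<Delta>[OF pp_mult[OF rs]] by simp_all
  next
    fix z assume "(0, z) \<in> \<Delta>"
    then obtain r r' where "(r, r') \<in> pair_polys \<Gamma>" "poly r x = 0" "z = poly r' y"
      by (auto simp: \<Delta>_def)
    then show "z = 0" using key by simp
  qed
  moreover have "\<Gamma> \<subseteq> \<Delta>" using c by auto
  moreover have "(x, y) \<in> \<Delta>"
    using in\<Delta>[OF pp_monom[OF eg_1, of 1]] by (simp add: poly_monom)
  ultimately show ?thesis by (rule that)
qed

lemma minimal_pair: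
  obtains p p' where "(p, p') \<in> pair_polys \<Gamma>" "lead_coeff p = 1" "poly p x = 0" "degree p > 0"
    "\<And>r r'. (r, r') \<in> pair_polys \<Gamma> \<Longrightarrow> r \<noteq> 0 \<Longrightarrow> poly r x = 0 \<Longrightarrow> degree p \<le> degree r"
proof -
  define S where "S = {(r, r') \<in> pair_polys \<Gamma>. r \<noteq> 0 \<and> poly r x = 0}"
  obtain q :: "'k poly" where q: "q \<noteq> 0" "poly (map_poly to_ac q) x = 0"
    using alg_closure_algebraic[of x] by blast
  have "map_poly to_ac q \<noteq> 0" using q(1) by (simp add: map_poly_eq_0_iff)
  then have "\<exists>z. z \<in> S" using q(2) pp_map[of q] by (auto simp: S_def)
  then obtain z where z: "z \<in> S" "\<And>w. w \<in> S \<Longrightarrow> degree (fst z) \<le> degree (fst w)"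
    using ex_has_least_nat[of "\<lambda>z. z \<in> S" _ "\<lambda>z. degree (fst z)"] by blast
  obtain r r' where [simp]: "z = (r, r')" by (cases z)
  have r: "(r, r') \<in> pair_polys \<Gamma>" "r \<noteq> 0" "poly r x = 0" using z(1) by (auto simp: S_def)
  define c c' where "c = lead_coeff r" and "c' = coeff r' (degree r)"
  have c: "(c, c') \<in> \<Gamma>" "c \<noteq> 0" using r by (auto simp: pair_polys_def c_def c'_def)
  show ?thesis
  proof (rule that)
    show "(smult (inverse c) r, smult (inverse c') r') \<in> pair_polys \<Gamma>"
      by (rule pp_smult[OF eg_inverse(1)[OF c] r(1)])
    show "lead_coeff (smult (inverse c) r) = 1" using c by (simp add: c_def)
    show "poly (smult (inverse c) r) x = 0" using r by simp
    show "degree (smult (inverse c) r) > 0"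
      using r c by (metis degree_eq_zeroE gr0I inverse_nonzero_iff_nonzero degree_smult_eq pCons_0_0 poly_pCons mult_zero_right add_0_right poly_0)
    show "degree (smult (inverse c) r) \<le> degree s"
      if "(s, s') \<in> pair_polys \<Gamma>" "s \<noteq> 0" "poly s x = 0" for s s'
      using z(2)[of "(s, s')"] that c by (simp add: S_def)
  qed
qed

end

lemma emb_graph_Union:
  assumes "C \<noteq> {}" "\<And>\<Gamma>. \<Gamma> \<in> C \<Longrightarrow> emb_graph \<Gamma>" "\<And>\<Gamma> \<Delta>. \<Gamma> \<in> C \<Longrightarrow> \<Delta> \<in> C \<Longrightarrow> \<Gamma> \<subseteq> \<Delta> \<or> \<Delta> \<subseteq> \<Gamma>"
  shows "emb_graph (\<Union>C)"
  unfolding emb_graph_def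
proof (intro conjI allI impI)
  show "(to_ac c, to_ac c) \<in> \<Union>C" for c
    using assms(1,2) eg_const by blast
  fix x x' y y' assume "(x, x') \<in> \<Union>C" "(y, y') \<in> \<Union>C"
  then obtain \<Gamma> where "\<Gamma> \<in> C" "(x, x') \<in> \<Gamma>" "(y, y') \<in> \<Gamma>" using assms(3) by blast
  then show "(x + y, x' + y') \<in> \<Union>C" "(x * y, x' * y') \<in> \<Union>C"
    using assms(2) eg_add eg_mult by blast+
next
  fix y assume "(0, y) \<in> \<Union>C"
  then show "y = 0" using assms(2) eg_zero by blast
qed

text \<open>A maximal graph is defined everywhere, since otherwise \<open>extend_step\<close>
  enlarges it. It is onto because it maps the finite set of zeros of a polynomial over k injectively
  into itself.\<close>

lemma emb_graph_extends:
  assumes "emb_graph \<Gamma>"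
  obtains \<sigma> where "\<sigma> \<in> abs_galois_group" "\<And>x y. (x, y) \<in> \<Gamma> \<Longrightarrow> \<sigma> x = y"
proof -
  define A where "A = {\<Delta>. emb_graph \<Delta> \<and> \<Gamma> \<subseteq> \<Delta>}"
  have "\<exists>M\<in>A. \<forall>N\<in>A. M \<subseteq> N \<longrightarrow> N = M"
  proof (rule subset_Zorn_nonempty)
    show "A \<noteq> {}" using assms by (auto simp: A_def)
    fix C assume C: "C \<noteq> {}" "subset.chain A C"
    have "C \<subseteq> A" and ch: "\<And>\<Delta> \<Delta>'. \<Delta> \<in> C \<Longrightarrow> \<Delta>' \<in> C \<Longrightarrow> \<Delta> \<subseteq> \<Delta>' \<or> \<Delta>' \<subseteq> \<Delta>"
      using C(2) unfolding subset.chain_def by blast+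
    then have "emb_graph (\<Union>C)"
      by (intro emb_graph_Union[OF C(1)]) (auto simp: A_def)
    moreover obtain \<Delta> where "\<Delta> \<in> C" using C(1) by blast
    then have "\<Gamma> \<subseteq> \<Union>C" using \<open>C \<subseteq> A\<close> unfolding A_def by blast
    ultimately show "\<Union>C \<in> A" by (simp add: A_def)
  qed
  then obtain M where M: "emb_graph M" "\<Gamma> \<subseteq> M" and max: "\<And>N. emb_graph N \<Longrightarrow> M \<subseteq> N \<Longrightarrow> N = M"
    unfolding A_def by auto
  have total: "\<exists>y. (x, y) \<in> M" for x
  proof -
    obtain p p' where p: "(p, p') \<in> pair_polys M" "lead_coeff p = 1" "poly p x = 0" "degree p > 0"
      and least: "\<And>r r'. (r, r') \<in> pair_polys M \<Longrightarrow> r \<noteq> 0 \<Longrightarrow> poly r x = 0 \<Longrightarrow> degree p \<le> degree r"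
      using minimal_pair[OF M(1)] by blast
    have "degree p' > 0" using pp_degree[OF M(1) p(1)] p(4) by simp
    then obtain y where y: "poly p' y = 0" using alg_closed_imp_poly_has_root by blast
    obtain \<Delta> where "emb_graph \<Delta>" "M \<subseteq> \<Delta>" "(x, y) \<in> \<Delta>"
    proof (rule extend_step[OF M(1) p(1-3) y])
      show "degree p \<le> degree r" if "(r, r') \<in> pair_polys M" "r \<noteq> 0" "poly r x = 0" for r r'
        by (rule least[OF that])
    qed (use that in blast)
    then show ?thesis using max by blast
  qed
  define \<sigma> where "\<sigma> x = (SOME y. (x, y) \<in> M)" for x
  have \<sigma>: "(x, \<sigma> x) \<in> M" for x unfolding \<sigma>_def using total by (rule someI_ex)
  have uniq: "\<sigma> x = y" if "(x, y) \<in> M" for x y using eg_single_valued[OF M(1) \<sigma> that] .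
  have add: "\<sigma> (x + y) = \<sigma> x + \<sigma> y" and mult: "\<sigma> (x * y) = \<sigma> x * \<sigma> y" and const: "\<sigma> (to_ac c) = to_ac c"
    for x y c
    by (rule uniq, (rule eg_add[OF M(1)] eg_mult[OF M(1)] eg_const[OF M(1)]); rule \<sigma>)+
  have z: "\<sigma> x = 0 \<longleftrightarrow> x = 0" for x
    using eg_inverse(2)[OF M(1) \<sigma>, of x] const[of 0] by auto
  have inj: "inj \<sigma>"
  proof (rule injI)
    fix x y assume "\<sigma> x = \<sigma> y"
    then have "\<sigma> (x + to_ac (- 1) * y) = 0" unfolding add mult const by simp
    then show "x = y" by (simp add: z)
  qed
  have "surj \<sigma>"
  proof (subst surj_def, rule allI)
    fix y
    obtain q :: "'a poly" where q: "q \<noteq> 0" "poly (map_poly to_ac q) y = 0"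
      using alg_closure_algebraic[of y] by blast
    define Z where "Z = {x. poly (map_poly to_ac q) x = 0}"
    have "map_poly to_ac q \<noteq> 0" using q(1) by (simp add: map_poly_eq_0_iff)
    then have "finite Z" unfolding Z_def by (rule poly_roots_finite)
    moreover have "\<sigma> ` Z \<subseteq> Z"
    proof
      fix w assume "w \<in> \<sigma> ` Z"
      then obtain x where x: "poly (map_poly to_ac q) x = 0" "w = \<sigma> x" by (auto simp: Z_def)
      have "(poly (map_poly to_ac q) x, poly (map_poly to_ac q) w) \<in> M"
        unfolding x(2) by (rule eg_poly[OF M(1) \<sigma>])
      then show "w \<in> Z" using eg_zero[OF M(1)] x(1) by (simp add: Z_def)
    qed
    ultimately have "\<sigma> ` Z = Z" using inj by (metis endo_inj_surj inj_on_subset subset_UNIV)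
    then show "\<exists>x. y = \<sigma> x" using q(2) by (metis (mono_tags, lifting) Z_def imageE mem_Collect_eq)
  qed
  then have "\<sigma> \<in> abs_galois_group" using inj add mult const by (simp add: abs_galois_group_def bij_def)
  then show ?thesis using that uniq M(2) by blast
qed

section \<open>The absolute Galois group\<close>

lemma galois_hom:
  assumes "\<sigma> \<in> abs_galois_group"
  shows galois_add: "\<sigma> (x + y) = \<sigma> x + \<sigma> y" and galois_mult: "\<sigma> (x * y) = \<sigma> x * \<sigma> y"
    and galois_const: "\<sigma> (to_ac c) = to_ac c" and galois_bij: "bij \<sigma>"
    and galois_0: "\<sigma> 0 = 0" and galois_1: "\<sigma> 1 = 1"
proof -
  show *: "\<sigma> (to_ac c) = to_ac c" for c using assms by (auto simp: abs_galois_group_def)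
  show "\<sigma> 0 = 0" "\<sigma> 1 = 1" using *[of 0] *[of 1] by simp_all
qed (use assms in \<open>auto simp: abs_galois_group_def\<close>)

lemma galois_inj: "\<sigma> \<in> abs_galois_group \<Longrightarrow> \<sigma> x = \<sigma> y \<longleftrightarrow> x = y"
  using galois_bij by (auto simp: bij_def inj_def)

lemma galois_uminus: "\<sigma> \<in> abs_galois_group \<Longrightarrow> \<sigma> (- x) = - \<sigma> x"
  using galois_add[of \<sigma> x "- x"] galois_0[of \<sigma>] by (simp add: eq_neg_iff_add_eq_0 add.commute)

lemma galois_id: "(\<lambda>x. x) \<in> abs_galois_group"
  by (simp add: abs_galois_group_def bij_def)

lemma galois_comp: "\<sigma> \<in> abs_galois_group \<Longrightarrow> \<tau> \<in> abs_galois_group \<Longrightarrow> \<sigma> \<circ> \<tau> \<in> abs_galois_group"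
  by (auto simp: abs_galois_group_def intro: bij_comp)

lemma galois_inv: "\<sigma> \<in> abs_galois_group \<Longrightarrow> inv_into UNIV \<sigma> \<in> abs_galois_group"
proof -
  assume s: "\<sigma> \<in> abs_galois_group"
  have i: "inv_into UNIV \<sigma> (\<sigma> x) = x" "\<sigma> (inv_into UNIV \<sigma> x) = x" for x
    using galois_bij[OF s] by (simp_all add: bij_def surj_f_inv_f)
  have "inv_into UNIV \<sigma> (x + y) = inv_into UNIV \<sigma> x + inv_into UNIV \<sigma> y" "inv_into UNIV \<sigma> (x * y) = inv_into UNIV \<sigma> x * inv_into UNIV \<sigma> y" for x y
    by (rule iffD1[OF galois_inj[OF s]]; simp add: i galois_add[OF s] galois_mult[OF s])+
  moreover have "inv_into UNIV \<sigma> (to_ac c) = to_ac c" for c using i(1)[of "to_ac c"] galois_const[OF s] by simp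
  ultimately show ?thesis using galois_bij[OF s] by (simp add: abs_galois_group_def bij_imp_bij_inv)
qed

lemma galois_poly:
  assumes "\<sigma> \<in> abs_galois_group"
  shows "\<sigma> (poly p x) = poly (map_poly \<sigma> p) (\<sigma> x)"
  by (induction p) (auto simp: map_poly_pCons galois_hom[OF assms])

lemma galois_poly_k:
  assumes "\<sigma> \<in> abs_galois_group"
  shows "\<sigma> (poly (map_poly to_ac h) x) = poly (map_poly to_ac h) (\<sigma> x)"
  by (induction h) (auto simp: map_poly_pCons galois_hom[OF assms])

text \<open>An element outside k has a minimal polynomial of degree at least 2, which is separable
  as k is perfect; the embedding that moves x to a second zero extends to an automorphism.\<close>

lemma fixed_by_galois:
  fixes x :: "'k::field alg_closure"
  assumes perf: "perfect_field TYPE('k)" and fixed: "\<And>\<sigma>. \<sigma> \<in> abs_galois_group \<Longrightarrow> \<sigma> x = x"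
  shows "x \<in> range to_ac"
proof (rule ccontr)
  assume x: "x \<notin> range to_ac"
  define \<Gamma> where "\<Gamma> = {(to_ac c, to_ac c) | c :: 'k. True}"
  have \<Gamma>: "emb_graph \<Gamma>"
    unfolding emb_graph_def \<Gamma>_def by (auto simp flip: to_ac_add to_ac_mult)
  obtain p p' where p: "(p, p') \<in> pair_polys \<Gamma>" "lead_coeff p = 1" "poly p x = 0" "degree p > 0"
    and least: "\<And>r r'. (r, r') \<in> pair_polys \<Gamma> \<Longrightarrow> r \<noteq> 0 \<Longrightarrow> poly r x = 0 \<Longrightarrow> degree p \<le> degree r"
    using minimal_pair[OF \<Gamma>] by blast
  have pc: "\<exists>c. coeff p i = to_ac c \<and> coeff p' i = to_ac c" for i
    using p(1) by (auto simp: pair_polys_def \<Gamma>_def)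
  have "coeff p i = coeff p' i" "coeff p i \<in> range to_ac" for i
    using pc[of i] by auto
  then have [simp]: "p' = p" and rng: "\<And>i. coeff p i \<in> range to_ac" by (auto simp: poly_eq_iff)
  define h where "h = map_poly of_ac p"
  have h: "p = map_poly to_ac h"
    by (rule poly_eqI) (use rng in \<open>simp add: h_def coeff_map_poly to_ac_of_ac\<close>)
  have dmap: "degree (map_poly to_ac g) = degree g" for g :: "'k poly"
    by (rule degree_map_poly) simp
  have irr: "irreducible h"
  proof (rule irreducibleI)
    show "h \<noteq> 0" using p(2) h by auto
    show "\<not> h dvd 1" using p(4) by (auto simp: h dmap is_unit_iff_degree[OF \<open>h \<noteq> 0\<close>])
    fix g1 g2 assume g: "h = g1 * g2"
    have nz: "g1 \<noteq> 0" "g2 \<noteq> 0" using \<open>h \<noteq> 0\<close> g by auto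
    have "degree h = degree g1 + degree g2" unfolding g using nz by (rule degree_mult_eq)
    moreover have "p = map_poly to_ac g1 * map_poly to_ac g2"
      unfolding h g by (rule poly_eqI) (simp add: coeff_map_poly coeff_mult to_ac_sum)
    then have "poly (map_poly to_ac g1) x = 0 \<or> poly (map_poly to_ac g2) x = 0" using p(3) by auto
    then have "degree h \<le> degree g1 \<or> degree h \<le> degree g2"
      using least[OF pp_map[OF \<Gamma>]] nz by (auto simp: h dmap map_poly_eq_0_iff)
    ultimately have "degree g1 = 0 \<or> degree g2 = 0" by auto
    then show "g1 dvd 1 \<or> g2 dvd 1" using nz by (auto simp: is_unit_iff_degree)
  qed
  then have sqf: "rsquarefree p" using perf by (auto simp: perfect_field_def separable_poly_def h)
  obtain r where r: "p = [:- x, 1:] * r" using p(3) by (auto simp: poly_eq_0_iff_dvd)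
  have r0: "r \<noteq> 0" using p(4) r by auto
  have "degree r > 0"
  proof (rule ccontr)
    assume "\<not> degree r > 0"
    then obtain e where "r = [:e:]" by (metis degree_eq_zeroE gr0I)
    then have "e = 1" "coeff p 0 = - (x * e)" using p(2) r r0 by (auto split: if_splits)
    then have "x = - coeff p 0" by simp
    moreover obtain c where "coeff p 0 = to_ac c" using rng[of 0] by blast
    ultimately have "x = to_ac (- c)" by simp
    then show False using x by blast
  qed
  then obtain y where y: "poly r y = 0" using alg_closed_imp_poly_has_root by blast
  have "poly r x \<noteq> 0"
  proof
    assume "poly r x = 0"
    then obtain s where s: "r = [:- x, 1:] * s" by (auto simp: poly_eq_0_iff_dvd)
    have nz: "[:- x, 1:] * s \<noteq> 0" "[:- x, 1:] * ([:- x, 1:] * s) \<noteq> 0"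
      using r0 p(4) unfolding r s by auto
    have "order x p = order x [:- x, 1:] + order x ([:- x, 1:] * s)"
      unfolding r s by (rule order_mult[OF nz(2)])
    also have "order x ([:- x, 1:] * s) = order x [:- x, 1:] + order x s" by (rule order_mult[OF nz(1)])
    finally have "order x p = order x [:- x, 1:] + (order x [:- x, 1:] + order x s)" .
    moreover have "order x [:- x, 1:] = 1" using order_power_n_n[of x 1] by (simp only: power_one_right)
    ultimately have "order x p \<ge> 2" by simp
    moreover have "order x p = 0 \<or> order x p = 1" using sqf unfolding rsquarefree_def by blast
    ultimately show False by linarith
  qed
  then have "y \<noteq> x" using y by auto
  moreover have "poly p y = 0" using y by (simp add: r)
  then have y': "poly p' y = 0" by simp
  obtain \<Delta> where "emb_graph \<Delta>" "(x, y) \<in> \<Delta>"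
  proof (rule extend_step[OF \<Gamma> p(1-3) y'])
    show "degree p \<le> degree r" if "(r, r') \<in> pair_polys \<Gamma>" "r \<noteq> 0" "poly r x = 0" for r r'
      by (rule least[OF that])
  qed (use that in blast)
  then obtain \<sigma> where "\<sigma> \<in> abs_galois_group" "\<sigma> x = y"
    using emb_graph_extends by blast
  ultimately show False using fixed by auto
qed

section \<open>Orbits and a generator of degree eight\<close>

definition orb :: "'k::field alg_closure \<Rightarrow> 'k alg_closure set" where
  "orb x = (\<lambda>\<sigma>. \<sigma> x) ` abs_galois_group"

lemma orb_self: "x \<in> orb x"
  unfolding orb_def by (rule image_eqI[OF _ galois_id]) simp

lemma orb_galois: "\<sigma> \<in> abs_galois_group \<Longrightarrow> y \<in> orb x \<Longrightarrow> \<sigma> y \<in> orb x"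
proof -
  assume s: "\<sigma> \<in> abs_galois_group" and "y \<in> orb x"
  then obtain \<tau> where t: "\<tau> \<in> abs_galois_group" "y = \<tau> x" by (auto simp: orb_def)
  show "\<sigma> y \<in> orb x"
    unfolding orb_def t(2) by (rule image_eqI[OF _ galois_comp[OF s t(1)]]) simp
qed

lemma galois_image_orb: "\<sigma> \<in> abs_galois_group \<Longrightarrow> \<sigma> ` orb x = orb x"
proof
  assume s: "\<sigma> \<in> abs_galois_group"
  show "\<sigma> ` orb x \<subseteq> orb x" using orb_galois[OF s] by auto
  show "orb x \<subseteq> \<sigma> ` orb x"
  proof
    fix y assume "y \<in> orb x"
    then have "inv_into UNIV \<sigma> y \<in> orb x" by (rule orb_galois[OF galois_inv[OF s]])
    moreover have "y = \<sigma> (inv_into UNIV \<sigma> y)" using galois_bij[OF s] by (simp add: bij_def surj_f_inv_f)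
    ultimately show "y \<in> \<sigma> ` orb x" by blast
  qed
qed

lemma orb_bound:
  fixes h :: "'k::field poly"
  assumes "h \<noteq> 0" "poly (map_poly to_ac h) x = 0"
  shows "finite (orb x)" "card (orb x) \<le> degree h"
proof -
  have nz: "map_poly to_ac h \<noteq> 0" using assms(1) by (simp add: map_poly_eq_0_iff)
  have sub: "orb x \<subseteq> {y. poly (map_poly to_ac h) y = 0}"
  proof
    fix y assume "y \<in> orb x"
    then obtain \<sigma> where s: "\<sigma> \<in> abs_galois_group" "y = \<sigma> x" by (auto simp: orb_def)
    have "poly (map_poly to_ac h) y = \<sigma> (poly (map_poly to_ac h) x)"
      unfolding s(2) by (rule galois_poly_k[OF s(1), symmetric])
    then show "y \<in> {y. poly (map_poly to_ac h) y = 0}" using assms(2) galois_0[OF s(1)] by simp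
  qed
  then show "finite (orb x)" using poly_roots_finite[OF nz] finite_subset by blast
  have "card (orb x) \<le> degree (map_poly to_ac h)"
    using card_mono[OF poly_roots_finite[OF nz] sub] card_poly_roots_bound[OF nz] by simp
  then show "card (orb x) \<le> degree h" by (simp add: degree_map_poly)
qed

lemma finite_orb: "finite (orb x)"
  using alg_closure_algebraic[of x] orb_bound(1) by blast

text \<open>The Lagrange polynomial that takes the conjugates of x to the corresponding conjugates
  of y is invariant under the Galois group, so its coefficients lie in k.\<close>

lemma galois_interpolation:
  fixes x y :: "'k::field alg_closure"
  assumes perf: "perfect_field TYPE('k)"
    and stab: "\<And>\<sigma>. \<sigma> \<in> abs_galois_group \<Longrightarrow> \<sigma> x = x \<Longrightarrow> \<sigma> y = y"
  obtains h :: "'k poly" where "degree h < card (orb x)" "poly (map_poly to_ac h) x = y"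
proof -
  define n where "n = card (orb x)"
  have n: "n > 0" using finite_orb[of x] orb_self[of x] by (auto simp: n_def card_gt_0_iff)
  \<comment> \<open>The choice of the automorphism is immaterial: by \<open>stab\<close>, two that
    agree at x agree at y.\<close>
  define e where "e r = (SOME \<sigma>. \<sigma> \<in> abs_galois_group \<and> \<sigma> x = r) y" for r
  have e: "e (\<sigma> x) = \<sigma> y" if s: "\<sigma> \<in> abs_galois_group" for \<sigma>
  proof -
    define \<tau> where "\<tau> = (SOME \<tau>. \<tau> \<in> abs_galois_group \<and> \<tau> x = \<sigma> x)"
    have t: "\<tau> \<in> abs_galois_group" "\<tau> x = \<sigma> x"
      unfolding \<tau>_def using someI[of "\<lambda>\<tau>. \<tau> \<in> abs_galois_group \<and> \<tau> x = \<sigma> x" \<sigma>] s by auto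
    have i: "inv_into UNIV \<sigma> (\<sigma> z) = z" "\<sigma> (inv_into UNIV \<sigma> z) = z" for z
      using galois_bij[OF s] by (simp_all add: bij_def surj_f_inv_f)
    have "(inv_into UNIV \<sigma> \<circ> \<tau>) y = y"
      by (rule stab[OF galois_comp[OF galois_inv[OF s] t(1)]]) (simp add: t i)
    then have "\<tau> y = \<sigma> y" using i(2) by (metis comp_apply)
    then show ?thesis by (simp add: e_def \<tau>_def)
  qed
  define H where "H = (\<Sum>r\<in>orb x. smult (e r / (\<Prod>s\<in>orb x - {r}. r - s)) (\<Prod>s\<in>orb x - {r}. [:- s, 1:]))"
  have fin: "finite (orb x)" by (rule finite_orb)
  have H: "poly H t = e t" if t: "t \<in> orb x" for t
  proof -
    have "poly H t = (\<Sum>r\<in>orb x. if r = t then e t else 0)"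
      unfolding H_def poly_sum
    proof (intro sum.cong refl)
      fix r assume "r \<in> orb x"
      have "(\<Prod>s\<in>orb x - {t}. t - s) \<noteq> 0" using fin by auto
      moreover have "(\<Prod>s\<in>orb x - {r}. t - s) = 0" if "r \<noteq> t" using that t fin by auto
      ultimately show "poly (smult (e r / (\<Prod>s\<in>orb x - {r}. r - s)) (\<Prod>s\<in>orb x - {r}. [:- s, 1:])) t
         = (if r = t then e t else 0)"
        by (auto simp: poly_prod)
    qed
    then show ?thesis using t fin by simp
  qed
  have dH: "degree H \<le> n - 1"
    unfolding H_def
  proof (rule degree_sum_le[OF fin])
    fix r assume "r \<in> orb x"
    then have "degree (\<Prod>s\<in>orb x - {r}. [:- s, 1:]) = n - 1"
      using fin by (subst degree_prod_sum_eq) (auto simp: n_def)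
    then show "degree (smult (e r / (\<Prod>s\<in>orb x - {r}. r - s)) (\<Prod>s\<in>orb x - {r}. [:- s, 1:])) \<le> n - 1"
      using degree_smult_le by metis
  qed
  have "map_poly \<sigma> H = H" if s: "\<sigma> \<in> abs_galois_group" for \<sigma>
  proof (rule ccontr)
    assume "map_poly \<sigma> H \<noteq> H"
    then have nz: "map_poly \<sigma> H - H \<noteq> 0" by simp
    have dmap: "degree (map_poly \<sigma> H) \<le> n - 1"
      using dH by (intro degree_le) (simp add: coeff_map_poly coeff_eq_0 galois_0[OF s])
    have "orb x \<subseteq> {z. poly (map_poly \<sigma> H - H) z = 0}"
    proof
      fix z assume "z \<in> orb x"
      then obtain w where w: "w \<in> orb x" "z = \<sigma> w" using galois_image_orb[OF s] by blast
      then obtain \<tau> where t: "\<tau> \<in> abs_galois_group" "w = \<tau> x" by (auto simp: orb_def)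
      have "poly (map_poly \<sigma> H) z = \<sigma> (e w)" using galois_poly[OF s, of H w] w H by simp
      also have "\<dots> = e z" using e[OF t(1)] e[OF galois_comp[OF s t(1)]] t w by simp
      also have "\<dots> = poly H z" using H \<open>z \<in> orb x\<close> by simp
      finally show "z \<in> {z. poly (map_poly \<sigma> H - H) z = 0}" by simp
    qed
    then have "n \<le> card {z. poly (map_poly \<sigma> H - H) z = 0}"
      unfolding n_def by (intro card_mono poly_roots_finite nz)
    also have "\<dots> \<le> degree (map_poly \<sigma> H - H)" by (rule card_poly_roots_bound[OF nz])
    also have "\<dots> \<le> n - 1" using dH dmap by (intro degree_diff_le) auto
    finally show False using n by simp
  qed
  then have "\<sigma> (coeff H i) = coeff H i" if "\<sigma> \<in> abs_galois_group" for \<sigma> i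
    using that galois_0[OF that] by (metis coeff_map_poly)
  then have rng: "coeff H i \<in> range to_ac" for i using fixed_by_galois[OF perf] by blast
  define h where "h = map_poly of_ac H"
  have h: "H = map_poly to_ac h"
    by (rule poly_eqI) (use rng in \<open>simp add: h_def coeff_map_poly to_ac_of_ac\<close>)
  have "degree h = degree H" unfolding h by (simp add: degree_map_poly)
  then have "degree h < card (orb x)" using dH n by (simp add: n_def)
  moreover have "poly (map_poly to_ac h) x = y"
    using H[OF orb_self] e[OF galois_id] h by simp
  ultimately show ?thesis by (rule that)
qed

lemma power_relation:
  fixes x :: "'k::field alg_closure"
  assumes dim: "vector_space.dim (\<lambda>(c::'k) x. to_ac c * x) L = n" "n > 0"
    and pow: "\<And>i. x ^ i \<in> L"
  obtains h :: "'k poly" where "h \<noteq> 0" "degree h \<le> n" "poly (map_poly to_ac h) x = 0"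
proof -
  interpret V: vector_space "\<lambda>(c::'k) x. to_ac c * x"
    by unfold_locales (simp_all add: algebra_simps)
  show ?thesis
  \<comment> \<open>If two of the powers coincide, they form too small a set for a count of
    dimensions, but their equality is already a relation.\<close>
  proof (cases "inj_on (\<lambda>i. x ^ i) {..n}")
    case False
    then obtain i j where ij: "i \<le> n" "j \<le> n" "i \<noteq> j" "x ^ i = x ^ j" by (auto simp: inj_on_def)
    define h :: "'k poly" where "h = monom 1 i - monom 1 j"
    have "coeff h i = 1" using ij by (simp add: h_def)
    then have "h \<noteq> 0" by auto
    moreover have "degree h \<le> n"
      unfolding h_def using ij degree_monom_le[of "1::'k" i] degree_monom_le[of "1::'k" j]
      by (intro degree_diff_le) auto
    moreover have "map_poly to_ac h = monom 1 i - monom 1 j"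
      by (rule poly_eqI) (auto simp: h_def coeff_map_poly)
    then have "poly (map_poly to_ac h) x = 0" using ij by (simp add: poly_monom)
    ultimately show ?thesis by (rule that)
  next
    case True
    define S where "S = (\<lambda>i. x ^ i) ` {..n}"
    have S: "card S = Suc n" "finite S" using True by (simp_all add: S_def card_image)
    have "V.dependent S"
    proof (rule ccontr)
      assume ind: "\<not> V.dependent S"
      obtain B where B: "B \<subseteq> L" "\<not> V.dependent B" "L \<subseteq> V.span B" "card B = n"
        using V.basis_exists[of L] dim(1) by metis
      \<comment> \<open>A positive dimension is a genuine one: the value 0 also stands for the
        absence of a finite basis.\<close>
      have fB: "finite B" using B(4) dim(2) by (intro card_ge_0_finite) simp
      have "S \<subseteq> V.span B" using B(3) pow by (auto simp: S_def)
      then have "card S \<le> card B" using V.independent_span_bound[OF fB ind] by simp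
      then show False using S B by simp
    qed
    then obtain u where u: "\<exists>v\<in>S. u v \<noteq> 0" "(\<Sum>v\<in>S. to_ac (u v) * v) = 0"
      using V.dependent_finite[OF S(2)] by auto
    define h where "h = (\<Sum>i\<le>n. monom (u (x ^ i)) i)"
    have ch: "coeff h i = (if i \<le> n then u (x ^ i) else 0)" for i
    proof -
      have "coeff h i = (\<Sum>j\<le>n. if j = i then u (x ^ i) else 0)"
        unfolding h_def coeff_sum by (intro sum.cong) auto
      then show ?thesis by simp
    qed
    obtain i where "i \<le> n" "u (x ^ i) \<noteq> 0" using u(1) by (auto simp: S_def)
    then have "coeff h i \<noteq> 0" by (simp add: ch)
    then have "h \<noteq> 0" by auto
    moreover have "degree h \<le> n" by (intro degree_le) (simp add: ch)
    moreover have "poly (map_poly to_ac h) x = 0"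
    proof -
      have "map_poly to_ac h = (\<Sum>i\<le>n. monom (to_ac (u (x ^ i))) i)"
        by (rule poly_eqI) (simp add: coeff_map_poly ch coeff_sum)
      then have "poly (map_poly to_ac h) x = (\<Sum>i\<le>n. to_ac (u (x ^ i)) * x ^ i)"
        by (simp add: poly_sum poly_monom)
      also have "\<dots> = (\<Sum>v\<in>S. to_ac (u v) * v)"
        unfolding S_def by (simp add: sum.reindex[OF True])
      finally show ?thesis using u(2) by simp
    qed
    ultimately show ?thesis by (rule that)
  qed
qed

text \<open>A primitive element by counting conjugates. If an automorphism fixed x and moved some y
  in \<open>L\<close>, then x + c y would have more conjugates than x for almost all c in k. So for
  an x with the most conjugates \<open>galois_interpolation\<close> expresses all of
  \<open>L\<close> by powers of x, and the degree is the number of conjugates.\<close>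

lemma generator_of_degree:
  fixes L :: "'k::field alg_closure set"
  assumes inf: "infinite (UNIV :: 'k set)" and perf: "perfect_field TYPE('k)"
    and L: "intermediate_field L" and dim: "ext_degree L = n" "n > 0"
  obtains x :: "'k alg_closure" where "card (orb x) = n"
proof -
  interpret V: vector_space "\<lambda>(c::'k) x. to_ac c * x"
    by unfold_locales (simp_all add: algebra_simps)
  have Lc: "to_ac c \<in> L" for c using L by (auto simp: intermediate_field_def)
  have Ld: "x - y \<in> L" and Lm: "x * y \<in> L" if "x \<in> L" "y \<in> L" for x y
    using L that by (auto simp: intermediate_field_def)
  have La: "x + y \<in> L" if "x \<in> L" "y \<in> L" for x y
    using Ld[OF that(1) Ld[OF Lc[of 0] that(2)]] by simp
  have Lp: "x ^ i \<in> L" if "x \<in> L" for x i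
    using that Lc[of 1] by (induction i) (auto intro: Lm)
  have dim': "vector_space.dim (\<lambda>(c::'k) x. to_ac c * x) L = n" using dim(1) by (simp add: ext_degree_def)
  have bound: "card (orb x) \<le> n" if x: "x \<in> L" for x
  proof -
    obtain h :: "'k poly" where "h \<noteq> 0" "degree h \<le> n" "poly (map_poly to_ac h) x = 0"
      using power_relation[OF dim' dim(2) Lp[OF x]] by blast
    then show ?thesis using orb_bound(2) by fastforce
  qed
  have "0 \<in> L" using Lc[of 0] by simp
  moreover have "\<forall>y. y \<in> L \<longrightarrow> card (orb y) < Suc n" using bound by (simp add: le_imp_less_Suc)
  ultimately have "\<exists>x. x \<in> L \<and> (\<forall>y. y \<in> L \<longrightarrow> card (orb y) \<le> card (orb x))"
    by (rule ex_has_greatest_nat)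
  then obtain x where x: "x \<in> L" and max: "\<And>y. y \<in> L \<Longrightarrow> card (orb y) \<le> card (orb x)"
    by blast
  have stab: "\<sigma> y = y" if y: "y \<in> L" and s: "\<sigma> \<in> abs_galois_group" "\<sigma> x = x" for y \<sigma>
  proof (rule ccontr)
    assume ne: "\<sigma> y \<noteq> y"
    define O2 where "O2 = (\<lambda>\<tau>. (\<tau> x, \<tau> y)) ` abs_galois_group"
    have "O2 \<subseteq> orb x \<times> orb y" by (auto simp: O2_def orb_def)
    then have fin: "finite O2" using finite_orb finite_subset by (metis finite_cartesian_product)
    define bad where "bad p q = {c :: 'k. p \<noteq> q \<and> fst p + to_ac c * snd p = fst q + to_ac c * snd q}"
      for p q :: "'k alg_closure \<times> 'k alg_closure"
    have "finite (bad p q)" for p q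
    proof -
      have "c = d" if "c \<in> bad p q" "d \<in> bad p q" for c d
      proof -
        have pq: "p \<noteq> q" and e: "fst p + to_ac c * snd p = fst q + to_ac c * snd q"
          "fst p + to_ac d * snd p = fst q + to_ac d * snd q"
          using that by (auto simp: bad_def)
        have "(to_ac c - to_ac d) * (snd p - snd q) =
            (fst p + to_ac c * snd p - (fst q + to_ac c * snd q)) - (fst p + to_ac d * snd p - (fst q + to_ac d * snd q))"
          by (simp add: algebra_simps)
        also have "\<dots> = 0" using e by simp
        finally have "c = d \<or> snd p = snd q" by auto
        moreover have "snd p \<noteq> snd q" using pq e(1) by (auto simp: prod_eq_iff)
        ultimately show "c = d" by blast
      qed
      then have "bad p q = {} \<or> (\<exists>c. bad p q = {c})" by blast
      then show ?thesis by auto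
    qed
    then have "finite (\<Union>p\<in>O2. \<Union>q\<in>O2. bad p q)" using fin by blast
    then obtain c where c: "c \<notin> (\<Union>p\<in>O2. \<Union>q\<in>O2. bad p q)" using inf by (metis ex_new_if_finite)
    let ?f = "\<lambda>p. fst p + to_ac c * snd p"
    have inj: "inj_on ?f O2" using c by (fastforce simp: inj_on_def bad_def)
    have "orb (x + to_ac c * y) = ?f ` O2"
      unfolding orb_def O2_def image_image
      by (intro image_cong) (auto simp: galois_add galois_mult galois_const)
    then have "card (orb (x + to_ac c * y)) = card O2" using inj by (simp add: card_image)
    moreover have "x + to_ac c * y \<in> L" by (intro La Lm Lc x y)
    ultimately have "card O2 \<le> card (orb x)" using max by metis
    moreover have f: "fst ` O2 = orb x" by (force simp: O2_def orb_def image_iff)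
    ultimately have "card (fst ` O2) = card O2" using card_image_le[OF fin, of fst] by simp
    then have "inj_on fst O2" by (rule eq_card_imp_inj_on[OF fin])
    moreover have "(x, y) \<in> O2" unfolding O2_def by (rule image_eqI[OF _ galois_id]) simp
    moreover have "(x, \<sigma> y) \<in> O2" unfolding O2_def by (rule image_eqI[OF _ s(1)]) (simp add: s(2))
    ultimately have "y = \<sigma> y" by (force simp: inj_on_def)
    then show False using ne by simp
  qed
  have "n \<le> card (orb x)"
  proof -
    define S where "S = (\<lambda>i. x ^ i) ` {..<card (orb x)}"
    have "L \<subseteq> V.span S"
    proof
      fix y assume y: "y \<in> L"
      obtain h :: "'k poly" where h: "degree h < card (orb x)" "poly (map_poly to_ac h) x = y"
        using galois_interpolation[OF perf, of x y] stab[OF y] by blast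
      have "y = (\<Sum>i\<le>degree h. to_ac (coeff h i) * x ^ i)"
        unfolding h(2)[symmetric] by (simp add: poly_altdef degree_map_poly coeff_map_poly)
      also have "\<dots> \<in> V.span S"
        using h(1) by (intro V.span_sum V.span_scale V.span_base) (auto simp: S_def)
      finally show "y \<in> V.span S" .
    qed
    then have "V.dim L \<le> card S" by (intro V.dim_le_card) (auto simp: S_def)
    also have "card S \<le> card (orb x)" unfolding S_def using card_image_le[of "{..<card (orb x)}" "\<lambda>i. x ^ i"] by simp
    finally show ?thesis using dim' by simp
  qed
  then have "card (orb x) = n" using bound[OF x] by simp
  then show ?thesis by (rule that)
qed

section \<open>Avoiding linear conditions\<close>

abbreviation kval :: "'k::field poly \<Rightarrow> 'k alg_closure \<Rightarrow> 'k alg_closure" where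
  "kval T r \<equiv> poly (map_poly to_ac T) r"

lemma map_poly_to_ac_lin: "map_poly to_ac (T + smult c U) = map_poly to_ac T + smult (to_ac c) (map_poly to_ac U)"
  by (rule poly_eqI) (simp add: coeff_map_poly)

lemma kval_lin: "kval (T + smult c U) r = kval T r + to_ac c * kval U r"
  by (simp add: map_poly_to_ac_lin)

lemma kval_monom: "kval (monom 1 j) r = r ^ j"
proof -
  have "map_poly to_ac (monom (1::'a) j) = monom 1 j" by (rule poly_eqI) (simp add: coeff_map_poly)
  then show ?thesis by (simp add: poly_monom)
qed

text \<open>The vanishing extends from powers to all polynomials; the product of the X - t over t
  other than s isolates \<open>\<mu> s\<close>.\<close>

lemma vandermonde_zero:
  fixes \<mu> :: "'a::field \<Rightarrow> 'a"
  assumes "finite R" "\<And>j. (\<Sum>r\<in>R. \<mu> r * r ^ j) = 0" "s \<in> R"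
  shows "\<mu> s = 0"
proof -
  have *: "(\<Sum>r\<in>R. \<mu> r * poly g r) = 0" for g
  proof -
    have "(\<Sum>r\<in>R. \<mu> r * poly g r) = (\<Sum>r\<in>R. \<Sum>j\<le>degree g. coeff g j * (\<mu> r * r ^ j))"
      by (simp add: poly_altdef sum_distrib_left mult_ac)
    also have "\<dots> = (\<Sum>j\<le>degree g. coeff g j * (\<Sum>r\<in>R. \<mu> r * r ^ j))"
      by (subst sum.swap) (simp add: sum_distrib_left)
    finally show ?thesis by (simp add: assms(2))
  qed
  define g where "g = (\<Prod>t\<in>R - {s}. [:- t, 1:])"
  have "(\<Sum>r\<in>R. \<mu> r * poly g r) = (\<Sum>r\<in>R. if r = s then \<mu> s * poly g s else 0)"
    using assms(1) by (intro sum.cong) (auto simp: g_def poly_prod)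
  then have "\<mu> s * poly g s = 0" using * assms by simp
  moreover have "poly g s \<noteq> 0" using assms(1) by (auto simp: g_def poly_prod)
  ultimately show ?thesis by simp
qed

text \<open>Constant coefficients give multiples of the trace, which vanish on all elements of trace
  0; these are the conditions that cannot be avoided.\<close>

definition nonconst_on :: "'a set \<Rightarrow> ('a \<Rightarrow> 'b) \<Rightarrow> bool" where
  "nonconst_on R \<mu> \<longleftrightarrow> (\<exists>r\<in>R. \<exists>s\<in>R. \<mu> r \<noteq> \<mu> s)"

lemma trace_in_range:
  fixes x :: "'k::field alg_closure"
  assumes perf: "perfect_field TYPE('k)"
  shows "(\<Sum>r\<in>orb x. kval (T :: 'k poly) r) \<in> range to_ac"
proof (rule fixed_by_galois[OF perf])
  fix \<sigma> :: "'k alg_closure \<Rightarrow> 'k alg_closure"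
  assume s: "\<sigma> \<in> abs_galois_group"
  have sum: "\<sigma> (sum f A) = (\<Sum>i\<in>A. \<sigma> (f i))" for f and A :: "'k alg_closure set"
    by (induction A rule: infinite_finite_induct) (auto simp: galois_0[OF s] galois_add[OF s])
  have inj: "inj_on \<sigma> (orb x)" using galois_inj[OF s] by (auto simp: inj_on_def)
  have "\<sigma> (\<Sum>r\<in>orb x. kval T r) = (\<Sum>r\<in>orb x. kval T (\<sigma> r))"
    by (simp add: sum galois_poly_k[OF s])
  also have "\<dots> = (\<Sum>r\<in>\<sigma> ` orb x. kval T r)" by (simp add: sum.reindex[OF inj])
  finally show "\<sigma> (\<Sum>r\<in>orb x. kval T r) = (\<Sum>r\<in>orb x. kval T r)" by (simp add: galois_image_orb[OF s])
qed

text \<open>A functional that vanishes on trace 0 is a multiple M of the trace, hence constant by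
  \<open>vandermonde_zero\<close>. As traces lie in k, each power of x is corrected to trace 0 by a
  multiple over k of a power with nonzero trace.\<close>

lemma trace_zero_functional:
  fixes x :: "'k::field alg_closure"
  assumes perf: "perfect_field TYPE('k)" and nc: "nonconst_on (orb x) \<mu>"
  obtains T :: "'k poly" where "(\<Sum>r\<in>orb x. kval T r) = 0" "(\<Sum>r\<in>orb x. \<mu> r * kval T r) \<noteq> 0"
proof (rule ccontr)
  assume "\<not> thesis"
  then have all: "(\<Sum>r\<in>orb x. \<mu> r * kval T r) = 0" if "(\<Sum>r\<in>orb x. kval T r) = 0" for T :: "'k poly"
    using that \<open>\<And>T. (\<Sum>r\<in>orb x. kval T r) = 0 \<Longrightarrow> (\<Sum>r\<in>orb x. \<mu> r * kval T r) \<noteq> 0 \<Longrightarrow> thesis\<close> by blast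
  \<comment> \<open>The exponent 0 does not always serve: the trace of 1 is the number of
    conjugates, which may be 0 in k.\<close>
  obtain i where i: "(\<Sum>r\<in>orb x. r ^ i) \<noteq> 0"
    using vandermonde_zero[OF finite_orb[of x], of "\<lambda>_. 1" x] orb_self by force
  define M where "M = (\<Sum>r\<in>orb x. \<mu> r * r ^ i) / (\<Sum>r\<in>orb x. r ^ i)"
  have "(\<Sum>r\<in>orb x. (\<mu> r - M) * r ^ j) = 0" for j
  proof -
    obtain c where c: "(\<Sum>r\<in>orb x. r ^ j) = to_ac c"
      using trace_in_range[OF perf, of "monom 1 j" x] by (auto simp: kval_monom)
    obtain d where d: "(\<Sum>r\<in>orb x. r ^ i) = to_ac d"
      using trace_in_range[OF perf, of "monom 1 i" x] by (auto simp: kval_monom)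
    have d0: "d \<noteq> 0" using i d by auto
    define T where "T = monom 1 j + smult (- (c / d)) (monom 1 i)"
    have T: "kval T r = r ^ j + to_ac (- (c / d)) * r ^ i" for r
      unfolding T_def kval_lin kval_monom ..
    have "(\<Sum>r\<in>orb x. kval T r) = to_ac c + to_ac (- (c / d)) * to_ac d"
      unfolding T sum.distrib sum_distrib_left[symmetric] c d ..
    also have "\<dots> = 0" using d0 by simp
    finally have "(\<Sum>r\<in>orb x. \<mu> r * kval T r) = 0" by (rule all)
    then have "(\<Sum>r\<in>orb x. \<mu> r * r ^ j) + to_ac (- (c / d)) * (\<Sum>r\<in>orb x. \<mu> r * r ^ i) = 0"
      unfolding T by (simp add: algebra_simps sum.distrib sum_distrib_left sum_negf sum_subtractf)
    then have "(\<Sum>r\<in>orb x. \<mu> r * r ^ j) = to_ac (c / d) * (\<Sum>r\<in>orb x. \<mu> r * r ^ i)"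
      by (simp add: eq_neg_iff_add_eq_0 add.commute)
    also have "\<dots> = M * (\<Sum>r\<in>orb x. r ^ j)" unfolding M_def c d by simp
    finally show ?thesis by (simp add: algebra_simps sum_subtractf sum_distrib_left)
  qed
  then have "\<mu> r - M = 0" if "r \<in> orb x" for r
    using vandermonde_zero[OF finite_orb[of x], of "\<lambda>r. \<mu> r - M" r] that by blast
  then have "\<mu> r = M" if "r \<in> orb x" for r using that by auto
  then show False using nc unfolding nonconst_on_def by metis
qed

lemma linear_zeros_finite:
  fixes u v :: "'k::field alg_closure"
  assumes "u \<noteq> 0 \<or> v \<noteq> 0"
  shows "finite {c :: 'k. u + to_ac c * v = 0}"
proof -
  have "c = d" if "u + to_ac c * v = 0" "u + to_ac d * v = 0" for c d :: 'k
  proof -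
    have "to_ac c * v = to_ac d * v" using that by (metis add_left_cancel)
    then show ?thesis using that assms by auto
  qed
  then have "{c :: 'k. u + to_ac c * v = 0} = {} \<or> (\<exists>c. {c :: 'k. u + to_ac c * v = 0} = {c})" by blast
  then show ?thesis by auto
qed

text \<open>For each new condition T is moved along a line T + c U; every condition excludes at most
  one c.\<close>

lemma trace_zero_avoid:
  fixes x :: "'k::field alg_closure"
  assumes inf: "infinite (UNIV :: 'k set)" and perf: "perfect_field TYPE('k)"
    and "finite F" "\<And>\<mu>. \<mu> \<in> F \<Longrightarrow> nonconst_on (orb x) \<mu>"
  obtains T :: "'k poly" where "(\<Sum>r\<in>orb x. kval T r) = 0"
    "\<And>\<mu>. \<mu> \<in> F \<Longrightarrow> (\<Sum>r\<in>orb x. \<mu> r * kval T r) \<noteq> 0"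
proof -
  have lin: "(\<Sum>r\<in>orb x. \<mu> r * kval (T + smult c U) r) =
     (\<Sum>r\<in>orb x. \<mu> r * kval T r) + to_ac c * (\<Sum>r\<in>orb x. \<mu> r * kval U r)" for \<mu> T c U
    unfolding kval_lin by (simp add: algebra_simps sum.distrib sum_distrib_left)
  have "\<exists>T :: 'k poly. (\<Sum>r\<in>orb x. kval T r) = 0 \<and> (\<forall>\<mu>\<in>F. (\<Sum>r\<in>orb x. \<mu> r * kval T r) \<noteq> 0)"
    using assms(3,4)
  proof (induction F rule: finite_induct)
    case empty
    show ?case by (rule exI[of _ 0]) simp
  next
    case (insert \<nu> F)
    then obtain T :: "'k poly" where T: "(\<Sum>r\<in>orb x. kval T r) = 0" "\<forall>\<mu>\<in>F. (\<Sum>r\<in>orb x. \<mu> r * kval T r) \<noteq> 0"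
      by auto
    obtain U :: "'k poly" where U: "(\<Sum>r\<in>orb x. kval U r) = 0" "(\<Sum>r\<in>orb x. \<nu> r * kval U r) \<noteq> 0"
      using trace_zero_functional[OF perf, of x \<nu>] insert.prems by blast
    define bad where "bad = (\<Union>\<mu>\<in>insert \<nu> F. {c :: 'k.
      (\<Sum>r\<in>orb x. \<mu> r * kval T r) + to_ac c * (\<Sum>r\<in>orb x. \<mu> r * kval U r) = 0})"
    have "finite bad"
      unfolding bad_def using insert.hyps T U by (intro finite_UN_I linear_zeros_finite) auto
    then obtain c where c: "c \<notin> bad" using inf by (metis ex_new_if_finite)
    have "(\<Sum>r\<in>orb x. kval (T + smult c U) r) = 0"
      using lin[of "\<lambda>_. 1" T c U] T U by simp
    moreover have "\<forall>\<mu>\<in>insert \<nu> F. (\<Sum>r\<in>orb x. \<mu> r * kval (T + smult c U) r) \<noteq> 0"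
      using c unfolding lin bad_def by blast
    ultimately show ?case by blast
  qed
  then show ?thesis using that by blast
qed

section \<open>The Bertini involution of eight general points\<close>

lemma line_sectionI:
  fixes F :: "'a::field poly3"
  assumes np: "\<not> par u v"
    and x: "a1 *s u + a2 *s v \<noteq> 0" and y: "b1 *s u + b2 *s v \<noteq> 0" and z: "c1 *s u + c2 *s v \<noteq> 0"
    and e: "e \<noteq> 0"
    and F: "\<And>s t. eval3 F (s *s u + t *s v) = e * (s * a2 - t * a1) * (s * b2 - t * b1) * (s * c2 - t * c1)"
  shows "line_section F (proj_pt (a1 *s u + a2 *s v)) (proj_pt (b1 *s u + b2 *s v)) (proj_pt (c1 *s u + c2 *s v))"
proof -
  have ind: "\<forall>s t. s *s u + t *s v = 0 \<longrightarrow> s = 0 \<and> t = 0" using not_par_indep[OF np] by blast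
  show ?thesis
    unfolding line_section_def
    by (intro conjI proj_pt_P2 x y z, rule exI[of _ u], rule exI[of _ v], rule exI[of _ a1], rule exI[of _ a2],
      rule exI[of _ b1], rule exI[of _ b2], rule exI[of _ c1], rule exI[of _ c2], rule exI[of _ e])
      (intro conjI ind refl e allI F)
qed

context eight_points
begin

definition member :: "'a \<Rightarrow> 'a \<Rightarrow> 'a poly3" where
  "member p r = pen (poly_const a) (const3 p) (const3 r) X3"

lemma eval_member: "eval3 (member p r) v = pen a p r v"
  by (simp add: member_def eval3_evh id_hom.evh_pen)

lemma homog_member: "homog 3 (member p r)"
  unfolding member_def pen_def
  using homog_mult[OF homog_const homog_gcub[OF homog_X3]]
    homog_mult[OF homog_mult[OF homog_const homog_const] homog_cusp[OF homog_X3]]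
  by (intro homog_diff) simp_all

lemma member_through:
  assumes "p \<noteq> 0 \<or> r \<noteq> 0"
  shows "member p r \<in> cubics_through pts"
proof -
  have "\<not> par (vector [1, 0, 0]) (vector [0, 1, 0] :: 'a ^ 3)" by (simp add: par_3 vector_3)
  then obtain s t where "pen a p r (s *s vector [1, 0, 0] + t *s vector [0, 1, 0]) \<noteq> 0"
    by (rule no_line[OF assms])
  then have "member p r \<noteq> 0" using eval_member[of p r] by (auto simp: eval3_evh)
  moreover have "eval3 (member p r) (cpt s) = 0" if "s \<in> R" for s
    using gcub_cpt_0_iff[of s] that by (simp add: eval_member pen_def)
  ultimately show ?thesis
    using homog_member by (auto simp: cubics_through_def plane_curve_def pts_def on_curve_proj_pt[OF homog_member])
qed

lemma base_locus: "{x \<in> P2. \<forall>F\<in>cubics_through pts. on_curve F x} = insert (proj_pt (cpt 0)) pts"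
proof (intro equalityI subsetI)
  fix x assume x: "x \<in> {x \<in> P2. \<forall>F\<in>cubics_through pts. on_curve F x}"
  then obtain v where v: "v \<noteq> 0" "x = proj_pt v" by (auto simp: P2_def)
  have z: "pen a p r v = 0" if "p \<noteq> 0 \<or> r \<noteq> 0" for p r
    using x member_through[OF that] on_curve_proj_pt[OF homog_member] by (auto simp: v(2) eval_member)
  have "gcub a v = 0" "cusp_cubic v = 0"
    using z[of 1 0] z[of 0 1] a_0_nonzero by (auto simp: pen_def)
  then obtain c s where "c \<noteq> 0" "s \<in> insert 0 R" "v = c *s cpt s" using base_points v(1) by metis
  then show "x \<in> insert (proj_pt (cpt 0)) pts" by (auto simp: v(2) proj_pt_eqI pts_def)
next
  fix x assume "x \<in> insert (proj_pt (cpt 0)) pts"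
  then obtain s where s: "s \<in> insert 0 R" "x = proj_pt (cpt s)" by (auto simp: pts_def)
  have "on_curve F x" if F: "F \<in> cubics_through pts" for F
  proof -
    have h: "homog 3 F" using F by (auto simp: cubics_through_def plane_curve_def)
    have "eval3 F (cpt t) = 0" if "t \<in> R" for t
      using F that on_curve_proj_pt[OF h] by (auto simp: cubics_through_def pts_def)
    then obtain c where "cusp_poly F = smult c (pCons 0 fpoly)"
      using cusp_poly_cubic_through[OF h] by blast
    then have "eval3 F (cpt s) = 0"
      using poly_cusp_poly[of F s] s(1) poly_fpoly_0_iff[of s] by auto
    then show ?thesis by (simp add: s(2) on_curve_proj_pt[OF h])
  qed
  then show "x \<in> {x \<in> P2. \<forall>F\<in>cubics_through pts. on_curve F x}"
    by (auto simp: s(2) proj_pt_P2)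
qed

lemma eval_pderiv_member: "eval3 (pderiv3 i (member p r)) v = dpen a p r v (axis i 1)"
proof -
  consider "i = 1" | "i = 2" | "i = 3" using exhaust_3 by blast
  then show ?thesis
    by cases (simp_all add: member_def pen_def gcub_def cusp_cubic_def dpen_def dgcub_def dcusp_def axis_def
      eval3_evh power2_eq_square power3_eq_cube algebra_simps)
qed

lemma smooth_member:
  assumes "\<not> (\<exists>v. v \<noteq> 0 \<and> pen a p r v = 0 \<and> (\<forall>i. dpen a p r v (axis i 1) = 0))"
  shows "smooth_curve (member p r)"
  unfolding smooth_curve_def
proof
  assume "\<exists>x\<in>P2. singular_at (member p r) x"
  then obtain v where v: "v \<noteq> 0" "singular_at (member p r) (proj_pt v)" by (auto simp: P2_def)
  then have "pen a p r v = 0" "dpen a p r v (axis i 1) = 0" for i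
    using mem_proj_pt[of v] by (auto simp: singular_at_def on_curve_def eval_member eval_pderiv_member)
  then show False using v(1) assms by blast
qed

lemma line_section_third:
  assumes "p \<noteq> 0" "pen a 1 m v = 0" "\<not> par v (tang a 1 m)" "v \<noteq> 0"
    and y: "y = p *s third_pt a 1 m v"
  shows "line_section (member 1 m) (proj_pt v) (proj_pt y) (proj_pt (tang a 1 m))" "y \<noteq> 0"
proof -
  let ?w = "tang a 1 m"
  define P where "P = dpen a 1 m v ?w"
  define Q where "Q = dpen a 1 m ?w v"
  have y': "y = (p * Q) *s v + (- (p * P)) *s ?w"
    by (simp add: y third_pt_def P_def Q_def vec_eq_iff algebra_simps)
  have w0: "?w \<noteq> 0" by (rule tang_nonzero) simp
  have ev: "pen a 1 m (s *s v + t *s ?w) = s * t * (s * P + t * Q)" for s t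
    unfolding pen_expand using assms(2) by (simp add: P_def Q_def algebra_simps power2_eq_square)
  obtain s t where "pen a 1 m (s *s v + t *s ?w) \<noteq> 0" using no_line[of 1 m, OF _ assms(3)] by auto
  then have PQ: "P \<noteq> 0 \<or> Q \<noteq> 0" unfolding ev by auto
  show y0: "y \<noteq> 0"
  proof
    assume "y = 0"
    then have z: "(p * Q) *s v + (- (p * P)) *s ?w = 0" by (simp only: y')
    show False using not_par_indep[OF assms(3) z] assms(1) PQ by simp
  qed
  have v: "1 *s v + 0 *s ?w = v" and w: "0 *s v + 1 *s ?w = ?w" by (simp_all add: vec_eq_iff)
  have "line_section (member 1 m) (proj_pt (1 *s v + 0 *s ?w)) (proj_pt ((p * Q) *s v + (- (p * P)) *s ?w))
      (proj_pt (0 *s v + 1 *s ?w))"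
  proof (rule line_sectionI[OF assms(3), where e = "1 / p"])
    show "eval3 (member 1 m) (s *s v + t *s ?w) = 1 / p * (s * 0 - t * 1) * (s * - (p * P) - t * (p * Q)) * (s * 1 - t * 0)"
      for s t using assms(1) by (simp add: eval_member ev field_simps)
  qed (unfold v w y'[symmetric], use assms(1,4) y0 w0 in simp_all)
  then show "line_section (member 1 m) (proj_pt v) (proj_pt y) (proj_pt ?w)" by (simp only: v w y'[symmetric])
qed

text \<open>The hypothesis says that \<open>tang\<close> is not (1 : 0 : 0), so that the two points
  span the tangent, which has a double zero at (1 : 0 : 0).\<close>

lemma line_section_tangent:
  assumes "tB a 1 m \<noteq> 0"
  shows "line_section (member 1 m) (proj_pt (tang a 1 m)) (proj_pt (cpt 0)) (proj_pt (cpt 0))"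
proof -
  let ?w = "tang a 1 m" and ?q = "cpt 0 :: 'a ^ 3"
  have np: "\<not> par ?w ?q" using assms by (simp add: par_3)
  have w0: "?w \<noteq> 0" by (rule tang_nonzero) simp
  define e where "e = dpen a 1 m ?w ?q"
  have ev: "pen a 1 m (s *s ?w + t *s ?q) = s\<^sup>2 * t * e" for s t
    unfolding pen_expand by (simp add: e_def)
  obtain s t where "pen a 1 m (s *s ?w + t *s ?q) \<noteq> 0" using no_line[of 1 m, OF _ np] by auto
  then have e: "e \<noteq> 0" unfolding ev by auto
  have w: "1 *s ?w + 0 *s ?q = ?w" and q: "0 *s ?w + 1 *s ?q = ?q" by (simp_all add: vec_eq_iff)
  have "line_section (member 1 m) (proj_pt (1 *s ?w + 0 *s ?q)) (proj_pt (0 *s ?w + 1 *s ?q)) (proj_pt (0 *s ?w + 1 *s ?q))"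
  proof (rule line_sectionI[OF np, where e = "- e"])
    show "eval3 (member 1 m) (s *s ?w + t *s ?q) = - e * (s * 0 - t * 1) * (s * 1 - t * 0) * (s * 1 - t * 0)"
      for s t by (simp add: eval_member ev power2_eq_square)
  qed (unfold w q, use w0 e in simp_all)
  then show ?thesis by (simp only: w q)
qed

text \<open>With neutral element q, x + y = q means that the third point w on the line through x and
  y has third point q on the line through w and q; this is the tangent at q, so w =
  \<open>tang\<close>. The condition \<open>T\<close> keeps v off this tangent, hence away from
  w.\<close>

lemma third_pt_neg:
  assumes p: "a 0 * cusp_cubic v \<noteq> 0" and m: "m = gcub a v / (a 0 * cusp_cubic v)"
    and T: "a 0 * cusp_cubic v * v $ 2 - gcub a v * v $ 3 \<noteq> 0" and B: "tB a 1 m \<noteq> 0"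
  shows "cubic_neg (member 1 m) (proj_pt (cpt 0)) (proj_pt v) (proj_pt (bert a v))" "bert a v \<noteq> 0"
proof -
  define p where "p = a 0 * cusp_cubic v"
  have p0: "p \<noteq> 0" using p by (simp add: p_def)
  have r: "gcub a v = p * m" using p by (simp add: m p_def)
  have v0: "v \<noteq> 0" using p by (auto simp: cusp_cubic_def)
  have b: "bert a v = p ^ 9 *s third_pt a 1 m v"
    using third_pt_scale[of a p 1 m v] r by (simp add: bert_def p_def[symmetric])
  have "p * pen a 1 m v = 0" using pen_member[of a v] pen_scale(1)[of a p 1 m v] r by (simp add: p_def[symmetric])
  then have z: "pen a 1 m v = 0" using p0 by simp
  have w0: "tang a 1 m \<noteq> 0" by (rule tang_nonzero) simp
  have np: "\<not> par v (tang a 1 m)"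
  proof
    assume "par v (tang a 1 m)"
    then obtain c where c: "v = c *s tang a 1 m" using w0 by (rule par_scaleE)
    have "v $ 2 = m * v $ 3" by (subst (1 2) c) (simp add: algebra_simps)
    then show False using T r by (simp add: p_def[symmetric])
  qed
  have p9: "p ^ 9 \<noteq> 0" using p0 by simp
  note L = line_section_third[OF p9 z np v0 b]
  show "bert a v \<noteq> 0" by (rule L(2))
  show "cubic_neg (member 1 m) (proj_pt (cpt 0)) (proj_pt v) (proj_pt (bert a v))"
    unfolding cubic_neg_def cubic_add_def using L(1) line_section_tangent[OF B] by blast
qed

end

lemma finite_quadratic_zeros:
  fixes b0 b1 b2 :: "'a::idom"
  assumes "\<not> (b2 = 0 \<and> b1 = 0 \<and> b0 = 0)"
  shows "finite {m. b2 + b1 * m + b0 * m\<^sup>2 = 0}"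
proof -
  have "finite {m. poly [:b2, b1, b0:] m = 0}" using assms by (intro poly_roots_finite) auto
  then show ?thesis by (simp add: algebra_simps power2_eq_square)
qed

lemma plane_curve_mult:
  fixes F G :: "'a::field poly3"
  shows "plane_curve d F \<Longrightarrow> plane_curve e G \<Longrightarrow> plane_curve (d + e) (F * G)"
  by (simp add: plane_curve_def homog_mult)

lemma plane_curve_prod:
  fixes F :: "'i \<Rightarrow> 'a::field poly3"
  assumes "finite A" "\<And>i. i \<in> A \<Longrightarrow> plane_curve (d i) (F i)"
  shows "plane_curve (sum d A) (prod F A)"
  using assms homog_prod[of A d F] by (auto simp: plane_curve_def prod_zero_iff)

lemma is_bertini_map:
  fixes R :: "'k::field alg_closure set" and b :: "nat \<Rightarrow> 'k"
  assumes inf: "infinite (UNIV :: 'k set)" and E: "eight_points R"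
    and b: "\<And>i. to_ac (b i) = coeff (eight_points.fpoly R) i"
  shows "is_bertini (eight_points.pts R) (bertini_map b)"
proof -
  interpret eight_points R by (rule E)
  have ba: "(\<lambda>i. to_ac (b i)) = a" using b by (simp add: fun_eq_iff)
  have b0: "b 0 \<noteq> 0" using a_0_nonzero b[of 0] by auto
  have q: "proj_pt (cpt 0) \<notin> pts" using R_nonzero by (auto simp: pts_def proj_pt_cpt_inj)
  \<comment> \<open>Parameters of singular members and of members for which \<open>tang\<close> is
    the base point (1 : 0 : 0) itself.\<close>
  define Bad where "Bad = {m. \<exists>v. v \<noteq> 0 \<and> pen a 1 m v = 0 \<and> (\<forall>i. dpen a 1 m v (axis i 1) = 0)} \<union> {m. tB a 1 m = 0}"
  have "finite {m. tB a 1 m = 0}"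
    using finite_quadratic_zeros[of "a 5" "a 3" "a 1"] odd_part_nonzero by (simp add: tB_def)
  then have finB: "finite Bad" using finite_singular by (simp add: Bad_def)
  \<comment> \<open>The quartic formed by the points that lie on the tangent at (1 : 0 : 0) to their
    own member.\<close>
  define T where "T = const3 (a 0) * cusp_cubic X3 * var3 2 - gcub (poly_const a) X3 * var3 3"
  have evT: "eval3 T v = a 0 * cusp_cubic v * v $ 2 - gcub a v * v $ 3" for v
    by (simp add: T_def eval3_evh id_hom.evh_cusp id_hom.evh_gcub)
  have hT: "homog 4 T"
    unfolding T_def
    using homog_mult[OF homog_mult[OF homog_const[of "a 0"] homog_cusp[OF homog_X3]] homog_var[of 2]]
      homog_mult[OF homog_gcub[OF homog_X3, of a] homog_var[of 3]]
    by (intro homog_diff) simp_all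
  have "eval3 T (vector [0, 0, 1]) = -1" by (simp add: evT cusp_cubic_def gcub_def vector_3)
  then have T0: "T \<noteq> 0" by (auto simp: eval3_evh)
  define H where "H = cusp_cubic X3 * (T * (\<Prod>m\<in>Bad. member 1 m))"
  have mem: "plane_curve 3 (member 1 m)" for m
    using member_through[of 1 m] by (simp add: cubics_through_def)
  have prod: "plane_curve (\<Sum>m\<in>Bad. 3) (\<Prod>m\<in>Bad. member 1 m)"
    by (rule plane_curve_prod[OF finB mem])
  have H: "plane_curve (3 + (4 + (\<Sum>m\<in>Bad. 3))) H"
    unfolding H_def
  proof (intro plane_curve_mult prod)
    show "plane_curve 3 (cusp_cubic (X3 :: 'k alg_closure poly3 ^ 3))"
      using homog_cusp[OF homog_X3] cusp_cubic_X3_nonzero by (simp add: plane_curve_def)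
    show "plane_curve 4 T" using hT T0 by (simp add: plane_curve_def)
  qed
  have main: "\<exists>F\<in>cubics_through pts. smooth_curve F \<and> on_curve F x \<and>
      (\<exists>y. rat_maps_to (bertini_map b) x y \<and> cubic_neg F (proj_pt (cpt 0)) x y)"
    if x: "x \<in> P2" "\<not> on_curve H x" for x
  proof -
    obtain v where v: "v \<noteq> 0" "x = proj_pt v" using x(1) by (auto simp: P2_def)
    have "eval3 H v \<noteq> 0" using x(2) H on_curve_proj_pt by (auto simp: v(2) plane_curve_def)
    then have nz: "cusp_cubic v \<noteq> 0" "eval3 T v \<noteq> 0" "\<And>m. m \<in> Bad \<Longrightarrow> pen a 1 m v \<noteq> 0"
      using finB by (auto simp: H_def eval3_evh id_hom.evh_cusp eval_member[unfolded eval3_evh])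
    define m where "m = gcub a v / (a 0 * cusp_cubic v)"
    have p0: "a 0 * cusp_cubic v \<noteq> 0" using nz(1) a_0_nonzero by simp
    have z: "pen a 1 m v = 0" using nz(1) a_0_nonzero by (simp add: pen_def m_def)
    then have mB: "m \<notin> Bad" using nz(3) by blast
    then have B: "tB a 1 m \<noteq> 0" by (simp add: Bad_def)
    note N = third_pt_neg[OF p0 m_def nz(2)[unfolded evT] B]
    have "smooth_curve (member 1 m)" by (rule smooth_member) (use mB in \<open>simp add: Bad_def\<close>)
    moreover have "on_curve (member 1 m) x" using z by (simp add: v(2) on_curve_proj_pt[OF homog_member] eval_member)
    moreover have "rat_maps_to (bertini_map b) x (proj_pt (bert a v))"
    proof -
      have "bert_triple b \<in> bertini_map b"
        using rat_eq_refl[OF bert_triple_nonzero(1)[of b, OF inf b0]] by (simp add: bertini_map_def rat_class_def)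
      moreover have "v \<in> x" by (simp add: v(2) mem_proj_pt)
      moreover have "(\<chi> i. eval3 (Poly_Mapping.map to_ac (bert_triple b $ i)) v) = bert a v"
        using ac.evt_bert[of b v] by (simp add: eval3_map_to_ac evt_def ba)
      ultimately show ?thesis unfolding rat_maps_to_def Let_def using N(2) by metis
    qed
    ultimately show ?thesis using member_through[of 1 m] N(1) unfolding v(2) by fastforce
  qed
  show ?thesis
    unfolding is_bertini_def
  proof (intro conjI exI[of _ "proj_pt (cpt 0)"] exI)
    show "bertini_map b \<in> Bir2" by (rule bertini_map_Bir2[of b, OF inf b0])
    show "proj_pt (cpt 0) \<notin> pts" by (rule q)
    show "{x \<in> P2. \<forall>F\<in>cubics_through pts. on_curve F x} = insert (proj_pt (cpt 0)) pts" by (rule base_locus)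
    show "plane_curve (3 + (4 + (\<Sum>m\<in>Bad. 3))) H" by (rule H)
    show "\<forall>x\<in>P2. \<not> on_curve H x \<longrightarrow> (\<exists>F\<in>cubics_through pts. smooth_curve F \<and> on_curve F x \<and>
      (\<exists>y. rat_maps_to (bertini_map b) x y \<and> cubic_neg F (proj_pt (cpt 0)) x y))"
      by (intro ballI impI main)
  qed
qed

section \<open>Points of degree eight\<close>

lemma galois_act_proj_pt:
  assumes s: "\<sigma> \<in> abs_galois_group"
  shows "galois_act \<sigma> (proj_pt v) = proj_pt (\<chi> i. \<sigma> (v $ i))"
proof (intro equalityI subsetI)
  fix u assume "u \<in> galois_act \<sigma> (proj_pt v)"
  then obtain c where "c \<noteq> 0" "u = (\<chi> i. \<sigma> ((c *s v) $ i))" by (auto simp: galois_act_def proj_pt_def)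
  then show "u \<in> proj_pt (\<chi> i. \<sigma> (v $ i))"
    using galois_inj[OF s, of c 0] galois_0[OF s]
    by (auto simp: proj_pt_def galois_mult[OF s] vec_eq_iff intro!: exI[of _ "\<sigma> c"])
next
  fix u assume "u \<in> proj_pt (\<chi> i. \<sigma> (v $ i))"
  then obtain c where c: "c \<noteq> 0" "u = c *s (\<chi> i. \<sigma> (v $ i))" by (auto simp: proj_pt_def)
  obtain d where d: "c = \<sigma> d" using galois_bij[OF s] by (metis bij_pointE)
  have "d \<noteq> 0" using c d galois_0[OF s] by auto
  moreover have "u = (\<chi> i. \<sigma> ((d *s v) $ i))" by (simp add: c d vec_eq_iff galois_mult[OF s])
  ultimately show "u \<in> galois_act \<sigma> (proj_pt v)"
    unfolding galois_act_def proj_pt_def by (intro image_eqI[of _ _ "d *s v"]) auto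
qed

lemma galois_diff: "\<sigma> \<in> abs_galois_group \<Longrightarrow> \<sigma> (x - y) = \<sigma> x - \<sigma> y"
  using galois_add[of \<sigma> x "- y"] galois_uminus[of \<sigma> y] by simp

lemma galois_power: "\<sigma> \<in> abs_galois_group \<Longrightarrow> \<sigma> (x ^ n) = \<sigma> x ^ n"
  by (induction n) (simp_all add: galois_mult galois_1)

lemma galois_prod: "\<sigma> \<in> abs_galois_group \<Longrightarrow> \<sigma> (prod f A) = (\<Prod>x\<in>A. \<sigma> (f x))"
  by (induction A rule: infinite_finite_induct) (simp_all add: galois_mult galois_1)

lemma galois_act_cpt:
  assumes "\<sigma> \<in> abs_galois_group"
  shows "galois_act \<sigma> (proj_pt (cpt s)) = proj_pt (cpt (\<sigma> s))"
proof -
  have "(\<chi> i. \<sigma> (cpt s $ i)) = cpt (\<sigma> s)"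
    by (rule vec3_eqI) (simp_all add: galois_1[OF assms] galois_power[OF assms])
  then show ?thesis by (simp add: galois_act_proj_pt[OF assms])
qed

lemma closed_point_cusp:
  assumes "card (orb x) = n" "n > 0"
  shows "closed_point_of_degree n (proj_pt ` cpt ` orb x)"
proof -
  have "proj_pt ` cpt ` orb x = (\<lambda>\<sigma>. galois_act \<sigma> (proj_pt (cpt x))) ` abs_galois_group"
    unfolding orb_def image_image by (intro image_cong) (simp_all add: galois_act_cpt)
  also have "\<dots> = {galois_act \<sigma> (proj_pt (cpt x)) | \<sigma>. \<sigma> \<in> abs_galois_group}" by auto
  finally have "proj_pt ` cpt ` orb x = {galois_act \<sigma> (proj_pt (cpt x)) | \<sigma>. \<sigma> \<in> abs_galois_group}" .
  moreover have "card (proj_pt ` cpt ` orb x) = n"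
    unfolding image_image using assms(1) by (subst card_image) (auto simp: inj_on_def proj_pt_cpt_inj)
  ultimately show ?thesis
    unfolding closed_point_of_degree_def using finite_orb[of x] proj_pt_P2[OF cpt_nonzero] by blast
qed

lemma orb_kval: "kval T ` orb x = orb (kval T x)"
  unfolding orb_def image_image by (intro image_cong) (simp_all add: galois_poly_k)

lemma orb_polynomial_coeffs:
  fixes x :: "'k::field alg_closure"
  assumes perf: "perfect_field TYPE('k)"
  shows "coeff (\<Prod>s\<in>orb x. [:- s, 1:]) i \<in> range to_ac"
proof (rule fixed_by_galois[OF perf])
  fix \<sigma> :: "'k alg_closure \<Rightarrow> 'k alg_closure"
  assume s: "\<sigma> \<in> abs_galois_group"
  define f where "f = (\<Prod>s\<in>orb x. [:- s, 1:])"
  have inj: "inj_on \<sigma> (orb x)" using galois_inj[OF s] by (auto simp: inj_on_def)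
  have "map_poly \<sigma> f = f"
  proof (rule poly_infinite_eqI[OF infinite_alg_closed])
    fix z
    obtain w where w: "z = \<sigma> w" using galois_bij[OF s] by (metis bij_pointE)
    have "poly (map_poly \<sigma> f) z = \<sigma> (poly f w)" unfolding w by (rule galois_poly[OF s, symmetric])
    also have "\<dots> = (\<Prod>r\<in>orb x. z - \<sigma> r)"
      unfolding f_def poly_prod w galois_prod[OF s]
      by (intro prod.cong) (simp_all add: galois_diff[OF s])
    also have "\<dots> = (\<Prod>r\<in>\<sigma> ` orb x. z - r)" by (simp add: prod.reindex[OF inj])
    also have "\<dots> = poly f z" unfolding galois_image_orb[OF s] f_def poly_prod by simp
    finally show "poly (map_poly \<sigma> f) z = poly f z" .
  qed
  then show "\<sigma> (coeff f i) = coeff f i" using galois_0[OF s] by (metis coeff_map_poly)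
qed

lemma bertini_of_orbit:
  fixes x :: "'k::field alg_closure"
  assumes inf: "infinite (UNIV :: 'k set)" and perf: "perfect_field TYPE('k)"
    and E: "eight_points (orb x)"
  obtains b :: "nat \<Rightarrow> 'k" where "(\<lambda>i. to_ac (b i)) = coeff (eight_points.fpoly (orb x))"
    "bertini_map b \<in> bertini_involutions 8"
proof -
  interpret eight_points "orb x" by (rule E)
  have "\<exists>c. to_ac c = a i" for i
    using orb_polynomial_coeffs[OF perf, of x i] unfolding fpoly_def by (metis rangeE)
  then obtain b where b: "\<And>i. to_ac (b i) = a i" by metis
  have "closed_point_of_degree 8 pts" unfolding pts_def by (rule closed_point_cusp[OF card_R]) simp
  moreover have "is_bertini pts (bertini_map b)" by (rule is_bertini_map[OF inf E b])
  ultimately have "bertini_map b \<in> bertini_involutions 8"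
    unfolding bertini_involutions_def using general_points_pts by blast
  moreover have "(\<lambda>i. to_ac (b i)) = a" using b by (simp add: fun_eq_iff)
  ultimately show ?thesis using that by blast
qed

text \<open>In characteristic \<open>2\<close> a root \<open>s\<close> with \<open>s\<^sup>2 \<in> k\<close> would be its only conjugate.\<close>

lemma orb_not_inseparable:
  fixes x :: "'k::field alg_closure"
  assumes perf: "perfect_field TYPE('k)" and E: "eight_points (orb x)" and s: "s \<in> orb x"
  shows "(2 :: 'k alg_closure) = 0 \<longrightarrow> coeff (eight_points.fpoly (orb x)) 5 \<noteq> 0 \<longrightarrow>
      coeff (eight_points.fpoly (orb x)) 5 * s\<^sup>2 + coeff (eight_points.fpoly (orb x)) 3 \<noteq> 0"
proof (intro impI notI)
  interpret eight_points "orb x" by (rule E)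
  assume two: "(2 :: 'k alg_closure) = 0" and 5: "a 5 \<noteq> 0" and z: "a 5 * s\<^sup>2 + a 3 = 0"
  obtain c5 where c5: "a 5 = to_ac c5"
    using orb_polynomial_coeffs[OF perf, of x 5] unfolding fpoly_def by (rule rangeE)
  obtain c3 where c3: "a 3 = to_ac c3"
    using orb_polynomial_coeffs[OF perf, of x 3] unfolding fpoly_def by (rule rangeE)
  obtain \<rho> where r: "\<rho> \<in> abs_galois_group" "s = \<rho> x" using s by (auto simp: orb_def)
  have sq: "a 5 * t\<^sup>2 + a 3 = 0" if t: "t \<in> orb x" for t
  proof -
    obtain \<tau> where t: "\<tau> \<in> abs_galois_group" "t = \<tau> x" using \<open>t \<in> orb x\<close> by (auto simp: orb_def)
    define \<sigma> where "\<sigma> = \<tau> \<circ> inv_into UNIV \<rho>"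
    have s: "\<sigma> \<in> abs_galois_group" unfolding \<sigma>_def by (intro galois_comp galois_inv t r)
    have "\<sigma> s = t" unfolding \<sigma>_def r(2) t(2) using galois_bij[OF r(1)] by (simp add: bij_def)
    have "\<sigma> (a 5 * s\<^sup>2 + a 3) = 0" unfolding z by (rule galois_0[OF s])
    then show ?thesis
      unfolding c5 c3 galois_add[OF s] galois_mult[OF s] galois_power[OF s] galois_const[OF s] \<open>\<sigma> s = t\<close> .
  qed
  have "t = s" if t: "t \<in> orb x" for t
  proof -
    have "a 5 * t\<^sup>2 = a 5 * s\<^sup>2" using sq[OF t] z by (metis add_right_cancel)
    then have "t\<^sup>2 = s\<^sup>2" using 5 by simp
    then have "(t - s)\<^sup>2 = 2 * (s\<^sup>2 - t * s)" by (simp add: power2_eq_square algebra_simps)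
    also have "\<dots> = 0" by (simp only: two mult_zero_left)
    finally show "t = s" by simp
  qed
  then have "orb x = {s}" using s by blast
  then show False using card_R by simp
qed

section \<open>Conjugacy classes\<close>

lemma map_matrix_mult: "(\<chi> i j. to_ac (A $ i $ j)) ** (\<chi> i j. to_ac (B $ i $ j)) = (\<chi> i j. to_ac ((A ** B) $ i $ j))"
  for A B :: "'k::field ^ 3 ^ 3"
  by (simp add: vec_eq_iff matrix_matrix_mult_def to_ac_sum)

lemma map_matrix_one: "(\<chi> i j. to_ac ((mat 1 :: 'k::field ^ 3 ^ 3) $ i $ j)) = mat 1"
  by (simp add: vec_eq_iff mat_def)

text \<open>Equality of classes over k is evaluated at geometric points: proportional triples have
  parallel values under \<open>to_ac\<close>, which is the hypothesis of
  \<open>conj_points\<close>.\<close>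

lemma conjugate_points:
  fixes x y :: "'k::field alg_closure" and b c :: "nat \<Rightarrow> 'k"
  assumes inf: "infinite (UNIV :: 'k set)" and perf: "perfect_field TYPE('k)"
    and E: "eight_points (orb x)" "eight_points (orb y)"
    and b: "(\<lambda>i. to_ac (b i)) = coeff (eight_points.fpoly (orb x))"
    and c: "(\<lambda>i. to_ac (c i)) = coeff (eight_points.fpoly (orb y))"
    and conj: "(bertini_map b, bertini_map c) \<in> PGL3_conj"
  obtains M M' :: "'k alg_closure ^ 3 ^ 3" where "M ** M' = mat 1" "M' ** M = mat 1"
    "\<And>s. s \<in> orb x \<Longrightarrow> \<exists>q\<in>insert 0 (orb y). \<exists>e. e \<noteq> 0 \<and> M *v cpt s = e *s cpt q"
proof -
  interpret E: eight_points "orb x" by (rule E(1))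
  interpret E': eight_points "orb y" by (rule E(2))
  have b0: "b 0 \<noteq> 0" using fun_cong[OF b, of 0] E.a_0_nonzero by auto
  have c0: "c 0 \<noteq> 0" using fun_cong[OF c, of 0] E'.a_0_nonzero by auto
  note tb = bert_triple_nonzero(1)[of b, OF inf b0] and tc = bert_triple_nonzero(1)[of c, OF inf c0]
  obtain A where A: "invertible A" "bertini_map c = PGL_map A \<circ>\<^sub>R bertini_map b \<circ>\<^sub>R PGL_map (matrix_inv A)"
    using conj by (auto simp: PGL3_conj_def)
  define H where "H = sub_triple (sub_triple (lin_triple A) (bert_triple b)) (lin_triple (matrix_inv A))"
  have "rat_class (bert_triple c) = rat_class H"
    using A(2) PGL_conj_class(1)[OF inf A(1) tb] by (simp add: bertini_map_def H_def)
  moreover have "bert_triple c \<in> rat_class (bert_triple c)" using rat_eq_refl[OF tc] by (simp add: rat_class_def)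
  ultimately have eq: "rat_eq H (bert_triple c)" by (simp add: rat_class_def)
  define M :: "'k alg_closure ^ 3 ^ 3" where "M = (\<chi> i j. to_ac (A $ i $ j))"
  define M' :: "'k alg_closure ^ 3 ^ 3" where "M' = (\<chi> i j. to_ac (matrix_inv A $ i $ j))"
  have inv: "M ** M' = mat 1" "M' ** M = mat 1"
    unfolding M_def M'_def map_matrix_mult matrix_inv_right[OF A(1)] matrix_inv_left[OF A(1)] map_matrix_one
    by (rule refl)+
  have "evt to_ac H v = M *v bert E.a (M' *v v)" for v
    unfolding H_def ac.evt_sub lin_triple_def ac.evt_lin ac.evt_bert b M_def M'_def ..
  moreover have "evt to_ac (bert_triple c) v = bert E'.a v" for v unfolding ac.evt_bert c ..
  ultimately have "par (bert E'.a v) (M *v bert E.a (M' *v v))" for v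
    using par_sym[OF rat_eq_par_ac[OF eq, of v]] by simp
  from conj_points[OF E inv this _ orb_not_inseparable[OF perf E(1)]]
  have "\<exists>q\<in>insert 0 (orb y). \<exists>e. e \<noteq> 0 \<and> M *v cpt s = e *s cpt q" if "s \<in> orb x" for s
    using that by blast
  then show ?thesis using that inv by blast
qed

lemma det3_matrix:
  fixes M :: "'a::comm_ring_1 ^ 3 ^ 3"
  shows "det3 (M *v x) (M *v u) (M *v v) = det3 (M $ 1) (M $ 2) (M $ 3) * det3 x u v"
  by (simp add: det3_def matrix_vector_mult_def sum_3 algebra_simps)

lemma det3_scale_all: "det3 (c *s x) (d *s u) (e *s v) = c * d * e * det3 x u v"
  by (simp add: det3_def algebra_simps)

text \<open>The generalised Vandermonde determinant with exponents 0, 1, 3; its last factor is the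
  condition for collinearity.\<close>

lemma det3_cpt: "det3 (cpt s) (cpt t) (cpt r) = (t - s) * (r - s) * (r - t) * (s + t + r)"
  by (simp add: det3_def algebra_simps power3_eq_cube)

text \<open>The cross-ratio of the four lines joining the first of five points to the others is
  \<open>[123][145] / ([124][135])\<close>; for points of the cuspidal cubic it reduces, up to a common factor,
  to \<open>cross_num / cross_den\<close>.\<close>

definition cross_num :: "(nat \<Rightarrow> 'a::comm_ring_1) \<Rightarrow> 'a" where
  "cross_num s = (s 3 - s 2) * (s 5 - s 4) * (s 1 + s 2 + s 3) * (s 1 + s 4 + s 5)"

definition cross_den :: "(nat \<Rightarrow> 'a::comm_ring_1) \<Rightarrow> 'a" where
  "cross_den s = (s 4 - s 2) * (s 5 - s 3) * (s 1 + s 2 + s 4) * (s 1 + s 3 + s 5)"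

text \<open>In [123][145] and in [124][135] the index 1 occurs twice and every other index once, so
  the scalars \<open>e i\<close> contribute the same factor \<open>E\<close>; the factors of the
  determinants that involve the first point also agree and form \<open>C\<close>. The identity is
  cross-multiplied to allow zero values.\<close>

lemma cross_ratio_invariant:
  fixes M M' :: "'a::field ^ 3 ^ 3"
  assumes inv: "M ** M' = mat 1"
    and e: "\<And>i. e i \<noteq> 0" "\<forall>i\<in>{1..5}. M *v cpt (s i) = e i *s cpt (q i)"
    and dist: "s 2 \<noteq> s 1" "s 3 \<noteq> s 1" "s 4 \<noteq> s 1" "s 5 \<noteq> s 1"
  defines "N \<equiv> det3 (cpt (q 1)) (cpt (q 2)) (cpt (q 3)) * det3 (cpt (q 1)) (cpt (q 4)) (cpt (q 5))"
    and "D \<equiv> det3 (cpt (q 1)) (cpt (q 2)) (cpt (q 4)) * det3 (cpt (q 1)) (cpt (q 3)) (cpt (q 5))"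
  shows "N * cross_den s = D * cross_num s" "cross_num s \<noteq> 0 \<Longrightarrow> N \<noteq> 0" "cross_den s \<noteq> 0 \<Longrightarrow> D \<noteq> 0"
proof -
  define k where "k = det3 (M $ 1) (M $ 2) (M $ 3)"
  define C where "C = (s 2 - s 1) * (s 3 - s 1) * (s 4 - s 1) * (s 5 - s 1)"
  define E where "E = (e 1)\<^sup>2 * e 2 * e 3 * e 4 * e 5"
  have C: "C \<noteq> 0" using dist by (simp add: C_def)
  have E: "E \<noteq> 0" using e(1) by (simp add: E_def)
  have k: "k \<noteq> 0"
  proof
    assume "k = 0"
    then have z: "det3 (M *v x) (M *v u) (M *v v) = 0" for x u v unfolding det3_matrix k_def[symmetric] by simp
    have MM: "M *v (M' *v v) = v" for v using inv by (simp add: matrix_vector_mul_assoc)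
    have "det3 (vector [1, 0, 0]) (vector [0, 1, 0]) (vector [0, 0, 1] :: 'a ^ 3) = 0"
      using z[of "M' *v vector [1, 0, 0]" "M' *v vector [0, 1, 0]" "M' *v vector [0, 0, 1]"] unfolding MM .
    then show False by (simp add: det3_def vector_3)
  qed
  have m: "k * det3 (cpt (s i)) (cpt (s j)) (cpt (s l)) = e i * e j * e l * det3 (cpt (q i)) (cpt (q j)) (cpt (q l))"
    if "i \<in> {1..5}" "j \<in> {1..5}" "l \<in> {1..5}" for i j l
    unfolding k_def det3_matrix[symmetric] using bspec[OF e(2) that(1)] bspec[OF e(2) that(2)] bspec[OF e(2) that(3)]
    by (simp only: det3_scale_all)
  have m123: "k * det3 (cpt (s 1)) (cpt (s 2)) (cpt (s 3)) = e 1 * e 2 * e 3 * det3 (cpt (q 1)) (cpt (q 2)) (cpt (q 3))"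
    by (rule m) simp_all
  have m145: "k * det3 (cpt (s 1)) (cpt (s 4)) (cpt (s 5)) = e 1 * e 4 * e 5 * det3 (cpt (q 1)) (cpt (q 4)) (cpt (q 5))"
    by (rule m) simp_all
  have m124: "k * det3 (cpt (s 1)) (cpt (s 2)) (cpt (s 4)) = e 1 * e 2 * e 4 * det3 (cpt (q 1)) (cpt (q 2)) (cpt (q 4))"
    by (rule m) simp_all
  have m135: "k * det3 (cpt (s 1)) (cpt (s 3)) (cpt (s 5)) = e 1 * e 3 * e 5 * det3 (cpt (q 1)) (cpt (q 3)) (cpt (q 5))"
    by (rule m) simp_all
  have "k\<^sup>2 * (C * cross_num s) =
      (k * det3 (cpt (s 1)) (cpt (s 2)) (cpt (s 3))) * (k * det3 (cpt (s 1)) (cpt (s 4)) (cpt (s 5)))"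
    unfolding det3_cpt by (simp add: C_def cross_num_def power2_eq_square mult_ac)
  also have "\<dots> = E * N"
    unfolding m123 m145 E_def N_def by (simp add: power2_eq_square mult_ac)
  finally have 1: "k\<^sup>2 * (C * cross_num s) = E * N" .
  have "k\<^sup>2 * (C * cross_den s) =
      (k * det3 (cpt (s 1)) (cpt (s 2)) (cpt (s 4))) * (k * det3 (cpt (s 1)) (cpt (s 3)) (cpt (s 5)))"
    unfolding det3_cpt by (simp add: C_def cross_den_def power2_eq_square mult_ac)
  also have "\<dots> = E * D"
    unfolding m124 m135 E_def D_def by (simp add: power2_eq_square mult_ac)
  finally have 2: "k\<^sup>2 * (C * cross_den s) = E * D" .
  have "k\<^sup>2 * C * (E * (N * cross_den s)) = (E * N) * (k\<^sup>2 * (C * cross_den s))" by (simp only: mult_ac)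
  also have "\<dots> = (k\<^sup>2 * (C * cross_num s)) * (E * D)" by (simp only: 1 2)
  also have "\<dots> = k\<^sup>2 * C * (E * (D * cross_num s))" by (simp only: mult_ac)
  finally show "N * cross_den s = D * cross_num s" using k C E by simp
  show "cross_num s \<noteq> 0 \<Longrightarrow> N \<noteq> 0" "cross_den s \<noteq> 0 \<Longrightarrow> D \<noteq> 0"
    using 1 2 k C by auto
qed

section \<open>A family with varying cross-ratio\<close>

lemma sum_indicator_mult:
  fixes g :: "'a \<Rightarrow> 'b::comm_ring_1"
  assumes "finite A" "r \<in> A"
  shows "(\<Sum>s\<in>A. (if s = r then 1 else 0) * g s) = g r"
proof -
  have "(\<Sum>s\<in>A. (if s = r then 1 else 0) * g s) = (\<Sum>s\<in>A. if s = r then g r else 0)"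
    by (intro sum.cong) auto
  then show ?thesis using assms by simp
qed

lemma sum_indicator_set_mult:
  fixes g :: "'a \<Rightarrow> 'b::comm_ring_1"
  assumes "finite A" "S \<subseteq> A"
  shows "(\<Sum>s\<in>A. (if s \<in> S then 1 else 0) * g s) = sum g S"
proof -
  have "(\<Sum>s\<in>A. (if s \<in> S then 1 else 0) * g s) = (\<Sum>s\<in>A. if s \<in> S then g s else 0)"
    by (intro sum.cong) auto
  also have "\<dots> = sum g (A \<inter> S)" using assms(1) by (simp add: sum.inter_restrict)
  finally show ?thesis using assms(2) by (simp add: Int_absorb1)
qed

text \<open>V separates the points 2 and 3, so these collide on the line U + t V at some
  \<open>t0\<close>, where \<open>cross_num\<close> vanishes. U is chosen off finitely many linear
  conditions, none of which is a multiple of the trace, so that \<open>cross_den\<close> does not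
  vanish there.\<close>

lemma generic_family:
  fixes x :: "'k::field alg_closure"
  assumes inf: "infinite (UNIV :: 'k set)" and perf: "perfect_field TYPE('k)" and card: "card (orb x) = 8"
  obtains U V :: "'k poly" and r :: "nat \<Rightarrow> 'k alg_closure" and t0
  where "r ` {1..5} \<subseteq> orb x" "inj_on r {1..5}"
    "(\<Sum>s\<in>orb x. kval U s) = 0" "(\<Sum>s\<in>orb x. kval V s) = 0"
    "\<forall>S. S \<subseteq> orb x \<longrightarrow> card S \<in> {1, 2, 3} \<longrightarrow> (\<Sum>s\<in>S. kval U s) \<noteq> 0"
    "inj_on (kval U) (orb x)"
    "cross_num (\<lambda>i. kval U (r i) + t0 * kval V (r i)) = 0"
    "cross_den (\<lambda>i. kval U (r i) + t0 * kval V (r i)) \<noteq> 0"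
proof -
  have fin: "finite (orb x)" by (rule finite_orb)
  obtain xs where xs: "set xs = orb x" "distinct xs" using finite_distinct_list[OF fin] by blast
  have len: "length xs = 8" using xs card distinct_card by force
  define r where "r i = xs ! i" for i
  have r: "r i \<in> orb x" if "i < 8" for i using that len xs(1) nth_mem[of i xs] by (simp add: r_def)
  have req: "r i = r j \<longleftrightarrow> i = j" if "i < 8" "j < 8" for i j
    using that xs(2) len by (simp add: r_def nth_eq_iff_index_eq)
  have ro: "r 1 \<in> orb x" "r 2 \<in> orb x" "r 3 \<in> orb x" "r 4 \<in> orb x" "r 5 \<in> orb x" using r by simp_all
  define \<delta> :: "'k alg_closure \<Rightarrow> 'k alg_closure \<Rightarrow> 'k alg_closure"
    where "\<delta> q s = (if s = q then 1 else 0)" for q s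
  have \<delta>: "(\<Sum>s\<in>orb x. \<delta> q s * g s) = g q" if "q \<in> orb x" for q g
    unfolding \<delta>_def by (rule sum_indicator_mult[OF fin that])
  have ncI: "nonconst_on (orb x) \<mu>" if "i < 8" "j < 8" "\<mu> (r i) \<noteq> \<mu> (r j)" for \<mu> :: "'k alg_closure \<Rightarrow> 'k alg_closure" and i j
    unfolding nonconst_on_def using r that by blast
  have "nonconst_on (orb x) (\<lambda>s. \<delta> (r 3) s - \<delta> (r 2) s)"
    by (rule ncI[of 3 1]) (simp_all add: \<delta>_def req)
  then obtain V :: "'k poly" where V: "(\<Sum>s\<in>orb x. kval V s) = 0"
    "(\<Sum>s\<in>orb x. (\<delta> (r 3) s - \<delta> (r 2) s) * kval V s) \<noteq> 0"
    by (rule trace_zero_functional[OF perf])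
  define \<beta> where "\<beta> i = kval V (r i)" for i
  define d where "d = \<beta> 3 - \<beta> 2"
  have d: "d \<noteq> 0" using V(2) ro by (simp add: left_diff_distrib sum_subtractf \<delta> d_def \<beta>_def)
  define c24 where "c24 s = \<delta> (r 4) s - \<delta> (r 2) s" for s
  define c35 where "c35 s = \<delta> (r 5) s - \<delta> (r 3) s" for s
  define c124 where "c124 s = \<delta> (r 1) s + \<delta> (r 2) s + \<delta> (r 4) s" for s
  define c135 where "c135 s = \<delta> (r 1) s + \<delta> (r 3) s + \<delta> (r 5) s" for s
  \<comment> \<open>With l the value of the functional c at V, this functional takes at U the value
    d times that of c at U + t0 V. Thus a condition at the point t0, which depends on U, becomes
    linear in U.\<close>
  define \<phi> where "\<phi> c l s = d * c s - l * (\<delta> (r 3) s - \<delta> (r 2) s)" for c :: "'k alg_closure \<Rightarrow> 'k alg_closure" and l s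
  define F where "F = (\<lambda>S s. if s \<in> S then 1 else 0) ` {S. S \<subseteq> orb x \<and> card S \<in> {1, 2, 3}} \<union>
     (\<lambda>(q, q') s. \<delta> q s - \<delta> q' s) ` {(q, q') \<in> orb x \<times> orb x. q \<noteq> q'} \<union>
     {\<phi> c24 (\<beta> 4 - \<beta> 2), \<phi> c35 (\<beta> 5 - \<beta> 3), \<phi> c124 (\<beta> 1 + \<beta> 2 + \<beta> 4), \<phi> c135 (\<beta> 1 + \<beta> 3 + \<beta> 5)}"
  have "finite {S. S \<subseteq> orb x \<and> card S \<in> {1, 2, 3}}" "finite {(q, q') \<in> orb x \<times> orb x. q \<noteq> q'}"
    using fin by (auto intro: finite_subset[of _ "Pow (orb x)"] finite_subset[of _ "orb x \<times> orb x"])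
  then have finF: "finite F" by (simp add: F_def)
  have nc1: "nonconst_on (orb x) (\<lambda>s. if s \<in> S then 1 else 0 :: 'k alg_closure)" if S: "S \<subseteq> orb x" "card S \<in> {1, 2, 3}" for S
  proof -
    have "S \<noteq> {}" using S(2) by auto
    then obtain s where s: "s \<in> S" by blast
    have "S \<noteq> orb x" using S(2) card by auto
    then obtain s' where "s' \<in> orb x" "s' \<notin> S" using S(1) by blast
    then show ?thesis using s S(1) unfolding nonconst_on_def by (intro bexI[of _ s] bexI[of _ s']) auto
  qed
  have nc2: "nonconst_on (orb x) (\<lambda>s. \<delta> q s - \<delta> q' s)" if q: "q \<in> orb x" "q' \<in> orb x" "q \<noteq> q'" for q q'
  proof -
    have "\<not> orb x \<subseteq> {q, q'}"
    proof
      assume "orb x \<subseteq> {q, q'}"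
      then have "card (orb x) \<le> card {q, q'}" by (intro card_mono) auto
      then show False using card q(3) by simp
    qed
    then obtain s where "s \<in> orb x" "s \<noteq> q" "s \<noteq> q'" by blast
    then show ?thesis using q unfolding nonconst_on_def by (intro bexI[of _ q] bexI[of _ s]) (auto simp: \<delta>_def)
  qed
  have nc3: "nonconst_on (orb x) (\<phi> c24 l)" "nonconst_on (orb x) (\<phi> c35 l)" "nonconst_on (orb x) (\<phi> c124 l)"
    "nonconst_on (orb x) (\<phi> c135 l)" for l
    by (rule ncI[of 4 1] ncI[of 5 1] ncI[of 1 5] ncI[of 1 4]; simp add: \<phi>_def c24_def c35_def c124_def c135_def \<delta>_def req d)+
  have "nonconst_on (orb x) \<mu>" if "\<mu> \<in> F" for \<mu>
    using that nc1 nc2 nc3 unfolding F_def by auto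
  then obtain U :: "'k poly" where U: "(\<Sum>s\<in>orb x. kval U s) = 0"
    and UF: "\<And>\<mu>. \<mu> \<in> F \<Longrightarrow> (\<Sum>s\<in>orb x. \<mu> s * kval U s) \<noteq> 0"
    using trace_zero_avoid[OF inf perf finF] by blast
  define \<alpha> where "\<alpha> i = kval U (r i)" for i
  have U1: "(\<Sum>s\<in>S. kval U s) \<noteq> 0" if "S \<subseteq> orb x" "card S \<in> {1, 2, 3}" for S
  proof -
    have "(\<lambda>s. if s \<in> S then 1 else 0) \<in> F" unfolding F_def using that by blast
    from UF[OF this] show ?thesis using sum_indicator_set_mult[OF fin that(1), of "kval U"] by simp
  qed
  have U2: "kval U s \<noteq> kval U s'" if "s \<in> orb x" "s' \<in> orb x" "s \<noteq> s'" for s s'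
  proof -
    have "(\<lambda>q. \<delta> s q - \<delta> s' q) \<in> F" unfolding F_def using that by (intro UnI1 UnI2 image_eqI[of _ _ "(s, s')"]) auto
    from UF[OF this] show ?thesis using that by (simp add: left_diff_distrib sum_subtractf \<delta>)
  qed
  have \<phi>U: "(\<Sum>s\<in>orb x. \<phi> c l s * kval U s) = d * (\<Sum>s\<in>orb x. c s * kval U s) - l * (\<alpha> 3 - \<alpha> 2)" for c l
  proof -
    have "(\<Sum>s\<in>orb x. \<phi> c l s * kval U s) = (\<Sum>s\<in>orb x. d * (c s * kval U s)
        - (l * (\<delta> (r 3) s * kval U s) - l * (\<delta> (r 2) s * kval U s)))"
      by (intro sum.cong) (simp_all add: \<phi>_def algebra_simps)
    also have "\<dots> = d * (\<Sum>s\<in>orb x. c s * kval U s)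
        - (l * (\<Sum>s\<in>orb x. \<delta> (r 3) s * kval U s) - l * (\<Sum>s\<in>orb x. \<delta> (r 2) s * kval U s))"
      by (simp only: sum_subtractf sum_distrib_left)
    finally show ?thesis by (simp only: \<delta>[OF ro(3)] \<delta>[OF ro(2)] \<alpha>_def right_diff_distrib)
  qed
  have f: "\<phi> c24 (\<beta> 4 - \<beta> 2) \<in> F" "\<phi> c35 (\<beta> 5 - \<beta> 3) \<in> F" "\<phi> c124 (\<beta> 1 + \<beta> 2 + \<beta> 4) \<in> F" "\<phi> c135 (\<beta> 1 + \<beta> 3 + \<beta> 5) \<in> F"
    by (simp_all add: F_def)
  have k: "d * (\<alpha> 4 - \<alpha> 2) - (\<beta> 4 - \<beta> 2) * (\<alpha> 3 - \<alpha> 2) \<noteq> 0"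
    "d * (\<alpha> 5 - \<alpha> 3) - (\<beta> 5 - \<beta> 3) * (\<alpha> 3 - \<alpha> 2) \<noteq> 0"
    "d * (\<alpha> 1 + \<alpha> 2 + \<alpha> 4) - (\<beta> 1 + \<beta> 2 + \<beta> 4) * (\<alpha> 3 - \<alpha> 2) \<noteq> 0"
    "d * (\<alpha> 1 + \<alpha> 3 + \<alpha> 5) - (\<beta> 1 + \<beta> 3 + \<beta> 5) * (\<alpha> 3 - \<alpha> 2) \<noteq> 0"
    using UF[OF f(1)] UF[OF f(2)] UF[OF f(3)] UF[OF f(4)] ro unfolding \<phi>U
    by (simp_all add: c24_def c35_def c124_def c135_def left_diff_distrib distrib_right sum_subtractf sum.distrib \<delta> \<alpha>_def)
  \<comment> \<open>The parameter at which the points 2 and 3 collide.\<close>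
  define t0 where "t0 = - (\<alpha> 3 - \<alpha> 2) / d"
  have t0: "d * t0 = - (\<alpha> 3 - \<alpha> 2)" using d by (simp add: t0_def)
  define s where "s i = \<alpha> i + t0 * \<beta> i" for i
  have "s 3 - s 2 = (\<alpha> 3 - \<alpha> 2) + d * t0" by (simp add: s_def d_def algebra_simps)
  then have num: "cross_num s = 0" unfolding t0 by (simp add: cross_num_def)
  have ds: "d * (s 4 - s 2) = d * (\<alpha> 4 - \<alpha> 2) - (\<beta> 4 - \<beta> 2) * (\<alpha> 3 - \<alpha> 2)"
    "d * (s 5 - s 3) = d * (\<alpha> 5 - \<alpha> 3) - (\<beta> 5 - \<beta> 3) * (\<alpha> 3 - \<alpha> 2)"
    "d * (s 1 + s 2 + s 4) = d * (\<alpha> 1 + \<alpha> 2 + \<alpha> 4) - (\<beta> 1 + \<beta> 2 + \<beta> 4) * (\<alpha> 3 - \<alpha> 2)"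
    "d * (s 1 + s 3 + s 5) = d * (\<alpha> 1 + \<alpha> 3 + \<alpha> 5) - (\<beta> 1 + \<beta> 3 + \<beta> 5) * (\<alpha> 3 - \<alpha> 2)"
  proof -
    have "d * (p + t0 * b) = d * p - b * (\<alpha> 3 - \<alpha> 2)" for p b
    proof -
      have "d * (p + t0 * b) = d * p + d * t0 * b" by (simp add: algebra_simps)
      then show ?thesis unfolding t0 by (simp add: algebra_simps)
    qed
    then have e: "d * (\<alpha> i + t0 * \<beta> i) = d * \<alpha> i - \<beta> i * (\<alpha> 3 - \<alpha> 2)" for i by blast
    show "d * (s 4 - s 2) = d * (\<alpha> 4 - \<alpha> 2) - (\<beta> 4 - \<beta> 2) * (\<alpha> 3 - \<alpha> 2)"
      "d * (s 5 - s 3) = d * (\<alpha> 5 - \<alpha> 3) - (\<beta> 5 - \<beta> 3) * (\<alpha> 3 - \<alpha> 2)"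
      "d * (s 1 + s 2 + s 4) = d * (\<alpha> 1 + \<alpha> 2 + \<alpha> 4) - (\<beta> 1 + \<beta> 2 + \<beta> 4) * (\<alpha> 3 - \<alpha> 2)"
      "d * (s 1 + s 3 + s 5) = d * (\<alpha> 1 + \<alpha> 3 + \<alpha> 5) - (\<beta> 1 + \<beta> 3 + \<beta> 5) * (\<alpha> 3 - \<alpha> 2)"
      unfolding s_def right_diff_distrib[of d "_ + _"] distrib_left[of d "_ + _"] e by (simp_all add: algebra_simps)
  qed
  have "d * (s 4 - s 2) \<noteq> 0" "d * (s 5 - s 3) \<noteq> 0" "d * (s 1 + s 2 + s 4) \<noteq> 0" "d * (s 1 + s 3 + s 5) \<noteq> 0"
    unfolding ds by (rule k)+
  then have "cross_den s \<noteq> 0" by (simp add: cross_den_def)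
  moreover have "inj_on r {1..5}" by (auto simp: inj_on_def req)
  moreover have "r ` {1..5} \<subseteq> orb x" using r by auto
  moreover have "inj_on (kval U) (orb x)" using U2 by (meson inj_onI)
  moreover have "\<forall>S. S \<subseteq> orb x \<longrightarrow> card S \<in> {1, 2, 3} \<longrightarrow> (\<Sum>s\<in>S. kval U s) \<noteq> 0" using U1 by blast
  ultimately show ?thesis using that[of r U V t0] U V(1) num unfolding s_def \<alpha>_def \<beta>_def by blast
qed

lemma poly_cross: "poly (cross_num g) z = cross_num (\<lambda>i. poly (g i) z)" "poly (cross_den g) z = cross_den (\<lambda>i. poly (g i) z)"
  by (simp_all add: cross_num_def cross_den_def)

lemma eight_points_image:
  fixes g :: "'b \<Rightarrow> 'a::alg_closed_field"
  assumes "card A = 8" "inj_on g A" "sum g A = 0" "\<And>S. S \<subseteq> A \<Longrightarrow> card S \<in> {1, 2, 3} \<Longrightarrow> sum g S \<noteq> 0"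
  shows "eight_points (g ` A)"
proof
  show "card (g ` A) = 8" using assms(1,2) by (simp add: card_image)
  show "\<Sum>(g ` A) = 0" using assms(2,3) by (simp add: sum.reindex)
  fix S assume S: "S \<subseteq> g ` A" "card S \<in> {1, 2, 3}"
  then obtain B where B: "B \<subseteq> A" "S = g ` B" by (metis subset_imageE)
  have "inj_on g B" using assms(2) B(1) by (rule inj_on_subset)
  then show "\<Sum>S \<noteq> 0" using assms(4)[OF B(1)] S(2) B(2) by (simp add: card_image sum.reindex)
qed

text \<open>The domain is covered by finite sets indexed by the infinite image, and such a union has
  at most the cardinality of the index set.\<close>

lemma lepoll_of_finite_fibres:
  fixes f :: "'a \<Rightarrow> 'b"
  assumes inf: "infinite (UNIV :: 'a set)" and bad: "finite (- G)" and f: "f ` G \<subseteq> B"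
    and fib: "\<And>u. u \<in> G \<Longrightarrow> finite {t \<in> G. f t = f u}"
  shows "lepoll (UNIV :: 'a set) B"
proof -
  have infG: "infinite G"
  proof
    assume "finite G"
    then have "finite (G \<union> - G)" using bad by (rule finite_UnI)
    then show False using inf by simp
  qed
  \<comment> \<open>The finitely many points outside \<open>G\<close> are added to every fibre, so
    that the sets cover the whole domain.\<close>
  define A where "A q = {t \<in> G. f t = q} \<union> - G" for q
  have finA: "finite (A q)" if "q \<in> f ` G" for q using that fib bad by (auto simp: A_def)
  have infI: "infinite (f ` G)"
  proof
    assume "finite (f ` G)"
    then have "finite (\<Union>q\<in>f ` G. A q)" using finA by blast
    moreover have "G \<subseteq> (\<Union>q\<in>f ` G. A q)" by (auto simp: A_def)
    ultimately show False using infG finite_subset by blast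
  qed
  have "f ` G \<noteq> {}" using infI by auto
  then have U: "(\<Union>q\<in>f ` G. A q) = UNIV" by (auto simp: A_def)
  have "(card_of (\<Union>q\<in>f ` G. A q), card_of (f ` G)) \<in> ordLeq"
  proof (rule card_of_UNION_ordLeq_infinite[OF infI])
    show "(card_of (f ` G), card_of (f ` G)) \<in> ordLeq" by (rule card_of_mono1) simp
    show "\<forall>q\<in>f ` G. (card_of (A q), card_of (f ` G)) \<in> ordLeq"
    proof
      fix q assume "q \<in> f ` G"
      then have "lepoll (A q) (f ` G)" using finA infI by (intro finite_lepoll_infinite)
      then show "(card_of (A q), card_of (f ` G)) \<in> ordLeq" by (simp add: lepoll_def card_of_ordLeq)
    qed
  qed
  then obtain h where "inj_on h (UNIV :: 'a set)" "h ` UNIV \<subseteq> f ` G"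
    unfolding U by (auto simp: card_of_ordLeq[symmetric])
  then show ?thesis unfolding lepoll_def using f by blast
qed

theorem corollary4p11:
  assumes "infinite (UNIV :: 'k::field set)"
    and "perfect_field TYPE('k::field)"
    and "\<exists>L :: 'k::field alg_closure set. galois_ext L \<and> ext_degree L = 8"
  shows "lepoll (UNIV :: 'k::field set)
    ((bertini_involutions 8 :: ('k::field poly3 ^ 3) set set) // PGL3_conj)"
proof -
  note inf = assms(1) and perf = assms(2)
  obtain L :: "'k alg_closure set" where "intermediate_field L" "ext_degree L = 8"
    using assms(3) by (auto simp: galois_ext_def)
  then obtain x :: "'k alg_closure" where x: "card (orb x) = 8"
    using generator_of_degree[OF inf perf, of L 8] by auto
  obtain U V :: "'k poly" and r :: "nat \<Rightarrow> 'k alg_closure" and t0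
    where r': "r ` {1..5} \<subseteq> orb x" "inj_on r {1..5}"
    and tr: "(\<Sum>s\<in>orb x. kval U s) = 0" "(\<Sum>s\<in>orb x. kval V s) = 0"
    and U1: "\<forall>S. S \<subseteq> orb x \<longrightarrow> card S \<in> {1, 2, 3} \<longrightarrow> (\<Sum>s\<in>S. kval U s) \<noteq> 0"
    and U2: "inj_on (kval U) (orb x)"
    and t0: "cross_num (\<lambda>i. kval U (r i) + t0 * kval V (r i)) = 0"
      "cross_den (\<lambda>i. kval U (r i) + t0 * kval V (r i)) \<noteq> 0"
    by (rule generic_family[OF inf perf x])
  have r: "i \<in> {1..5} \<Longrightarrow> r i \<in> orb x" "inj_on r {1..5}" for i using r' by auto
  define W where "W t = U + smult t V" for t
  have W: "kval (W t) s = kval U s + to_ac t * kval V s" for t s unfolding W_def by (rule kval_lin)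
  have Wsum: "(\<Sum>s\<in>S. kval (W t) s) = (\<Sum>s\<in>S. kval U s) + to_ac t * (\<Sum>s\<in>S. kval V s)" for t S
    unfolding W by (simp add: sum.distrib sum_distrib_left)
  define y where "y t = kval (W t) x" for t
  have orb_y: "orb (y t) = kval (W t) ` orb x" for t unfolding y_def by (rule orb_kval[symmetric])
  define G where "G = {t. inj_on (kval (W t)) (orb x) \<and>
     (\<forall>S. S \<subseteq> orb x \<longrightarrow> card S \<in> {1, 2, 3} \<longrightarrow> (\<Sum>s\<in>S. kval (W t) s) \<noteq> 0)}"
  have fin: "finite (orb x)" by (rule finite_orb)
  have finG: "finite (- G)"
  proof -
    let ?A = "{S. S \<subseteq> orb x \<and> card S \<in> {1, 2, 3}}" and ?B = "{(s, s') \<in> orb x \<times> orb x. s \<noteq> s'}"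
    have "- G \<subseteq> (\<Union>S\<in>?A. {t. (\<Sum>s\<in>S. kval U s) + to_ac t * (\<Sum>s\<in>S. kval V s) = 0}) \<union>
       (\<Union>p\<in>?B. {t. (kval U (fst p) - kval U (snd p)) + to_ac t * (kval V (fst p) - kval V (snd p)) = 0})"
    proof
      fix t assume "t \<in> - G"
      then consider S where "S \<in> ?A" "(\<Sum>s\<in>S. kval (W t) s) = 0"
        | s s' where "(s, s') \<in> ?B" "kval (W t) s = kval (W t) s'"
        unfolding G_def inj_on_def by auto
      then show "t \<in> (\<Union>S\<in>?A. {t. (\<Sum>s\<in>S. kval U s) + to_ac t * (\<Sum>s\<in>S. kval V s) = 0}) \<union>
       (\<Union>p\<in>?B. {t. (kval U (fst p) - kval U (snd p)) + to_ac t * (kval V (fst p) - kval V (snd p)) = 0})"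
      proof cases
        case 1 then show ?thesis unfolding Wsum by blast
      next
        case 2
        then have "(kval U s - kval U s') + to_ac t * (kval V s - kval V s') = 0"
          unfolding W by (simp add: algebra_simps)
        then show ?thesis using 2(1) by (intro UnI2 UN_I[of "(s, s')"]) simp_all
      qed
    qed
    moreover have "finite ?A" "finite ?B"
      using fin by (auto intro: finite_subset[of _ "Pow (orb x)"] finite_subset[of _ "orb x \<times> orb x"])
    then have "finite ((\<Union>S\<in>?A. {t. (\<Sum>s\<in>S. kval U s) + to_ac t * (\<Sum>s\<in>S. kval V s) = 0}) \<union>
       (\<Union>p\<in>?B. {t. (kval U (fst p) - kval U (snd p)) + to_ac t * (kval V (fst p) - kval V (snd p)) = 0}))"
      using U1 U2 by (intro finite_UnI finite_UN_I linear_zeros_finite) (auto simp: inj_on_def)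
    ultimately show ?thesis by (rule finite_subset)
  qed
  have E: "eight_points (orb (y t))" if "t \<in> G" for t
    unfolding orb_y using that x tr Wsum[of t "orb x"] by (intro eight_points_image) (auto simp: G_def)
  have "\<exists>b. t \<in> G \<longrightarrow> (\<lambda>i. to_ac (b i)) = coeff (eight_points.fpoly (orb (y t))) \<and>
     bertini_map b \<in> bertini_involutions 8" for t
    using bertini_of_orbit[OF inf perf E] by metis
  then obtain b where b: "\<And>t. t \<in> G \<Longrightarrow> (\<lambda>i. to_ac (b t i)) = coeff (eight_points.fpoly (orb (y t)))"
    and bert: "\<And>t. t \<in> G \<Longrightarrow> bertini_map (b t) \<in> bertini_involutions 8" by metis
  define f where "f t = PGL3_conj `` {bertini_map (b t)}" for t
  have fib: "finite {t \<in> G. f t = f u}" if u: "u \<in> G" for u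
  proof -
    \<comment> \<open>Systems of possible images of five points; restricting the functions to the
      five indices keeps their number finite.\<close>
    define Q where "Q = ({1..5::nat} \<rightarrow>\<^sub>E insert 0 (orb (y u)))"
    define N where "N q = det3 (cpt (q 1)) (cpt (q 2)) (cpt (q 3)) * det3 (cpt (q 1)) (cpt (q 4)) (cpt (q 5))"
      for q :: "nat \<Rightarrow> 'k alg_closure"
    define D where "D q = det3 (cpt (q 1)) (cpt (q 2)) (cpt (q 4)) * det3 (cpt (q 1)) (cpt (q 3)) (cpt (q 5))"
      for q :: "nat \<Rightarrow> 'k alg_closure"
    define g where "g i = [:kval U (r i), kval V (r i):]" for i
    define P where "P q = smult (N q) (cross_den g) - smult (D q) (cross_num g)" for q
    have P: "poly (P q) z = N q * cross_den (\<lambda>i. kval U (r i) + z * kval V (r i))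
        - D q * cross_num (\<lambda>i. kval U (r i) + z * kval V (r i))" for q z
      by (simp add: P_def poly_cross g_def)
    \<comment> \<open>At \<open>t0\<close> only the term with \<open>cross_den\<close> survives, so
      the equation is not an identity in the parameter.\<close>
    have P0: "P q \<noteq> 0" if "N q \<noteq> 0" for q
    proof
      assume "P q = 0"
      then have "poly (P q) t0 = 0" by simp
      then show False unfolding P using t0 that by simp
    qed
    have finQ: "finite Q" unfolding Q_def by (intro finite_PiE) (auto simp: finite_orb)
    have "{t \<in> G. f t = f u} \<subseteq> (\<Union>q\<in>{q \<in> Q. N q \<noteq> 0}. to_ac -` {z. poly (P q) z = 0})"
    proof
      fix t assume "t \<in> {t \<in> G. f t = f u}"
      then have t: "t \<in> G" "f t = f u" by auto
      have "b u 0 \<noteq> 0" using fun_cong[OF b[OF u], of 0] eight_points.a_0_nonzero[OF E[OF u]] by auto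
      then have "(bertini_map (b u), bertini_map (b u)) \<in> PGL3_conj"
        unfolding bertini_map_def by (intro PGL3_conj_refl[OF inf] bert_triple_nonzero(1)[OF inf])
      then have "(bertini_map (b t), bertini_map (b u)) \<in> PGL3_conj" using t(2) unfolding f_def by blast
      then obtain M M' :: "'k alg_closure ^ 3 ^ 3" where M: "M ** M' = mat 1"
        and q: "\<And>s. s \<in> orb (y t) \<Longrightarrow> \<exists>q\<in>insert 0 (orb (y u)). \<exists>e. e \<noteq> 0 \<and> M *v cpt s = e *s cpt q"
        using conjugate_points[OF inf perf E[OF t(1)] E[OF u] b[OF t(1)] b[OF u]] by blast
      define s where "s i = kval (W t) (r i)" for i
      have inj: "inj_on (kval (W t)) (orb x)" using t(1) by (simp add: G_def)
      have sne: "s i \<noteq> s j" if "i \<in> {1..5}" "j \<in> {1..5}" "i \<noteq> j" for i j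
        using inj_onD[OF inj, of "r i" "r j"] inj_onD[OF r(2), of i j] r(1) that unfolding s_def by blast
      have s3: "s i + s j + s k \<noteq> 0" if "i \<in> {1..5}" "j \<in> {1..5}" "k \<in> {1..5}" "i \<noteq> j" "i \<noteq> k" "j \<noteq> k" for i j k
      proof -
        have ne: "r i \<noteq> r j" "r i \<noteq> r k" "r j \<noteq> r k" using inj_onD[OF r(2)] that by blast+
        then have "card {r i, r j, r k} = 3" "(\<Sum>z\<in>{r i, r j, r k}. kval (W t) z) = s i + s j + s k"
          by (simp_all add: s_def)
        moreover have "{r i, r j, r k} \<subseteq> orb x" using r(1) that by blast
        ultimately show ?thesis using t(1) unfolding G_def by fastforce
      qed
      have "\<exists>z e. i \<in> {1..5} \<longrightarrow> z \<in> insert 0 (orb (y u)) \<and> e \<noteq> 0 \<and> M *v cpt (s i) = e *s cpt z" for i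
        using q[of "s i"] r(1)[of i] unfolding orb_y s_def by blast
      then obtain q0 e0 where qe: "\<And>i. i \<in> {1..5} \<Longrightarrow> q0 i \<in> insert 0 (orb (y u)) \<and> e0 i \<noteq> 0 \<and> M *v cpt (s i) = e0 i *s cpt (q0 i)"
        by metis
      define q where "q = restrict q0 {1..5}"
      define e where "e i = (if i \<in> {1..5} then e0 i else 1)" for i
      have e: "e i \<noteq> 0" "\<forall>i\<in>{1..5}. M *v cpt (s i) = e i *s cpt (q i)" for i
        using qe by (simp_all add: e_def q_def)
      have d: "s 2 \<noteq> s 1" "s 3 \<noteq> s 1" "s 4 \<noteq> s 1" "s 5 \<noteq> s 1" by (rule sne; simp)+
      \<comment> \<open>General position for t in \<open>G\<close> leaves only systems q with
        nonzero \<open>N q\<close>, for which \<open>P0\<close> applies.\<close>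
      have "cross_num s \<noteq> 0"
        unfolding cross_num_def using sne[of 3 2] sne[of 5 4] s3[of 1 2 3] s3[of 1 4 5] by simp
      then have "N q \<noteq> 0" unfolding N_def by (rule cross_ratio_invariant(2)[where e = e, OF M e d])
      moreover have "N q * cross_den s = D q * cross_num s"
        unfolding N_def D_def by (rule cross_ratio_invariant(1)[where e = e, OF M e d])
      then have "poly (P q) (to_ac t) = 0" unfolding P s_def W by simp
      moreover have "q \<in> Q" using qe by (auto simp: Q_def q_def)
      ultimately show "t \<in> (\<Union>q\<in>{q \<in> Q. N q \<noteq> 0}. to_ac -` {z. poly (P q) z = 0})" by blast
    qed
    moreover have "finite (\<Union>q\<in>{q \<in> Q. N q \<noteq> 0}. to_ac -` {z. poly (P q) z = 0})"
      using finQ P0 by (intro finite_UN_I finite_vimageI poly_roots_finite inj_to_ac) auto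
    ultimately show ?thesis by (rule finite_subset)
  qed
  have "f ` G \<subseteq> bertini_involutions 8 // PGL3_conj"
    unfolding f_def using bert by (auto intro: quotientI)
  then show ?thesis by (rule lepoll_of_finite_fibres[OF inf finG _ fib])
qed

end
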